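(* Let $d,p\in\mathbb N$, and let $\mathbf a,\mathbf b\in\mathbb R^d$ and $T>0$ be fixed. Let $(\mathbf Z_t)_{t\ge0}$ be the $d$-dimensional linear process given by the stochastic differential equation $$\mathrm d\mathbf Z_t=\big(Q(t)\mathbf Z_t+\mathbf r(t)\big)\,\mathrm dt+\Sigma(t)\,\mathrm d\mathbf B_t,\qquad t\ge0,$$ with initial condition $\mathbf Z_0=\mathbf a$, and assume that the matrices $\kappa(s,t)$ (defined in the context) are positive definite for all $0\le s<t$. Let $n\in\mathbb N$ and $0<t_1<t_2<\dots<t_n<T$. Then the conditional distribution of $(\mathbf Z_{t_1}^\top,\dots,\mathbf Z_{t_n}^\top)^\top$ given $\mathbf Z_T=\mathbf b$ equals the distribution of $(\mathbf U_{t_1}^\top,\dots,\mathbf U_{t_n}^\top)^\top$, where $(\mathbf U_t)_{t\in[0,T]}$ is the linear process bridge from $\mathbf a$ to $\mathbf b$ over $[0,T]$ derived from $(\mathbf Z_t)_{t\ge0}$.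
   Context: $Q:\mathbb R_+\to\mathbb R^{d\times d}$, $\Sigma:\mathbb R_+\to\mathbb R^{d\times p}$, $\mathbf r:\mathbb R_+\to\mathbb R^d$ are continuous functions, and $(\mathbf B_t)_{t\ge0}$ is a $p$-dimensional standard Wiener process on a filtered probability space satisfying the usual conditions. Evolution matrices: $E(t,s)\in\mathbb R^{d\times d}$, $s,t\ge0$, is the unique solution of $\partial_1E(t,s)=Q(t)E(t,s)$, $E(s,s)=I_d$. One has $E(t,s)E(s,r)=E(t,r)$ and $E(t,s)^{-1}=E(s,t)$. For $0\le s\le t$: $\kappa(s,t):=\int_s^tE(t,u)\Sigma(u)\Sigma(u)^\top E(t,u)^\top\,\mathrm du$ and $\Gamma(s,t):=E(s,t)\kappa(s,t)=\int_s^tE(s,u)\Sigma(u)\Sigma(u)^\top E(t,u)^\top\,\mathrm du$. For $\mathbf x\in\mathbb R^d$, $0\le s\le t$: $\mathbf m^+_{\mathbf x}(s,t):=\mathbf x+\int_s^tE(s,u)\mathbf r(u)\,\mathrm du$ and $\mathbf m^-_{\mathbf x}(s,t):=\mathbf x-\int_s^tE(t,u)\mathbf r(u)\,\mathrm du$. For $0\le s\le t<T$: $$\mathbf n_{\mathbf a,\mathbf b}(s,t):=\Gamma(t,T)\Gamma(s,T)^{-1}\mathbf m^+_{\mathbf a}(s,t)+\Gamma(s,t)^\top\big(\Gamma(s,T)^\top\big)^{-1}\mathbf m^-_{\mathbf b}(t,T).$$ The linear process bridge from $\mathbf a$ to $\mathbf b$ over $[0,T]$ derived from $\mathbf Z$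 is the almost surely continuous process $(\mathbf U_t)_{t\in[0,T]}$ with $$\mathbf U_t=\mathbf n_{\mathbf a,\mathbf b}(0,t)+\Gamma(t,T)\int_0^t\Gamma(u,T)^{-1}\Sigma(u)\,\mathrm d\mathbf B_u,\quad t\in[0,T),\qquad \mathbf U_T=\mathbf b.$$ Conditional distributions of jointly Gauss vectors given $\mathbf Z_T=\mathbf b$ are understood in the usual sense: for jointly Gauss $(\mathbf X,\mathbf W)$ with $\mathrm{Cov}(\mathbf W,\mathbf W)$ invertible, the regular conditional distribution of $\mathbf X$ given $\mathbf W=\mathbf w$ is the version that is Gauss with mean $\mathsf E\mathbf X+\mathrm{Cov}(\mathbf X,\mathbf W)\mathrm{Cov}(\mathbf W,\mathbf W)^{-1}(\mathbf w-\mathsf E\mathbf W)$ and covariance matrix $\mathrm{Cov}(\mathbf X,\mathbf X)-\mathrm{Cov}(\mathbf X,\mathbf W)\mathrm{Cov}(\mathbf W,\mathbf W)^{-1}\mathrm{Cov}(\mathbf X,\mathbf W)^\top$. *)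

theory Defs
  imports "HOL-Probability.Probability"
begin

section \<open>Gauss distributions and conditional distributions\<close>

definition pos_definite :: "real^'k^'k \<Rightarrow> bool" where
  "pos_definite A \<longleftrightarrow> transpose A = A \<and> (\<forall>x. x \<noteq> 0 \<longrightarrow> x \<bullet> (A *v x) > 0)"

text \<open>
  Defined through the characteristic function, so singular covariance matrices are allowed.
  The identity forces \<open>C\<close> to be positive semidefinite.
\<close>
definition is_gauss :: "(real^'k) measure \<Rightarrow> real^'k \<Rightarrow> real^'k^'k \<Rightarrow> bool" where
  "is_gauss N m C \<longleftrightarrow>
     prob_space N \<and> sets N = sets borel \<and> transpose C = C \<and>
     (\<forall>l. (\<integral>x. iexp (l \<bullet> x) \<partial>N)
           = exp (\<i> * complex_of_real (l \<bullet> m) - complex_of_real (l \<bullet> (C *v l)) / 2))"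

definition mean_vec :: "'w measure \<Rightarrow> ('w \<Rightarrow> real^'k) \<Rightarrow> real^'k" where
  "mean_vec M X = (\<chi> i. \<integral>\<omega>. X \<omega> $ i \<partial>M)"

definition cov_mat :: "'w measure \<Rightarrow> ('w \<Rightarrow> real^'k) \<Rightarrow> ('w \<Rightarrow> real^'m) \<Rightarrow> real^'m^'k" where
  "cov_mat M X W =
     (\<chi> i j. \<integral>\<omega>. (X \<omega> $ i - mean_vec M X $ i) * (W \<omega> $ j - mean_vec M W $ j) \<partial>M)"

definition stack :: "real^'k \<Rightarrow> real^'m \<Rightarrow> real^('k + 'm)" where
  "stack x w = (\<chi> s. case s of Inl i \<Rightarrow> x $ i | Inr j \<Rightarrow> w $ j)"

definition jointly_gauss :: "'w measure \<Rightarrow> ('w \<Rightarrow> real^'k) \<Rightarrow> ('w \<Rightarrow> real^'m) \<Rightarrow> bool" where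
  "jointly_gauss M X W \<longleftrightarrow>
     X \<in> borel_measurable M \<and> W \<in> borel_measurable M \<and>
     (\<exists>m C. is_gauss (distr M borel (\<lambda>\<omega>. stack (X \<omega>) (W \<omega>))) m C)"

definition regular_cond_distr ::
    "'w measure \<Rightarrow> ('w \<Rightarrow> real^'k) \<Rightarrow> ('w \<Rightarrow> real^'m) \<Rightarrow> (real^'m \<Rightarrow> (real^'k) measure) \<Rightarrow> bool" where
  "regular_cond_distr M X W K \<longleftrightarrow>
     K \<in> borel \<rightarrow>\<^sub>M prob_algebra borel \<and>
     (\<forall>A\<in>sets borel. \<forall>C\<in>sets borel.
        emeasure M {\<omega> \<in> space M. X \<omega> \<in> A \<and> W \<omega> \<in> C}
          = (\<integral>\<^sup>+w\<in>C. emeasure (K w) A \<partial>(distr M borel W)))"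

text \<open>
  The Gauss version of the regular conditional distribution; it is prescribed for every value
  \<open>w\<close> of \<open>W\<close>, so that conditioning on the null event \<open>W = w\<close> is unambiguous.
\<close>
definition gauss_cond_distr ::
    "'w measure \<Rightarrow> ('w \<Rightarrow> real^'k) \<Rightarrow> ('w \<Rightarrow> real^'m) \<Rightarrow> (real^'m \<Rightarrow> (real^'k) measure) \<Rightarrow> bool" where
  "gauss_cond_distr M X W K \<longleftrightarrow>
     jointly_gauss M X W \<and> invertible (cov_mat M W W) \<and>
     regular_cond_distr M X W K \<and>
     (\<forall>w. is_gauss (K w)
        (mean_vec M X + (cov_mat M X W ** matrix_inv (cov_mat M W W)) *v (w - mean_vec M W))
        (cov_mat M X X
           - cov_mat M X W ** matrix_inv (cov_mat M W W) ** transpose (cov_mat M X W)))"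


section \<open>Wiener process and Ito integral\<close>

text \<open>Time is \<open>[0, \<infinity>)\<close>; values of processes and filtrations at negative times are irrelevant.\<close>

definition usual_filtration :: "'w measure \<Rightarrow> (real \<Rightarrow> 'w measure) \<Rightarrow> bool" where
  "usual_filtration M F \<longleftrightarrow>
     prob_space M \<and> complete_measure M \<and>
     (\<forall>t\<ge>0. subalgebra M (F t)) \<and>
     (\<forall>s t. 0 \<le> s \<and> s \<le> t \<longrightarrow> sets (F s) \<subseteq> sets (F t)) \<and>
     (\<forall>t\<ge>0. (\<Inter>u\<in>{t<..}. sets (F u)) = sets (F t)) \<and>
     null_sets M \<subseteq> sets (F 0)"

definition wiener_process ::
    "'w measure \<Rightarrow> (real \<Rightarrow> 'w measure) \<Rightarrow> (real \<Rightarrow> 'w \<Rightarrow> real^'p) \<Rightarrow> bool" where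
  "wiener_process M F B \<longleftrightarrow>
     (\<forall>t\<ge>0. B t \<in> borel_measurable (F t)) \<and>
     (AE \<omega> in M. B 0 \<omega> = 0) \<and>
     (AE \<omega> in M. continuous_on {0..} (\<lambda>t. B t \<omega>)) \<and>
     (\<forall>s t. 0 \<le> s \<and> s < t \<longrightarrow>
        is_gauss (distr M borel (\<lambda>\<omega>. B t \<omega> - B s \<omega>)) 0 ((t - s) *\<^sub>R mat 1) \<and>
        prob_space.indep_set M (sets (F s))
          {(\<lambda>\<omega>. B t \<omega> - B s \<omega>) -` A \<inter> space M | A. A \<in> sets borel})"

text \<open>
  The simple process \<open>\<Sum>i<k. \<xi> i \<cdot> 1\<^bsub>(\<tau> i, \<tau> (i + 1)]\<^esub>\<close> on \<open>[0, t]\<close>, with bounded and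
  \<open>F (\<tau> i)\<close>-measurable coefficients \<open>\<xi> i\<close>.
\<close>
definition simple_integrand ::
    "'w measure \<Rightarrow> (real \<Rightarrow> 'w measure) \<Rightarrow> real \<Rightarrow>
     nat \<Rightarrow> (nat \<Rightarrow> real) \<Rightarrow> (nat \<Rightarrow> 'w \<Rightarrow> real^'p^'d) \<Rightarrow> bool" where
  "simple_integrand M F t k \<tau> \<xi> \<longleftrightarrow>
     0 \<le> \<tau> 0 \<and> \<tau> k \<le> t \<and>
     (\<forall>i<k. \<tau> i \<le> \<tau> (Suc i) \<and>
        \<xi> i \<in> borel_measurable (F (\<tau> i)) \<and> (\<exists>c. \<forall>\<omega>\<in>space M. norm (\<xi> i \<omega>) \<le> c))"

definition simple_value ::
    "nat \<Rightarrow> (nat \<Rightarrow> real) \<Rightarrow> (nat \<Rightarrow> 'w \<Rightarrow> real^'p^'d) \<Rightarrow> real \<Rightarrow> 'w \<Rightarrow> real^'p^'d" where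
  "simple_value k \<tau> \<xi> u \<omega> = (\<Sum>i<k. indicator {\<tau> i<..\<tau> (Suc i)} u *\<^sub>R \<xi> i \<omega>)"

definition simple_integral ::
    "(real \<Rightarrow> 'w \<Rightarrow> real^'p) \<Rightarrow>
     nat \<Rightarrow> (nat \<Rightarrow> real) \<Rightarrow> (nat \<Rightarrow> 'w \<Rightarrow> real^'p^'d) \<Rightarrow> 'w \<Rightarrow> real^'d" where
  "simple_integral B k \<tau> \<xi> \<omega> = (\<Sum>i<k. \<xi> i \<omega> *v (B (\<tau> (Suc i)) \<omega> - B (\<tau> i) \<omega>))"

text \<open>
  \<open>X\<close> is a version of \<open>\<integral>\<^sub>0\<^sup>t G dB\<close>: the mean-square limit of the integrals of simple processes that
  converge to \<open>G\<close> in mean square on \<open>[0, t] \<times> \<Omega>\<close>. This is meant for measurable adapted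
  square-integrable \<open>G\<close>; the norm on matrices is the Frobenius norm.
\<close>
definition has_ito_integral ::
    "'w measure \<Rightarrow> (real \<Rightarrow> 'w measure) \<Rightarrow> (real \<Rightarrow> 'w \<Rightarrow> real^'p) \<Rightarrow>
     (real \<Rightarrow> 'w \<Rightarrow> real^'p^'d) \<Rightarrow> real \<Rightarrow> ('w \<Rightarrow> real^'d) \<Rightarrow> bool" where
  "has_ito_integral M F B G t X \<longleftrightarrow>
     X \<in> borel_measurable M \<and>
     (\<exists>k \<tau> \<xi>.
        (\<forall>n. simple_integrand M F t (k n) (\<tau> n) (\<xi> n)) \<and>
        (\<lambda>n. \<integral>\<^sup>+\<omega>. (\<integral>\<^sup>+u\<in>{0..t}.
            ennreal ((norm (simple_value (k n) (\<tau> n) (\<xi> n) u \<omega> - G u \<omega>))\<^sup>2) \<partial>lborel) \<partial>M)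
          \<longlonglongrightarrow> 0 \<and>
        (\<lambda>n. \<integral>\<^sup>+\<omega>. ennreal ((norm (simple_integral B (k n) (\<tau> n) (\<xi> n) \<omega> - X \<omega>))\<^sup>2) \<partial>M)
          \<longlonglongrightarrow> 0)"

text \<open>The almost surely continuous integral process \<open>I t = \<integral>\<^sub>0\<^sup>t G dB\<close> with \<open>t\<close> ranging over \<open>S\<close>.\<close>
definition ito_integral_process ::
    "'w measure \<Rightarrow> (real \<Rightarrow> 'w measure) \<Rightarrow> (real \<Rightarrow> 'w \<Rightarrow> real^'p) \<Rightarrow>
     (real \<Rightarrow> 'w \<Rightarrow> real^'p^'d) \<Rightarrow> real set \<Rightarrow> (real \<Rightarrow> 'w \<Rightarrow> real^'d) \<Rightarrow> bool" where
  "ito_integral_process M F B G S I \<longleftrightarrow>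
     (\<forall>t\<in>S. has_ito_integral M F B G t (I t)) \<and>
     (AE \<omega> in M. continuous_on S (\<lambda>t. I t \<omega>))"


section \<open>Linear processes and linear process bridges\<close>

definition evolution_matrices :: "(real \<Rightarrow> real^'d^'d) \<Rightarrow> (real \<Rightarrow> real \<Rightarrow> real^'d^'d) \<Rightarrow> bool" where
  "evolution_matrices Q E \<longleftrightarrow>
     (\<forall>s\<ge>0. E s s = mat 1 \<and>
        (\<forall>t\<ge>0. ((\<lambda>v. E v s) has_vector_derivative (Q t ** E t s)) (at t within {0..})))"

definition kappa ::
    "(real \<Rightarrow> real \<Rightarrow> real^'d^'d) \<Rightarrow> (real \<Rightarrow> real^'p^'d) \<Rightarrow> real \<Rightarrow> real \<Rightarrow> real^'d^'d" where
  "kappa E \<Sigma> s t =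
     integral {s..t} (\<lambda>u. E t u ** \<Sigma> u ** transpose (\<Sigma> u) ** transpose (E t u))"

definition Gam ::
    "(real \<Rightarrow> real \<Rightarrow> real^'d^'d) \<Rightarrow> (real \<Rightarrow> real^'p^'d) \<Rightarrow> real \<Rightarrow> real \<Rightarrow> real^'d^'d" where
  "Gam E \<Sigma> s t = E s t ** kappa E \<Sigma> s t"

definition m_plus ::
    "(real \<Rightarrow> real \<Rightarrow> real^'d^'d) \<Rightarrow> (real \<Rightarrow> real^'d) \<Rightarrow> real^'d \<Rightarrow> real \<Rightarrow> real \<Rightarrow> real^'d" where
  "m_plus E r x s t = x + integral {s..t} (\<lambda>u. E s u *v r u)"

definition m_minus ::
    "(real \<Rightarrow> real \<Rightarrow> real^'d^'d) \<Rightarrow> (real \<Rightarrow> real^'d) \<Rightarrow> real^'d \<Rightarrow> real \<Rightarrow> real \<Rightarrow> real^'d" where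
  "m_minus E r x s t = x - integral {s..t} (\<lambda>u. E t u *v r u)"

definition bridge_mean ::
    "(real \<Rightarrow> real \<Rightarrow> real^'d^'d) \<Rightarrow> (real \<Rightarrow> real^'d) \<Rightarrow> (real \<Rightarrow> real^'p^'d) \<Rightarrow> real \<Rightarrow>
     real^'d \<Rightarrow> real^'d \<Rightarrow> real \<Rightarrow> real \<Rightarrow> real^'d" where
  "bridge_mean E r \<Sigma> T a b s t =
     (Gam E \<Sigma> t T ** matrix_inv (Gam E \<Sigma> s T)) *v m_plus E r a s t
     + (transpose (Gam E \<Sigma> s t) ** matrix_inv (transpose (Gam E \<Sigma> s T))) *v m_minus E r b t T"

text \<open>\<open>dZ = (Q Z + r) dt + \<Sigma> dB\<close>, \<open>Z\<^sub>0 = a\<close>, in integral form (strong solution).\<close>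
definition linear_process ::
    "'w measure \<Rightarrow> (real \<Rightarrow> 'w measure) \<Rightarrow> (real \<Rightarrow> 'w \<Rightarrow> real^'p) \<Rightarrow>
     (real \<Rightarrow> real^'d^'d) \<Rightarrow> (real \<Rightarrow> real^'d) \<Rightarrow> (real \<Rightarrow> real^'p^'d) \<Rightarrow> real^'d \<Rightarrow>
     (real \<Rightarrow> 'w \<Rightarrow> real^'d) \<Rightarrow> bool" where
  "linear_process M F B Q r \<Sigma> a Z \<longleftrightarrow>
     (\<forall>t\<ge>0. Z t \<in> borel_measurable (F t)) \<and>
     (AE \<omega> in M. continuous_on {0..} (\<lambda>t. Z t \<omega>)) \<and>
     (\<exists>I. ito_integral_process M F B (\<lambda>u \<omega>. \<Sigma> u) {0..} I \<and>
        (AE \<omega> in M. \<forall>t\<ge>0.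
           Z t \<omega> = a + integral {0..t} (\<lambda>s. Q s *v Z s \<omega> + r s) + I t \<omega>))"

definition linear_process_bridge ::
    "'w measure \<Rightarrow> (real \<Rightarrow> 'w measure) \<Rightarrow> (real \<Rightarrow> 'w \<Rightarrow> real^'p) \<Rightarrow>
     (real \<Rightarrow> real \<Rightarrow> real^'d^'d) \<Rightarrow> (real \<Rightarrow> real^'d) \<Rightarrow> (real \<Rightarrow> real^'p^'d) \<Rightarrow> real \<Rightarrow>
     real^'d \<Rightarrow> real^'d \<Rightarrow> (real \<Rightarrow> 'w \<Rightarrow> real^'d) \<Rightarrow> bool" where
  "linear_process_bridge M F B E r \<Sigma> T a b U \<longleftrightarrow>
     (\<forall>t\<in>{0..T}. U t \<in> borel_measurable M) \<and>
     (AE \<omega> in M. continuous_on {0..T} (\<lambda>t. U t \<omega>)) \<and>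
     (\<exists>I. ito_integral_process M F B (\<lambda>u \<omega>. matrix_inv (Gam E \<Sigma> u T) ** \<Sigma> u) {0..<T} I \<and>
        (AE \<omega> in M. \<forall>t\<in>{0..<T}.
           U t \<omega> = bridge_mean E r \<Sigma> T a b 0 t + Gam E \<Sigma> t T *v I t \<omega>)) \<and>
     (AE \<omega> in M. U T \<omega> = b)"

text \<open>
  The vectors \<open>X (t i)\<close> stacked into one vector of length \<open>n d\<close>, where \<open>n = CARD('n)\<close>: entry
  \<open>(i, k)\<close> is coordinate \<open>k\<close> of \<open>X (t i)\<close>.
\<close>
definition fdd_vec ::
    "('n::finite \<Rightarrow> real) \<Rightarrow> (real \<Rightarrow> 'w \<Rightarrow> real^'d) \<Rightarrow> 'w \<Rightarrow> real^('n \<times> 'd)" where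
  "fdd_vec t X \<omega> = (\<chi> s. X (t (fst s)) \<omega> $ snd s)"

end

theory Submission
  imports Defs
begin

text \<open>
  All processes involved are Wiener integrals of deterministic integrands: an Ito integral of a
  deterministic \<open>G\<close> is an \<open>L\<^sup>2\<close> limit of linear combinations of increments of \<open>B\<close>, and solving the
  linear equation path by path and integrating by parts gives
  \<open>Z t = E t 0 (a + \<integral>\<^sub>0\<^sup>t E 0 u r u du + \<integral>\<^sub>0\<^sup>t E 0 u \<Sigma> u dB)\<close>. Hence the finite-dimensional distributions of
  \<open>Z\<close> and \<open>U\<close> are Gauss, and only means and covariances have to be compared. With
  \<open>P t = \<integral>\<^sub>0\<^sup>t E 0 u \<Sigma> u (E 0 u \<Sigma> u)\<^sup>T du\<close> and \<open>J t = P T - P t\<close> one has \<open>Gam s T = E s 0 J s (E T 0)\<^sup>T\<close>, and since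
  \<open>J\<^sup>-\<^sup>1\<close> is a primitive of \<open>J\<^sup>-\<^sup>1 P' J\<^sup>-\<^sup>1\<close>, both covariances of the values at \<open>s \<le> t\<close> equal
  \<open>E s 0 (P s - P s (P T)\<^sup>-\<^sup>1 P t) (E t 0)\<^sup>T\<close>.
\<close>

section \<open>Characteristic functions determine measures\<close>

text \<open>Both processes are given only through properties that they satisfy, and the definition
  of the Ito integral admits random simple integrands, so nothing is Gauss by construction. The
  relation \<open>wiener_integral\<close> therefore ties a deterministic integrand to a given random
  variable instead of constructing an integral, and it is shown to hold for whatever version is
  supplied. Since \<open>is_gauss\<close> prescribes a characteristic function, singular covariances
  included, equality of laws requires uniqueness from characteristic functions in several
  dimensions; it is reduced to the real line by inserting half-spaces coordinate by coordinate.
  Existence of a Gauss conditional distribution is established as well, since a claim about all such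
  kernels could otherwise hold vacuously. Pulling every vector back to time 0 by
  \<open>E 0 t\<close> turns \<open>kappa\<close> over an interval into a difference of values of
  one matrix function between constant factors; the comparison of covariances then becomes matrix
  algebra, with inverses taken only at times before \<open>T\<close>, where the remaining noise is
  nondegenerate.\<close>

lemma integrable_bounded_mult_iexp:
  fixes M :: "(real^'n) measure" and h :: "real^'n \<Rightarrow> real"
  assumes "prob_space M" "sets M = sets borel" "h \<in> borel_measurable borel" "\<And>x. \<bar>h x\<bar> \<le> K"
  shows "integrable M (\<lambda>x. complex_of_real (h x) * iexp (l \<bullet> x))"
proof -
  interpret prob_space M by fact
  have [measurable_cong]: "sets M = sets borel" by fact
  note assms(3)[measurable]
  show ?thesis
    by (rule integrable_const_bound[where B=K]) (use assms(4) in \<open>auto simp: norm_mult\<close>)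
qed

text \<open>Splitting the cosine into two exponentials turns the positive weight into a combination
  of characters; the phase \<open>\<theta>\<close> survives only in constant factors.\<close>

lemma cos_as_iexp:
  "complex_of_real (1 + cos (x + \<theta>)) = 1 + (iexp \<theta> * iexp x + iexp (-\<theta>) * iexp (-x)) / 2"
  by (simp add: complex_eq_iff Re_exp Im_exp cos_add sin_add)

text \<open>The cosine moves the frequency \<open>m\<close> to \<open>m + l\<close> and
  \<open>m - l\<close>, so the transform of the weighted function is a combination of values of the
  transform of \<open>h\<close> at three frequencies. Agreement of the latter for two measures thus
  carries over to every weight.\<close>

lemma integral_mult_one_plus_cos_mult_iexp:
  fixes M :: "(real^'n) measure" and h :: "real^'n \<Rightarrow> real"
  assumes "prob_space M" "sets M = sets borel" "h \<in> borel_measurable borel" "\<And>x. \<bar>h x\<bar> \<le> K"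
  shows "(\<integral>x. complex_of_real (h x * (1 + cos (l \<bullet> x + \<theta>))) * iexp (m \<bullet> x) \<partial>M) =
     (\<integral>x. complex_of_real (h x) * iexp (m \<bullet> x) \<partial>M)
     + (iexp \<theta> * (\<integral>x. complex_of_real (h x) * iexp ((m + l) \<bullet> x) \<partial>M)
        + iexp (-\<theta>) * (\<integral>x. complex_of_real (h x) * iexp ((m - l) \<bullet> x) \<partial>M)) / 2"
proof -
  have eq: "complex_of_real (h x * (1 + cos (l \<bullet> x + \<theta>))) * iexp (m \<bullet> x) =
     complex_of_real (h x) * iexp (m \<bullet> x)
     + (iexp \<theta> * (complex_of_real (h x) * iexp ((m + l) \<bullet> x))
        + iexp (-\<theta>) * (complex_of_real (h x) * iexp ((m - l) \<bullet> x))) / 2" for x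
    unfolding of_real_mult[of "h x"] cos_as_iexp inner_left_distrib inner_diff_left
    by (simp add: ring_distribs exp_add exp_diff exp_minus field_simps)
  show ?thesis
    unfolding eq using integrable_bounded_mult_iexp[OF assms] by simp
qed

text \<open>
  Levy's one-dimensional theorem applies to positive measures only; multiplying by
  \<open>1 + cos (l \<bullet> x + \<theta>)\<close> instead of \<open>iexp (l \<bullet> x)\<close> keeps the weights nonnegative.
\<close>
lemma char_fn_half_space:
  fixes M N :: "(real^'n) measure" and h :: "real^'n \<Rightarrow> real"
  assumes M: "prob_space M" "sets M = sets borel" and N: "prob_space N" "sets N = sets borel"
    and h[measurable]: "h \<in> borel_measurable borel" and h0: "\<And>x. 0 \<le> h x" and h1: "\<And>x. h x \<le> 1"
    and eq: "\<And>l. (\<integral>x. complex_of_real (h x) * iexp (l \<bullet> x) \<partial>M) = (\<integral>x. complex_of_real (h x) * iexp (l \<bullet> x) \<partial>N)"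
  shows "(\<integral>x. complex_of_real (h x * indicator {..c} (x $ j)) * iexp (l \<bullet> x) \<partial>M)
       = (\<integral>x. complex_of_real (h x * indicator {..c} (x $ j)) * iexp (l \<bullet> x) \<partial>N)"
proof -
  interpret M: prob_space M by fact
  interpret N: prob_space N by fact
  have [measurable_cong]: "sets M = sets borel" "sets N = sets borel" by fact+
  have nth[measurable]: "(\<lambda>x. x $ j) \<in> borel_measurable (borel :: (real^'n) measure)"
    by (intro borel_measurable_continuous_onI continuous_intros)
  define w where "w l \<theta> x = h x * (1 + cos (l \<bullet> x + \<theta>))" for l x :: "real^'n" and \<theta>
  have w[measurable]: "w l \<theta> \<in> borel_measurable borel" for l \<theta> unfolding w_def by measurable
  have w0: "0 \<le> w l \<theta> x" for l \<theta> x
    using cos_ge_minus_one[of "l \<bullet> x + \<theta>"] unfolding w_def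
    by (intro mult_nonneg_nonneg h0) linarith
  have w2: "w l \<theta> x \<le> 2" for l \<theta> x
  proof -
    have "w l \<theta> x \<le> 1 * (1 + cos (l \<bullet> x + \<theta>))"
      unfolding w_def using h1[of x] cos_ge_minus_one[of "l \<bullet> x + \<theta>"] by (intro mult_right_mono) linarith+
    also have "\<dots> \<le> 2" using cos_le_one[of "l \<bullet> x + \<theta>"] by simp
    finally show ?thesis .
  qed
  have habs: "\<bar>h x\<bar> \<le> 1" for x using h0 h1 by (simp add: abs_le_iff order_trans[OF _ h0])
  have wabs: "\<bar>w l \<theta> x\<bar> \<le> 2" for l \<theta> x using w0 w2 by simp
  have weq: "(\<integral>x. complex_of_real (w l \<theta> x) * iexp (m \<bullet> x) \<partial>M) = (\<integral>x. complex_of_real (w l \<theta> x) * iexp (m \<bullet> x) \<partial>N)"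
    for l \<theta> m
    unfolding w_def integral_mult_one_plus_cos_mult_iexp[OF M h habs] integral_mult_one_plus_cos_mult_iexp[OF N h habs] eq ..
  \<comment> \<open>Divided by its mass \<open>a\<close>, the weight is a probability density. The
    image \<open>D\<close> under coordinate \<open>j\<close> has as characteristic function the
    normalised transform of \<open>w\<close> along \<open>axis j\<close>, so Levy's theorem applies;
    for mass 0 both sides vanish.\<close>
  have wind: "(\<integral>x. w l \<theta> x * indicator {..c} (x $ j) \<partial>M) = (\<integral>x. w l \<theta> x * indicator {..c} (x $ j) \<partial>N)" for l \<theta>
  proof -
    define a where "a = (\<integral>x. w l \<theta> x \<partial>M)"
    have intM: "integrable M (w l \<theta>)"
      by (rule M.integrable_const_bound[where B=2]) (use wabs in auto)
    have intN: "integrable N (w l \<theta>)"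
      by (rule N.integrable_const_bound[where B=2]) (use wabs in auto)
    have aN: "a = (\<integral>x. w l \<theta> x \<partial>N)"
      using weq[of l \<theta> 0] by (simp add: a_def)
    have "0 \<le> a" unfolding a_def using w0 by simp
    then consider "a = 0" | "0 < a" by linarith
    then show ?thesis
    proof cases
      case 1
      have "AE x in M. w l \<theta> x = 0"
        using 1 integral_nonneg_eq_0_iff_AE[OF intM] w0 by (simp add: a_def)
      then have "(\<integral>x. w l \<theta> x * indicator {..c} (x $ j) \<partial>M) = (\<integral>x. 0 \<partial>M)"
        by (intro integral_cong_AE) auto
      moreover have "AE x in N. w l \<theta> x = 0"
        using 1 integral_nonneg_eq_0_iff_AE[OF intN] w0 by (simp add: aN)
      then have "(\<integral>x. w l \<theta> x * indicator {..c} (x $ j) \<partial>N) = (\<integral>x. 0 \<partial>N)"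
        by (intro integral_cong_AE) auto
      ultimately show ?thesis by simp
    next
      case 2
      define D where "D L = distr (density L (\<lambda>x. ennreal (w l \<theta> x / a))) borel (\<lambda>x. x $ j)" for L :: "(real^'n) measure"
      have prob: "prob_space (density L (\<lambda>x. ennreal (w l \<theta> x / a)))"
        if [measurable_cong]: "sets L = sets borel" and "integrable L (w l \<theta>)" "a = (\<integral>x. w l \<theta> x \<partial>L)" for L :: "(real^'n) measure"
      proof (rule prob_spaceI)
        have "emeasure (density L (\<lambda>x. ennreal (w l \<theta> x / a))) (space L) = (\<integral>\<^sup>+x. ennreal (w l \<theta> x / a) \<partial>L)"
          by (subst emeasure_density) (auto intro!: nn_integral_cong)
        also have "\<dots> = ennreal (\<integral>x. w l \<theta> x / a \<partial>L)"
          using that 2 w0 by (intro nn_integral_eq_integral) auto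
        also have "\<dots> = 1" using that(3) 2 by simp
        finally show "emeasure (density L (\<lambda>x. ennreal (w l \<theta> x / a))) (space (density L (\<lambda>x. ennreal (w l \<theta> x / a)))) = 1"
          by simp
      qed
      have rd: "real_distribution (D L)"
        if [measurable_cong]: "sets L = sets borel" and "integrable L (w l \<theta>)" "a = (\<integral>x. w l \<theta> x \<partial>L)" for L :: "(real^'n) measure"
        unfolding D_def by (rule prob_space.real_distribution_distr[OF prob[OF that]]) measurable
      have chD: "char (D L) t = (\<integral>x. complex_of_real (w l \<theta> x) * iexp (axis j t \<bullet> x) \<partial>L) / a"
        if [measurable_cong]: "sets L = sets borel" for L t
        unfolding D_def char_def using 2 w0
        by (subst integral_distr, simp_all, subst integral_density)
           (auto simp: inner_axis' scaleR_conv_of_real intro!: Bochner_Integration.integral_cong)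
      have DMN: "D M = D N"
      proof (rule Levy_uniqueness)
        show "real_distribution (D M)" by (rule rd[OF M(2) intM a_def])
        show "real_distribution (D N)" by (rule rd[OF N(2) intN aN])
        show "char (D M) = char (D N)" by (rule ext) (simp only: chD[OF M(2)] chD[OF N(2)] weq)
      qed
      have mD: "measure (D L) {..c} = (\<integral>x. w l \<theta> x * indicator {..c} (x $ j) \<partial>L) / a"
        if [measurable_cong]: "sets L = sets borel" for L
      proof -
        have "(\<integral>x. indicator {..c} x \<partial>D L) = (\<integral>x. (w l \<theta> x * indicator {..c} (x $ j)) / a \<partial>L)"
          unfolding D_def using 2 w0
          by (subst integral_distr, simp_all, subst integral_density)
             (auto intro!: Bochner_Integration.integral_cong)
        then show ?thesis using 2 by (simp add: D_def)
      qed
      show ?thesis using mD[OF M(2)] mD[OF N(2)] DMN 2 by simp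
    qed
  qed
  define h' where "h' x = h x * indicator {..c} (x $ j)" for x
  have h'm[measurable]: "h' \<in> borel_measurable borel" unfolding h'_def by measurable
  have h': "\<bar>h' x\<bar> \<le> 1" for x using habs by (auto simp: h'_def indicator_def)
  have int1: "integrable L (\<lambda>x. h' x * f x)" if "prob_space L" and [measurable_cong]: "sets L = sets borel"
      and [measurable]: "f \<in> borel_measurable borel" and "\<And>x. \<bar>f x\<bar> \<le> 2" for L f
  proof -
    interpret prob_space L by fact
    show ?thesis
      by (rule integrable_const_bound[where B=2])
         (use that(4) h' mult_mono[of "\<bar>h' x\<bar>" 1 "\<bar>f x\<bar>" 2 for x] in \<open>auto simp: abs_mult\<close>)
  qed
  have h'c: "(\<integral>x. h' x * (1 + cos (l \<bullet> x + \<theta>)) \<partial>M) = (\<integral>x. h' x * (1 + cos (l \<bullet> x + \<theta>)) \<partial>N)" for l \<theta>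
    using wind[of l \<theta>] by (simp add: w_def h'_def mult_ac)
  have *: "(\<integral>x. h' x \<partial>M) + (\<integral>x. h' x * cos (l \<bullet> x + \<theta>) \<partial>M) = (\<integral>x. h' x \<partial>N) + (\<integral>x. h' x * cos (l \<bullet> x + \<theta>) \<partial>N)" for l \<theta>
    using h'c[of l \<theta>] int1[OF M, of "\<lambda>_. 1"] int1[OF N, of "\<lambda>_. 1"] int1[OF M, of "\<lambda>x. cos (l \<bullet> x + \<theta>)"]
      int1[OF N, of "\<lambda>x. cos (l \<bullet> x + \<theta>)"]
    by (simp add: ring_distribs order_trans[OF abs_cos_le_one])
  \<comment> \<open>At \<open>l = 0\<close> and phase \<open>pi/2\<close> the cosine is 0, which
    isolates the plain integral; once that is subtracted, the phases \<open>0\<close> and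
    \<open>-pi/2\<close> give the real and the imaginary part of the transform.\<close>
  have h'eq: "(\<integral>x. h' x \<partial>M) = (\<integral>x. h' x \<partial>N)" using *[of 0 "pi/2"] by simp
  have c: "(\<integral>x. h' x * cos (l \<bullet> x) \<partial>M) = (\<integral>x. h' x * cos (l \<bullet> x) \<partial>N)" using *[of l 0] h'eq by simp
  have "(\<integral>x. h' x * cos (l \<bullet> x + (- pi/2)) \<partial>M) = (\<integral>x. h' x * cos (l \<bullet> x + (- pi/2)) \<partial>N)"
    using *[of l "-pi/2"] h'eq by simp
  then have s: "(\<integral>x. h' x * sin (l \<bullet> x) \<partial>M) = (\<integral>x. h' x * sin (l \<bullet> x) \<partial>N)"
    by (simp add: cos_diff)
  have "(\<integral>x. complex_of_real (h' x) * iexp (l \<bullet> x) \<partial>L) =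
     complex_of_real (\<integral>x. h' x * cos (l \<bullet> x) \<partial>L) + \<i> * complex_of_real (\<integral>x. h' x * sin (l \<bullet> x) \<partial>L)"
    if "prob_space L" and [measurable_cong]: "sets L = sets borel" for L
  proof -
    have "(\<integral>x. complex_of_real (h' x) * iexp (l \<bullet> x) \<partial>L) =
      (\<integral>x. complex_of_real (h' x * cos (l \<bullet> x)) + \<i> * complex_of_real (h' x * sin (l \<bullet> x)) \<partial>L)"
      by (intro Bochner_Integration.integral_cong) (auto simp: complex_eq_iff Re_exp Im_exp)
    also have "\<dots> = (\<integral>x. complex_of_real (h' x * cos (l \<bullet> x)) \<partial>L) + (\<integral>x. \<i> * complex_of_real (h' x * sin (l \<bullet> x)) \<partial>L)"
      using int1[OF that, of "\<lambda>x. cos (l \<bullet> x)"] int1[OF that, of "\<lambda>x. sin (l \<bullet> x)"]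
      by (intro Bochner_Integration.integral_add integrable_mult_right integrable_of_real)
         (auto simp: order_trans[OF abs_cos_le_one] order_trans[OF abs_sin_le_one])
    finally show ?thesis by (simp only: integral_mult_right_zero integral_complex_of_real)
  qed
  then show ?thesis using M N c s unfolding h'_def[symmetric] by simp
qed

text \<open>The conclusion of \<open>char_fn_half_space\<close> has the form of its hypothesis with
  a new bounded weight, so half-spaces can be multiplied in one coordinate at a time; for this the
  induction keeps all frequencies \<open>l\<close>. At \<open>l = 0\<close> the full product gives
  the measure of a lower orthant, and the orthants form an intersection-stable generator.\<close>

lemma char_fn_uniqueness:
  fixes M N :: "(real^'n) measure"
  assumes M: "prob_space M" "sets M = sets borel" and N: "prob_space N" "sets N = sets borel"
    and eq: "\<And>l. (\<integral>x. iexp (l \<bullet> x) \<partial>M) = (\<integral>x. iexp (l \<bullet> x) \<partial>N)"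
  shows "M = N"
proof -
  interpret M: prob_space M by fact
  interpret N: prob_space N by fact
  have [measurable_cong]: "sets M = sets borel" "sets N = sets borel" by fact+
  have nth[measurable]: "(\<lambda>x. x $ j) \<in> borel_measurable (borel :: (real^'n) measure)" for j
    by (intro borel_measurable_continuous_onI continuous_intros)
  have *: "\<forall>l. (\<integral>x. complex_of_real (\<Prod>j\<in>S. indicator {..c $ j} (x $ j)) * iexp (l \<bullet> x) \<partial>M) =
     (\<integral>x. complex_of_real (\<Prod>j\<in>S. indicator {..c $ j} (x $ j)) * iexp (l \<bullet> x) \<partial>N)" for c :: "real^'n" and S
  proof (induction S rule: infinite_finite_induct)
    case (insert j S)
    have "(\<integral>x. complex_of_real ((\<Prod>j\<in>S. indicator {..c $ j} (x $ j)) * indicator {..c $ j} (x $ j)) * iexp (l \<bullet> x) \<partial>M) =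
     (\<integral>x. complex_of_real ((\<Prod>j\<in>S. indicator {..c $ j} (x $ j)) * indicator {..c $ j} (x $ j)) * iexp (l \<bullet> x) \<partial>N)" for l
      by (rule char_fn_half_space[OF M N]) (use insert in \<open>auto intro!: prod_nonneg prod_le_1\<close>)
    then show ?case using insert(1,2) by (simp add: mult.commute)
  qed (use eq in auto)
  have prod: "(\<Prod>j\<in>UNIV. indicator {..c $ j} (x $ j)) = (indicator {..c} x :: real)" for c x :: "real^'n"
    by (auto simp: indicator_def less_eq_vec_def)
  have box: "emeasure M {..c} = emeasure N {..c}" for c
  proof -
    have "complex_of_real (measure M {..c}) = complex_of_real (measure N {..c})"
    proof -
      have "(\<integral>x. complex_of_real (\<Prod>j\<in>UNIV. indicator {..c $ j} (x $ j)) * iexp (0 \<bullet> x) \<partial>M) =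
        (\<integral>x. complex_of_real (\<Prod>j\<in>UNIV. indicator {..c $ j} (x $ j)) * iexp (0 \<bullet> x) \<partial>N)"
        using * by blast
      then show ?thesis unfolding prod by simp
    qed
    then show ?thesis by (simp add: M.emeasure_eq_measure N.emeasure_eq_measure)
  qed
  show ?thesis
  proof (rule measure_eqI_generator_eq[where E="range atMost" and \<Omega>=UNIV and A="\<lambda>i. {..(\<chi> j. real i)}"])
    show "Int_stable (range atMost :: (real^'n) set set)"
      unfolding Int_stable_def
    proof safe
      fix a b :: "real^'n"
      have "{..a} \<inter> {..b} = {..(\<chi> j. min (a $ j) (b $ j))}" by (auto simp: less_eq_vec_def)
      then show "{..a} \<inter> {..b} \<in> range atMost" by blast
    qed
    show "sets M = sigma_sets UNIV (range atMost)" "sets N = sigma_sets UNIV (range atMost)"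
      unfolding M(2) N(2) borel_eq_atMost by (simp_all add: sets_measure_of)
    show "(\<Union>i. {..(\<chi> j::'n. real i)}) = UNIV"
    proof safe
      fix x :: "real^'n"
      obtain n where "norm x \<le> real n" using real_arch_simple by blast
      then have "x $ j \<le> real n" for j using component_le_norm_cart[of x j] by linarith
      then have "x \<le> (\<chi> j. real n)" by (simp add: less_eq_vec_def)
      then show "x \<in> (\<Union>i. {..(\<chi> j::'n. real i)})" by blast
    qed simp
  qed (use box in auto)
qed

section \<open>Gauss vectors\<close>

text \<open>By Levy uniqueness \<open>X\<close> has the law of \<open>m + sqrt v * y\<close> with
  \<open>y\<close> standard normal, and the moments are read off there. Writing the law as an image
  of a standard normal covers the degenerate case \<open>v = 0\<close>.\<close>

lemma (in prob_space) gauss_char_moments: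
  fixes X :: "'a \<Rightarrow> real"
  assumes X[measurable]: "X \<in> borel_measurable M"
    and ch: "\<And>\<theta>. (\<integral>\<omega>. iexp (\<theta> * X \<omega>) \<partial>M) =
      exp (\<i> * complex_of_real (\<theta> * m) - complex_of_real (\<theta>\<^sup>2 * v) / 2)"
  shows "0 \<le> v" "integrable M X" "expectation X = m" "integrable M (\<lambda>\<omega>. (X \<omega>)\<^sup>2)"
    "expectation (\<lambda>\<omega>. (X \<omega> - m)\<^sup>2) = v"
proof -
  \<comment> \<open>A characteristic function is bounded by 1 in modulus; at
    \<open>\<theta> = 1\<close> this says \<open>exp (- v / 2) \<le> 1\<close>.\<close>
  have "norm (\<integral>\<omega>. iexp (1 * X \<omega>) \<partial>M) \<le> 1"
    by (rule order_trans[OF integral_norm_bound]) (simp add: prob_space)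
  then show v: "0 \<le> v" unfolding ch by (simp add: exp_diff norm_divide)
  define N where "N = std_normal_distribution"
  let ?f = "\<lambda>y. m + sqrt v * y"
  interpret N: real_distribution N unfolding N_def by (rule real_dist_normal_dist)
  have distr: "distr M borel X = distr N borel ?f"
  proof (rule Levy_uniqueness)
    show "char (distr M borel X) = char (distr N borel ?f)"
    proof
      fix \<theta>
      have "char (distr N borel ?f) \<theta> = (\<integral>y. iexp (\<theta> * m) * iexp ((\<theta> * sqrt v) * y) \<partial>N)"
        unfolding char_def by (subst integral_distr) (simp_all add: ring_distribs exp_add mult_ac)
      also have "\<dots> = iexp (\<theta> * m) * char N (\<theta> * sqrt v)"
        by (simp add: char_def)
      also have "\<dots> = exp (\<i> * complex_of_real (\<theta> * m) - complex_of_real (\<theta>\<^sup>2 * v) / 2)"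
      proof -
        have "(\<theta> * sqrt v)\<^sup>2 = \<theta>\<^sup>2 * v" using v by (simp add: power_mult_distrib)
        then have "char N (\<theta> * sqrt v) = exp (complex_of_real (- (\<theta>\<^sup>2 * v) / 2))"
          by (simp only: N_def char_std_normal_distribution exp_of_real)
        then show ?thesis by (simp add: exp_add[symmetric])
      qed
      also have "\<dots> = char (distr M borel X) \<theta>"
        unfolding char_def using ch[of \<theta>] by (subst integral_distr) simp_all
      finally show "char (distr M borel X) \<theta> = char (distr N borel ?f) \<theta>" ..
    qed
    show "real_distribution (distr M borel X)" by (rule real_distribution_distr) fact
    show "real_distribution (distr N borel ?f)" by (rule N.real_distribution_distr) simp
  qed
  have i1: "integrable N (\<lambda>y. y)" using integrable_std_normal_distribution_moment[of 1] by (simp add: N_def)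
  have i2: "integrable N (\<lambda>y. y\<^sup>2)" using integrable_std_normal_distribution_moment[of 2] by (simp add: N_def)
  have pN: "N.prob UNIV = 1" using N.prob_space by simp
  have e1: "(\<integral>y. y \<partial>N) = 0" using integral_std_normal_distribution_moment_odd[of 1] by (simp add: N_def)
  have e2: "(\<integral>y. y\<^sup>2 \<partial>N) = 1" using std_normal_distribution_even_moments(1)[of 1] by (simp add: N_def)
  have trI: "integrable M (\<lambda>\<omega>. g (X \<omega>)) \<longleftrightarrow> integrable N (\<lambda>y. g (?f y))"
    if [measurable]: "g \<in> borel_measurable borel" for g :: "real \<Rightarrow> real"
  proof -
    have "integrable M (\<lambda>\<omega>. g (X \<omega>)) \<longleftrightarrow> integrable (distr M borel X) g"
      by (subst integrable_distr_eq) auto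
    also have "\<dots> \<longleftrightarrow> integrable N (\<lambda>y. g (?f y))"
      unfolding distr by (subst integrable_distr_eq) auto
    finally show ?thesis .
  qed
  have trE: "(\<integral>\<omega>. g (X \<omega>) \<partial>M) = (\<integral>y. g (?f y) \<partial>N)"
    if [measurable]: "g \<in> borel_measurable borel" for g :: "real \<Rightarrow> real"
  proof -
    have "(\<integral>\<omega>. g (X \<omega>) \<partial>M) = (\<integral>x. g x \<partial>distr M borel X)"
      by (subst integral_distr) auto
    also have "\<dots> = (\<integral>y. g (?f y) \<partial>N)"
      unfolding distr by (subst integral_distr) auto
    finally show ?thesis .
  qed
  have f1: "integrable N ?f"
    by (intro Bochner_Integration.integrable_add integrable_mult_right i1 N.integrable_const)
  show "integrable M X" by (rule trI[THEN iffD2, of "\<lambda>x. x"]) (measurable, rule f1)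
  have "expectation X = (\<integral>y. ?f y \<partial>N)" by (rule trE[of "\<lambda>x. x"]) measurable
  also have "\<dots> = m" using i1 by (subst Bochner_Integration.integral_add) (simp_all add: e1 pN)
  finally show "expectation X = m" .
  have sq: "(\<lambda>y. (?f y)\<^sup>2) = (\<lambda>y. m\<^sup>2 + 2 * m * sqrt v * y + v * y\<^sup>2)"
    using v by (auto simp: power2_sum power_mult_distrib)
  have "integrable N (\<lambda>y. (?f y)\<^sup>2)"
    unfolding sq by (intro Bochner_Integration.integrable_add integrable_mult_right i1 i2 N.integrable_const)
  then show "integrable M (\<lambda>\<omega>. (X \<omega>)\<^sup>2)"
    by (intro trI[THEN iffD2, of "\<lambda>x. x\<^sup>2"]) measurable
  have "expectation (\<lambda>\<omega>. (X \<omega> - m)\<^sup>2) = (\<integral>y. (?f y - m)\<^sup>2 \<partial>N)"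
    by (rule trE[of "\<lambda>x. (x - m)\<^sup>2"]) measurable
  also have "\<dots> = v" using v by (simp add: power_mult_distrib e2)
  finally show "expectation (\<lambda>\<omega>. (X \<omega> - m)\<^sup>2) = v" .
qed

lemma integrable_mult_of_squares:
  fixes f g :: "'a \<Rightarrow> real"
  assumes [measurable]: "f \<in> borel_measurable M" "g \<in> borel_measurable M"
    and "integrable M (\<lambda>x. (f x)\<^sup>2)" "integrable M (\<lambda>x. (g x)\<^sup>2)"
  shows "integrable M (\<lambda>x. f x * g x)"
proof (rule Bochner_Integration.integrable_bound)
  show "integrable M (\<lambda>x. (f x)\<^sup>2 + (g x)\<^sup>2)" using assms by simp
  have "\<bar>f x * g x\<bar> \<le> (f x)\<^sup>2 + (g x)\<^sup>2" for x
  proof -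
    have "0 \<le> (\<bar>f x\<bar> - \<bar>g x\<bar>)\<^sup>2" by simp
    then have "2 * \<bar>f x * g x\<bar> \<le> (f x)\<^sup>2 + (g x)\<^sup>2" by (simp add: power2_diff abs_mult)
    then show ?thesis by linarith
  qed
  then show "AE x in M. norm (f x * g x) \<le> norm ((f x)\<^sup>2 + (g x)\<^sup>2)" by simp
qed measurable

section \<open>Means and covariances of square-integrable vectors\<close>

definition square_integrable :: "'w measure \<Rightarrow> ('w \<Rightarrow> real^'k) \<Rightarrow> bool" where
  "square_integrable M X \<longleftrightarrow> X \<in> borel_measurable M \<and> (\<forall>i. integrable M (\<lambda>\<omega>. (X \<omega> $ i)\<^sup>2))"

lemma borel_measurable_vec_nth:
  fixes X :: "'w \<Rightarrow> 'b::topological_space^'k"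
  assumes "X \<in> borel_measurable M"
  shows "(\<lambda>\<omega>. X \<omega> $ i) \<in> borel_measurable M"
  by (rule measurable_compose[OF assms]) (intro borel_measurable_continuous_onI continuous_intros)

lemma measurable_vec_nth[measurable (raw)]:
  fixes X :: "'w \<Rightarrow> real^'k"
  assumes "X \<in> borel_measurable M"
  shows "(\<lambda>\<omega>. X \<omega> $ i) \<in> borel_measurable M"
  using assms by (rule borel_measurable_vec_nth)

lemma borel_measurable_vecI:
  fixes X :: "'w \<Rightarrow> real^'k"
  assumes "\<And>i. (\<lambda>\<omega>. X \<omega> $ i) \<in> borel_measurable M"
  shows "X \<in> borel_measurable M"
proof (rule borel_measurable_euclidean_space[THEN iffD2], safe)
  fix b :: "real^'k" assume "b \<in> Basis"
  then obtain i where "b = axis i 1" by (auto simp: Basis_vec_def)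
  then show "(\<lambda>\<omega>. X \<omega> \<bullet> b) \<in> borel_measurable M" using assms[of i] by (simp add: inner_axis)
qed

lemma measurable_matrix_vector_mult[measurable (raw)]:
  fixes A :: "real^'m^'k"
  assumes [measurable]: "X \<in> borel_measurable M"
  shows "(\<lambda>\<omega>. A *v X \<omega>) \<in> borel_measurable M"
  by (rule borel_measurable_vecI) (simp add: matrix_vector_mult_def)

lemma square_integrable_measurable[measurable_dest]:
  "square_integrable M X \<Longrightarrow> X \<in> borel_measurable M"
  by (simp add: square_integrable_def)

context prob_space
begin

lemma square_integrable_integrable:
  assumes [measurable]: "square_integrable M X"
  shows "integrable M (\<lambda>\<omega>. X \<omega> $ i)"
  using integrable_mult_of_squares[of "\<lambda>\<omega>. X \<omega> $ i" M "\<lambda>_. 1"] assms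
  by (simp add: square_integrable_def)

lemma square_integrable_mult:
  assumes [measurable]: "square_integrable M X" "square_integrable M Y"
  shows "integrable M (\<lambda>\<omega>. X \<omega> $ i * Y \<omega> $ j)"
  by (rule integrable_mult_of_squares) (use assms in \<open>simp_all add: square_integrable_def\<close>)

lemma square_integrable_centred:
  assumes [measurable]: "square_integrable M X"
  shows "square_integrable M (\<lambda>\<omega>. X \<omega> - c)"
  using assms square_integrable_integrable[OF assms]
  by (auto simp: square_integrable_def power2_diff)

lemma square_integrable_add:
  assumes [measurable]: "square_integrable M X" "square_integrable M Y"
  shows "square_integrable M (\<lambda>\<omega>. X \<omega> + Y \<omega>)"
  using assms square_integrable_mult[OF assms]
  by (auto simp: square_integrable_def power2_sum mult.assoc)

lemma square_integrable_matrix_vector_mult: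
  fixes A :: "real^'m^'k"
  assumes [measurable]: "square_integrable M X"
  shows "square_integrable M (\<lambda>\<omega>. A *v X \<omega>)"
  unfolding square_integrable_def
proof (intro conjI allI)
  show "(\<lambda>\<omega>. A *v X \<omega>) \<in> borel_measurable M" using assms by (auto simp: square_integrable_def)
  fix i
  have "integrable M (\<lambda>\<omega>. \<Sum>j\<in>UNIV. \<Sum>j'\<in>UNIV. (A $ i $ j * A $ i $ j') * (X \<omega> $ j * X \<omega> $ j'))"
    by (intro Bochner_Integration.integrable_sum integrable_mult_right square_integrable_mult assms)
  moreover have "((A *v X \<omega>) $ i)\<^sup>2 = (\<Sum>j\<in>UNIV. \<Sum>j'\<in>UNIV. (A $ i $ j * A $ i $ j') * (X \<omega> $ j * X \<omega> $ j'))" for \<omega>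
    by (simp add: matrix_vector_mult_def power2_eq_square sum_product mult_ac)
  ultimately show "integrable M (\<lambda>\<omega>. ((A *v X \<omega>) $ i)\<^sup>2)" by simp
qed

lemma mean_vec_add:
  assumes [measurable]: "square_integrable M X" "square_integrable M Y"
  shows "mean_vec M (\<lambda>\<omega>. X \<omega> + Y \<omega>) = mean_vec M X + mean_vec M Y"
  using assms by (simp add: mean_vec_def vec_eq_iff square_integrable_integrable)

lemma mean_vec_matrix_vector_mult:
  fixes A :: "real^'m^'k"
  assumes [measurable]: "square_integrable M X"
  shows "mean_vec M (\<lambda>\<omega>. A *v X \<omega>) = A *v mean_vec M X"
  using assms by (simp add: mean_vec_def vec_eq_iff square_integrable_integrable matrix_vector_mult_def)

lemma integrable_inner_mult_inner:
  assumes [measurable]: "square_integrable M X" "square_integrable M Y"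
  shows "integrable M (\<lambda>\<omega>. (l \<bullet> X \<omega>) * (k \<bullet> Y \<omega>))"
proof -
  have "(l \<bullet> X \<omega>) * (k \<bullet> Y \<omega>) = (\<Sum>i\<in>UNIV. \<Sum>j\<in>UNIV. (l $ i * k $ j) * (X \<omega> $ i * Y \<omega> $ j))" for \<omega>
    by (simp add: inner_vec_def sum_product mult_ac)
  then show ?thesis
    by (simp only:) (intro Bochner_Integration.integrable_sum integrable_mult_right square_integrable_mult assms)
qed

text \<open>Bilinearity links the entrywise covariance matrix to the quadratic forms in which
  characteristic functions are stated.\<close>

lemma inner_cov_mat:
  assumes X[measurable]: "square_integrable M X" and Y[measurable]: "square_integrable M Y"
  shows "l \<bullet> (cov_mat M X Y *v k) =
    (\<integral>\<omega>. (l \<bullet> (X \<omega> - mean_vec M X)) * (k \<bullet> (Y \<omega> - mean_vec M Y)) \<partial>M)"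
proof -
  note * = square_integrable_mult[OF square_integrable_centred[OF X] square_integrable_centred[OF Y]]
  have "(\<integral>\<omega>. (l \<bullet> (X \<omega> - mean_vec M X)) * (k \<bullet> (Y \<omega> - mean_vec M Y)) \<partial>M) =
    (\<integral>\<omega>. (\<Sum>i\<in>UNIV. \<Sum>j\<in>UNIV. (l $ i * k $ j) * ((X \<omega> - mean_vec M X) $ i * (Y \<omega> - mean_vec M Y) $ j)) \<partial>M)"
    by (simp add: inner_vec_def sum_product mult_ac)
  also have "\<dots> = (\<Sum>i\<in>UNIV. \<Sum>j\<in>UNIV. (l $ i * k $ j) * cov_mat M X Y $ i $ j)"
    using * by (simp add: cov_mat_def)
  also have "\<dots> = l \<bullet> (cov_mat M X Y *v k)"
    by (simp add: inner_vec_def matrix_vector_mult_def sum_distrib_left mult_ac)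
  finally show ?thesis ..
qed

lemma transpose_cov_mat: "transpose (cov_mat M X Y) = cov_mat M Y X"
  by (simp add: cov_mat_def transpose_def vec_eq_iff mult.commute)

lemma cov_mat_add_left:
  assumes [measurable]: "square_integrable M X" "square_integrable M Y" "square_integrable M W"
  shows "cov_mat M (\<lambda>\<omega>. X \<omega> + Y \<omega>) W = cov_mat M X W + cov_mat M Y W"
proof -
  have "(X \<omega> $ i + Y \<omega> $ i - (mean_vec M X $ i + mean_vec M Y $ i)) * (W \<omega> $ j - mean_vec M W $ j) =
    (X \<omega> $ i - mean_vec M X $ i) * (W \<omega> $ j - mean_vec M W $ j)
    + (Y \<omega> $ i - mean_vec M Y $ i) * (W \<omega> $ j - mean_vec M W $ j)" for \<omega> i j
    by (simp add: algebra_simps)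
  then show ?thesis
    unfolding cov_mat_def mean_vec_add[OF assms(1,2)] vec_eq_iff
    using square_integrable_mult[OF square_integrable_centred square_integrable_centred, OF assms(1,3)]
      square_integrable_mult[OF square_integrable_centred square_integrable_centred, OF assms(2,3)] by simp
qed

lemma cov_mat_matrix_vector_mult_left:
  fixes A :: "real^'m^'k"
  assumes [measurable]: "square_integrable M X" "square_integrable M W"
  shows "cov_mat M (\<lambda>\<omega>. A *v X \<omega>) W = A ** cov_mat M X W"
proof -
  have "(\<Sum>k\<in>UNIV. A $ i $ k * X \<omega> $ k) - (\<Sum>k\<in>UNIV. A $ i $ k * mean_vec M X $ k) =
    (\<Sum>k\<in>UNIV. A $ i $ k * (X \<omega> $ k - mean_vec M X $ k))" for \<omega> i
    by (simp add: sum_subtractf right_diff_distrib)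
  then show ?thesis
    unfolding cov_mat_def mean_vec_matrix_vector_mult[OF assms(1)] vec_eq_iff
    using square_integrable_mult[OF square_integrable_centred square_integrable_centred, OF assms(1,2)]
    by (simp add: matrix_vector_mult_def matrix_matrix_mult_def sum_distrib_right mult.assoc)
qed


section \<open>Gauss vectors: moments, independence and conditioning\<close>

lemma gauss_inner_moments:
  fixes X :: "'a \<Rightarrow> real^'k"
  assumes X[measurable]: "X \<in> borel_measurable M" and g: "is_gauss (distr M borel X) m C"
  shows "integrable M (\<lambda>\<omega>. (l \<bullet> X \<omega>)\<^sup>2)" "expectation (\<lambda>\<omega>. l \<bullet> X \<omega>) = l \<bullet> m"
    "expectation (\<lambda>\<omega>. (l \<bullet> X \<omega> - l \<bullet> m)\<^sup>2) = l \<bullet> (C *v l)"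
proof -
  have meas: "(\<lambda>\<omega>. l \<bullet> X \<omega>) \<in> borel_measurable M" by measurable
  \<comment> \<open>Along the multiples \<open>\<theta> *\<^sub>R l\<close> of one direction the
    characteristic function is that of a real Gauss variable.\<close>
  have ch: "(\<integral>\<omega>. iexp (\<theta> * (l \<bullet> X \<omega>)) \<partial>M) =
      exp (\<i> * complex_of_real (\<theta> * (l \<bullet> m)) - complex_of_real (\<theta>\<^sup>2 * (l \<bullet> (C *v l))) / 2)" for \<theta>
  proof -
    have "(\<integral>x. iexp ((\<theta> *\<^sub>R l) \<bullet> x) \<partial>distr M borel X) =
      exp (\<i> * complex_of_real ((\<theta> *\<^sub>R l) \<bullet> m) - complex_of_real ((\<theta> *\<^sub>R l) \<bullet> (C *v (\<theta> *\<^sub>R l))) / 2)"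
      using g unfolding is_gauss_def by blast
    then show ?thesis
      by (subst (asm) integral_distr) (simp_all add: matrix_vector_mult_scaleR power2_eq_square mult.assoc)
  qed
  note mom = gauss_char_moments[OF meas ch]
  show "integrable M (\<lambda>\<omega>. (l \<bullet> X \<omega>)\<^sup>2)" by (rule mom(4))
  show "expectation (\<lambda>\<omega>. l \<bullet> X \<omega>) = l \<bullet> m" by (rule mom(3))
  show "expectation (\<lambda>\<omega>. (l \<bullet> X \<omega> - l \<bullet> m)\<^sup>2) = l \<bullet> (C *v l)" by (rule mom(5))
qed

lemma gauss_square_integrable:
  assumes X[measurable]: "X \<in> borel_measurable M" and g: "is_gauss (distr M borel X) m C"
  shows "square_integrable M X" "mean_vec M X = m"
  using gauss_inner_moments[OF assms, of "axis i 1" for i]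
  by (simp_all add: square_integrable_def inner_axis' mean_vec_def vec_eq_iff)

lemma square_integrable_stackD:
  assumes [measurable]: "square_integrable M (\<lambda>\<omega>. stack (X \<omega>) (W \<omega>))"
  shows "square_integrable M X" "square_integrable M W"
proof -
  have 1: "(\<lambda>\<omega>. stack (X \<omega>) (W \<omega>) $ s) \<in> borel_measurable M" "integrable M (\<lambda>\<omega>. (stack (X \<omega>) (W \<omega>) $ s)\<^sup>2)" for s
    using assms by (auto simp: square_integrable_def)
  show "square_integrable M X" using 1[of "Inl i" for i]
    by (auto simp: square_integrable_def stack_def intro: borel_measurable_vecI)
  show "square_integrable M W" using 1[of "Inr i" for i]
    by (auto simp: square_integrable_def stack_def intro: borel_measurable_vecI)
qed

lemma inner_stack: "stack l k \<bullet> stack x w = l \<bullet> x + k \<bullet> w"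
  unfolding inner_vec_def UNIV_Plus_UNIV[symmetric] by (subst sum.Plus) (simp_all add: stack_def)

lemma mean_vec_stack: "mean_vec M (\<lambda>\<omega>. stack (X \<omega>) (W \<omega>)) = stack (mean_vec M X) (mean_vec M W)"
  by (auto simp: mean_vec_def stack_def vec_eq_iff split: sum.split)

lemma measurable_stack[measurable (raw)]:
  fixes X :: "'b \<Rightarrow> real^'k" and W :: "'b \<Rightarrow> real^'m"
  assumes [measurable]: "X \<in> borel_measurable N" "W \<in> borel_measurable N"
  shows "(\<lambda>\<omega>. stack (X \<omega>) (W \<omega>)) \<in> borel_measurable N"
proof (rule borel_measurable_vecI)
  fix s :: "'k + 'm"
  show "(\<lambda>\<omega>. stack (X \<omega>) (W \<omega>) $ s) \<in> borel_measurable N"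
    by (cases s) (simp_all add: stack_def)
qed

lemma jointly_gauss_square_integrable:
  assumes "jointly_gauss M X W"
  shows "square_integrable M X" "square_integrable M W"
proof -
  have "square_integrable M (\<lambda>\<omega>. stack (X \<omega>) (W \<omega>))"
    using assms by (auto simp: jointly_gauss_def intro: gauss_square_integrable(1))
  then show "square_integrable M X" "square_integrable M W" by (rule square_integrable_stackD)+
qed

text \<open>In \<open>jointly_gauss\<close> mean and covariance are existentially quantified; the
  moments identify them. The variance is left as one integral of a square, because the passage to
  the residual rewrites the variable inside that integral.\<close>

lemma jointly_gauss_char:
  assumes "jointly_gauss M X W"
  shows "(\<integral>\<omega>. iexp (l \<bullet> X \<omega> + k \<bullet> W \<omega>) \<partial>M) =
    exp (\<i> * complex_of_real (l \<bullet> mean_vec M X + k \<bullet> mean_vec M W)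
      - complex_of_real (\<integral>\<omega>. (l \<bullet> (X \<omega> - mean_vec M X) + k \<bullet> (W \<omega> - mean_vec M W))\<^sup>2 \<partial>M) / 2)"
proof -
  have [measurable]: "X \<in> borel_measurable M" "W \<in> borel_measurable M"
    using assms by (auto simp: jointly_gauss_def)
  obtain m C where g: "is_gauss (distr M borel (\<lambda>\<omega>. stack (X \<omega>) (W \<omega>))) m C"
    using assms by (auto simp: jointly_gauss_def)
  have m: "m = stack (mean_vec M X) (mean_vec M W)"
    using gauss_square_integrable(2)[OF _ g] by (simp add: mean_vec_stack)
  have "(\<integral>x. iexp (stack l k \<bullet> x) \<partial>distr M borel (\<lambda>\<omega>. stack (X \<omega>) (W \<omega>))) =
    exp (\<i> * complex_of_real (stack l k \<bullet> m) - complex_of_real (stack l k \<bullet> (C *v stack l k)) / 2)"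
    using g unfolding is_gauss_def by blast
  also have "stack l k \<bullet> (C *v stack l k) = (\<integral>\<omega>. (l \<bullet> (X \<omega> - mean_vec M X) + k \<bullet> (W \<omega> - mean_vec M W))\<^sup>2 \<partial>M)"
    using gauss_inner_moments(3)[OF _ g, of "stack l k"] by (simp add: m inner_stack inner_diff_right algebra_simps)
  finally show ?thesis by (subst (asm) integral_distr) (simp_all add: inner_stack m)
qed

end

lemma is_gauss_unique: "is_gauss N m C \<Longrightarrow> is_gauss N' m C \<Longrightarrow> N = N'"
  by (rule char_fn_uniqueness) (auto simp: is_gauss_def)

text \<open>Kac's theorem: a factorising joint characteristic function forces a product law. Pairs
  are encoded as stacked vectors by \<open>?s\<close>, so that uniqueness for vectors applies, and
  its left inverse \<open>?u\<close> carries the equality of laws back to the pair space.\<close>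

lemma (in prob_space) char_fn_indep:
  fixes V :: "'a \<Rightarrow> real^'k" and W :: "'a \<Rightarrow> real^'m"
  assumes [measurable]: "V \<in> borel_measurable M" "W \<in> borel_measurable M"
    and eq: "\<And>l k. (\<integral>\<omega>. iexp (l \<bullet> V \<omega> + k \<bullet> W \<omega>) \<partial>M) = (\<integral>\<omega>. iexp (l \<bullet> V \<omega>) \<partial>M) * (\<integral>\<omega>. iexp (k \<bullet> W \<omega>) \<partial>M)"
  shows "distr M (borel \<Otimes>\<^sub>M borel) (\<lambda>\<omega>. (V \<omega>, W \<omega>)) = distr M borel V \<Otimes>\<^sub>M distr M borel W"
proof -
  let ?V = "distr M borel V" and ?W = "distr M borel W"
  let ?s = "\<lambda>p :: (real^'k) \<times> (real^'m). stack (fst p) (snd p)"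
  let ?u = "\<lambda>z :: real^('k + 'm). ((\<chi> i. z $ Inl i) :: real^'k, (\<chi> j. z $ Inr j) :: real^'m)"
  interpret V: prob_space ?V by (rule prob_space_distr) measurable
  interpret W: prob_space ?W by (rule prob_space_distr) measurable
  interpret P: pair_prob_space ?V ?W ..
  have s[measurable]: "?s \<in> borel_measurable (borel \<Otimes>\<^sub>M borel)" by measurable
  have u[measurable]: "?u \<in> borel \<rightarrow>\<^sub>M borel \<Otimes>\<^sub>M borel"
    by (intro measurable_Pair borel_measurable_vecI) (simp_all add: borel_measurable_continuous_onI continuous_intros)
  have us: "?u (?s p) = p" for p by (cases p) (simp add: stack_def vec_eq_iff)
  have "distr M borel (\<lambda>\<omega>. stack (V \<omega>) (W \<omega>)) = distr (?V \<Otimes>\<^sub>M ?W) borel ?s"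
  proof (rule char_fn_uniqueness)
    show "prob_space (distr M borel (\<lambda>\<omega>. stack (V \<omega>) (W \<omega>)))" by (rule prob_space_distr) measurable
    show "prob_space (distr (?V \<Otimes>\<^sub>M ?W) borel ?s)" by (rule P.prob_space_distr) measurable
    fix z :: "real^('k + 'm)"
    define l k where "l = fst (?u z)" and "k = snd (?u z)"
    have z: "z = stack l k" by (auto simp: l_def k_def stack_def vec_eq_iff split: sum.split)
    have "(\<integral>x. iexp (z \<bullet> x) \<partial>distr (?V \<Otimes>\<^sub>M ?W) borel ?s) =
      (\<integral>p. (case p of (v, w) \<Rightarrow> iexp (l \<bullet> v) * iexp (k \<bullet> w)) \<partial>(?V \<Otimes>\<^sub>M ?W))"
      by (subst integral_distr) (simp_all add: z inner_stack case_prod_beta' ring_distribs exp_add)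
    also have "\<dots> = (\<integral>v. (\<integral>w. iexp (l \<bullet> v) * iexp (k \<bullet> w) \<partial>?W) \<partial>?V)"
    proof (rule P.integral_fst[symmetric])
      show "integrable (?V \<Otimes>\<^sub>M ?W) (\<lambda>(v, w). iexp (l \<bullet> v) * iexp (k \<bullet> w))"
        by (rule P.integrable_const_bound[where B=1]) (auto simp: norm_mult)
    qed
    also have "\<dots> = (\<integral>\<omega>. iexp (l \<bullet> V \<omega>) \<partial>M) * (\<integral>\<omega>. iexp (k \<bullet> W \<omega>) \<partial>M)"
      by (simp add: integral_distr)
    finally show "(\<integral>x. iexp (z \<bullet> x) \<partial>distr M borel (\<lambda>\<omega>. stack (V \<omega>) (W \<omega>))) =
      (\<integral>x. iexp (z \<bullet> x) \<partial>distr (?V \<Otimes>\<^sub>M ?W) borel ?s)"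
      unfolding eq[symmetric] by (subst integral_distr) (simp_all add: z inner_stack)
  qed simp_all
  then have "distr (distr M borel (\<lambda>\<omega>. stack (V \<omega>) (W \<omega>))) (borel \<Otimes>\<^sub>M borel) ?u = distr (distr (?V \<Otimes>\<^sub>M ?W) borel ?s) (borel \<Otimes>\<^sub>M borel) ?u"
    by simp
  moreover have "distr (distr M borel (\<lambda>\<omega>. stack (V \<omega>) (W \<omega>))) (borel \<Otimes>\<^sub>M borel) ?u = distr M (borel \<Otimes>\<^sub>M borel) (\<lambda>\<omega>. (V \<omega>, W \<omega>))"
    by (subst distr_distr) (auto simp: comp_def us[of "(V \<omega>, W \<omega>)" for \<omega>, simplified])
  moreover have "distr (distr (?V \<Otimes>\<^sub>M ?W) borel ?s) (borel \<Otimes>\<^sub>M borel) ?u = distr (?V \<Otimes>\<^sub>M ?W) (borel \<Otimes>\<^sub>M borel) (\<lambda>p. p)"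
    by (subst distr_distr) (auto simp: comp_def us)
  moreover have "distr (?V \<Otimes>\<^sub>M ?W) (borel \<Otimes>\<^sub>M borel) (\<lambda>p. p) = ?V \<Otimes>\<^sub>M ?W"
    by (rule distr_id2) (simp cong: sets_pair_measure_cong)
  ultimately show ?thesis by simp
qed


lemma matrix_inv_mult:
  fixes A :: "real^'n^'n"
  assumes "invertible A"
  shows "A ** matrix_inv A = mat 1" "matrix_inv A ** A = mat 1"
  using assms unfolding invertible_def matrix_inv_def
  by (metis (mono_tags, lifting) someI_ex)+

text \<open>
  With \<open>A = cov_mat M X W ** matrix_inv (cov_mat M W W)\<close> the residual \<open>X - A W\<close> is uncorrelated with
  \<open>W\<close>, hence independent of it, and \<open>K w\<close> is the law of \<open>X - A W + A w\<close>.
\<close>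
lemma (in prob_space) gauss_cond_distr_exists:
  fixes X :: "'a \<Rightarrow> real^'k" and W :: "'a \<Rightarrow> real^'m"
  assumes jg: "jointly_gauss M X W" and inv: "invertible (cov_mat M W W)"
  shows "\<exists>K. gauss_cond_distr M X W K"
proof -
  define A where "A = cov_mat M X W ** matrix_inv (cov_mat M W W)"
  define V where "V \<omega> = X \<omega> + (- A) *v W \<omega>" for \<omega>
  note X[measurable] = jointly_gauss_square_integrable(1)[OF jg]
  note W[measurable] = jointly_gauss_square_integrable(2)[OF jg]
  note AW[measurable] = square_integrable_matrix_vector_mult[OF W, of "- A"]
  have V[measurable]: "square_integrable M V" unfolding V_def by (rule square_integrable_add[OF X AW])
  have cXY: "cov_mat M V Y = cov_mat M X Y - A ** cov_mat M W Y" if Y: "square_integrable M Y" for Y :: "'a \<Rightarrow> real^'l"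
  proof -
    have "cov_mat M V Y = cov_mat M X Y + (- A) ** cov_mat M W Y"
      unfolding V_def cov_mat_add_left[OF X AW Y] cov_mat_matrix_vector_mult_left[OF W Y] ..
    also have "(- A) ** cov_mat M W Y = - (A ** cov_mat M W Y)"
      by (simp add: matrix_matrix_mult_def vec_eq_iff sum_negf)
    finally show ?thesis by simp
  qed
  \<comment> \<open>The normal equation of linear regression: it is what makes the residual
    uncorrelated with \<open>W\<close>.\<close>
  have AWW: "A ** cov_mat M W W = cov_mat M X W"
    unfolding A_def matrix_mul_assoc[symmetric] matrix_inv_mult(2)[OF inv] by simp
  have VW: "cov_mat M V W = 0" unfolding cXY[OF W] AWW by simp
  have VX: "cov_mat M V X = cov_mat M X X - A ** transpose (cov_mat M X W)"
    unfolding cXY[OF X] transpose_cov_mat ..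
  \<comment> \<open>The correction by a multiple of \<open>W\<close> contributes nothing against
    \<open>V\<close>, so the variance of the residual equals the covariance of \<open>X\<close> with
    \<open>V\<close>, which is the conditional covariance to be produced.\<close>
  have VV: "cov_mat M V V = cov_mat M X X - A ** transpose (cov_mat M X W)"
  proof -
    have "transpose (cov_mat M X V) = cov_mat M X X - A ** transpose (cov_mat M X W)"
      unfolding transpose_cov_mat[of X V] VX ..
    moreover have "transpose (cov_mat M W V) = 0" unfolding transpose_cov_mat[of W V] VW ..
    then have "cov_mat M W V = 0" by (simp add: transpose_def vec_eq_iff)
    then have "cov_mat M V V = cov_mat M X V" unfolding cXY[OF V] by simp
    ultimately show ?thesis using transpose_cov_mat[of V V] by simp
  qed
  have mV: "mean_vec M V = mean_vec M X - A *v mean_vec M W"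
    unfolding V_def mean_vec_add[OF X AW] mean_vec_matrix_vector_mult[OF W]
    by (simp add: matrix_vector_mult_def vec_eq_iff sum_negf)
  \<comment> \<open>In terms of \<open>k' = k - transpose A *v l\<close> the expression
    \<open>l \<bullet> V \<omega> + k \<bullet> W \<omega>\<close> is a linear form in
    \<open>X\<close> and \<open>W\<close>, to which joint normality applies; the cross term of its
    variance is zero by \<open>VW\<close>, so the exponential splits.\<close>
  have char: "(\<integral>\<omega>. iexp (l \<bullet> V \<omega> + k \<bullet> W \<omega>) \<partial>M) =
    exp (\<i> * complex_of_real (l \<bullet> mean_vec M V) - complex_of_real (l \<bullet> (cov_mat M V V *v l)) / 2)
    * exp (\<i> * complex_of_real (k \<bullet> mean_vec M W) - complex_of_real (k \<bullet> (cov_mat M W W *v k)) / 2)" for l k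
  proof -
    define k' where "k' = k - transpose A *v l"
    have lA: "l \<bullet> (A *v w) = (transpose A *v l) \<bullet> w" for w
      by (simp add: dot_lmul_matrix vector_transpose_matrix)
    have V': "V \<omega> = X \<omega> - A *v W \<omega>" for \<omega>
      by (simp add: V_def matrix_vector_mult_def vec_eq_iff sum_negf)
    have lV: "l \<bullet> V \<omega> + k \<bullet> W \<omega> = l \<bullet> X \<omega> + k' \<bullet> W \<omega>" for \<omega>
      by (simp add: V' k'_def inner_diff_right inner_diff_left lA)
    have lm: "l \<bullet> mean_vec M V + k \<bullet> mean_vec M W = l \<bullet> mean_vec M X + k' \<bullet> mean_vec M W"
      by (simp add: mV k'_def inner_diff_right inner_diff_left lA)
    have lc: "l \<bullet> (X \<omega> - mean_vec M X) + k' \<bullet> (W \<omega> - mean_vec M W) =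
        l \<bullet> (V \<omega> - mean_vec M V) + k \<bullet> (W \<omega> - mean_vec M W)" for \<omega>
      using lV[of \<omega>] lm by (simp add: inner_diff_right)
    note i = integrable_inner_mult_inner[OF square_integrable_centred square_integrable_centred]
    have "(\<integral>\<omega>. (l \<bullet> (V \<omega> - mean_vec M V) + k \<bullet> (W \<omega> - mean_vec M W))\<^sup>2 \<partial>M) =
      (\<integral>\<omega>. (l \<bullet> (V \<omega> - mean_vec M V)) * (l \<bullet> (V \<omega> - mean_vec M V))
        + (2 * ((l \<bullet> (V \<omega> - mean_vec M V)) * (k \<bullet> (W \<omega> - mean_vec M W)))
        + (k \<bullet> (W \<omega> - mean_vec M W)) * (k \<bullet> (W \<omega> - mean_vec M W))) \<partial>M)"
      by (rule Bochner_Integration.integral_cong) (simp_all add: power2_eq_square algebra_simps)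
    also have "\<dots> = l \<bullet> (cov_mat M V V *v l) + (2 * (l \<bullet> (cov_mat M V W *v k)) + k \<bullet> (cov_mat M W W *v k))"
      unfolding inner_cov_mat[OF V V] inner_cov_mat[OF V W] inner_cov_mat[OF W W]
      by (subst Bochner_Integration.integral_add, intro i V W,
          intro Bochner_Integration.integrable_add integrable_mult_right i V W,
          subst Bochner_Integration.integral_add, intro integrable_mult_right i V W, intro i V W) simp
    also have "\<dots> = l \<bullet> (cov_mat M V V *v l) + k \<bullet> (cov_mat M W W *v k)"
      by (simp add: VW)
    finally have var: "(\<integral>\<omega>. (l \<bullet> (V \<omega> - mean_vec M V) + k \<bullet> (W \<omega> - mean_vec M W))\<^sup>2 \<partial>M) =
      l \<bullet> (cov_mat M V V *v l) + k \<bullet> (cov_mat M W W *v k)" .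
    show ?thesis
      unfolding lV jointly_gauss_char[OF jg] lm[symmetric] lc var
      by (simp add: exp_add[symmetric] ring_distribs add_divide_distrib algebra_simps)
  qed
  have charV: "(\<integral>\<omega>. iexp (l \<bullet> V \<omega>) \<partial>M) =
    exp (\<i> * complex_of_real (l \<bullet> mean_vec M V) - complex_of_real (l \<bullet> (cov_mat M V V *v l)) / 2)" for l
    using char[of l 0] by simp
  have charW: "(\<integral>\<omega>. iexp (k \<bullet> W \<omega>) \<partial>M) =
    exp (\<i> * complex_of_real (k \<bullet> mean_vec M W) - complex_of_real (k \<bullet> (cov_mat M W W *v k)) / 2)" for k
    using char[of 0 k] by simp
  have Vm[measurable]: "V \<in> borel_measurable M" and Wm[measurable]: "W \<in> borel_measurable M" and Xm[measurable]: "X \<in> borel_measurable M"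
    using V W X by (auto simp only: square_integrable_def)
  have indep: "distr M (borel \<Otimes>\<^sub>M borel) (\<lambda>\<omega>. (V \<omega>, W \<omega>)) = distr M borel V \<Otimes>\<^sub>M distr M borel W"
    by (rule char_fn_indep[OF Vm Wm]) (simp only: char charV charW)
  interpret dV: prob_space "distr M borel V" by (rule prob_space_distr) measurable
  interpret dW: prob_space "distr M borel W" by (rule prob_space_distr) measurable
  interpret P: pair_prob_space "distr M borel V" "distr M borel W" ..
  have Am[measurable]: "(\<lambda>w. A *v w) \<in> borel_measurable borel" by measurable
  define K where "K w = distr (distr M borel V) borel (\<lambda>v. v + A *v w)" for w
  have Kprob: "prob_space (K w)" for w unfolding K_def by (rule dV.prob_space_distr) measurable
  have Kint: "(\<integral>x. f x \<partial>K w) = (\<integral>\<omega>. f (V \<omega> + A *v w) \<partial>M)"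
    if [measurable]: "f \<in> borel_measurable borel" for f :: "real^'k \<Rightarrow> complex" and w
    unfolding K_def by (subst integral_distr, measurable, subst integral_distr, measurable)
  have "gauss_cond_distr M X W K"
    unfolding gauss_cond_distr_def
  proof (intro conjI allI jg inv)
    show "regular_cond_distr M X W K"
      unfolding regular_cond_distr_def
    proof (intro conjI ballI)
      have "distr M borel V \<in> space (subprob_algebra borel)"
        by (auto simp: space_subprob_algebra dV.prob_space_axioms intro: prob_space_imp_subprob_space)
      then show "K \<in> borel \<rightarrow>\<^sub>M prob_algebra borel"
        unfolding K_def[abs_def]
        by (intro measurable_prob_algebraI measurable_distr2[where M=borel])
           (simp_all add: Kprob[unfolded K_def])
      fix S :: "(real^'k) set" and C :: "(real^'m) set" assume [measurable]: "S \<in> sets borel" "C \<in> sets borel"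
      define D where "D = {p :: (real^'k) \<times> (real^'m). fst p + A *v snd p \<in> S \<and> snd p \<in> C}"
      have D[measurable]: "D \<in> sets (borel \<Otimes>\<^sub>M borel)"
      proof -
        have m[measurable]: "(\<lambda>p :: (real^'k) \<times> (real^'m). fst p + A *v snd p) \<in> borel \<Otimes>\<^sub>M borel \<rightarrow>\<^sub>M borel"
          by (intro borel_measurable_add measurable_fst measurable_compose[OF measurable_snd Am])
        have "D = {p \<in> space (borel \<Otimes>\<^sub>M borel). fst p + A *v snd p \<in> S \<and> snd p \<in> C}"
          by (simp add: D_def space_pair_measure)
        also have "\<dots> = (\<lambda>p. fst p + A *v snd p) -` S \<inter> space (borel \<Otimes>\<^sub>M borel) \<inter> (snd -` C \<inter> space (borel \<Otimes>\<^sub>M borel))"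
          by auto
        also have "\<dots> \<in> sets (borel \<Otimes>\<^sub>M borel)"
          by (intro sets.Int measurable_sets[OF m] measurable_sets[OF measurable_snd]) fact+
        finally show ?thesis .
      qed
      have XV: "X \<omega> = V \<omega> + A *v W \<omega>" for \<omega>
        by (simp add: V_def matrix_vector_mult_def vec_eq_iff sum_negf)
      have "emeasure M {\<omega> \<in> space M. X \<omega> \<in> S \<and> W \<omega> \<in> C} = emeasure (distr M (borel \<Otimes>\<^sub>M borel) (\<lambda>\<omega>. (V \<omega>, W \<omega>))) D"
      proof -
        have VWm: "(\<lambda>\<omega>. (V \<omega>, W \<omega>)) \<in> M \<rightarrow>\<^sub>M borel \<Otimes>\<^sub>M borel" by measurable
        have "(\<lambda>\<omega>. (V \<omega>, W \<omega>)) -` D \<inter> space M = {\<omega> \<in> space M. X \<omega> \<in> S \<and> W \<omega> \<in> C}"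
          by (auto simp: D_def XV)
        then show ?thesis unfolding emeasure_distr[OF VWm D] by simp
      qed
      \<comment> \<open>Under the product law the slice at \<open>w\<close> is
        \<open>{v. v + A *v w \<in> S}\<close> for \<open>w \<in> C\<close> and empty otherwise, so
        integrating over the slices yields the integral of \<open>K w\<close>.\<close>
      also have "\<dots> = (\<integral>\<^sup>+w. emeasure (distr M borel V) ((\<lambda>v. (v, w)) -` D) \<partial>distr M borel W)"
        unfolding indep by (rule P.emeasure_pair_measure_alt2) (simp cong: sets_pair_measure_cong)
      also have "\<dots> = (\<integral>\<^sup>+w\<in>C. emeasure (K w) S \<partial>distr M borel W)"
      proof (rule nn_integral_cong)
        fix w
        have "emeasure (K w) S = emeasure (distr M borel V) {v. v + A *v w \<in> S}"
          unfolding K_def by (subst emeasure_distr) (auto simp: vimage_def)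
        then show "emeasure (distr M borel V) ((\<lambda>v. (v, w)) -` D) = emeasure (K w) S * indicator C w"
          by (auto simp: D_def vimage_def indicator_def)
      qed
      finally show "emeasure M {\<omega> \<in> space M. X \<omega> \<in> S \<and> W \<omega> \<in> C} = (\<integral>\<^sup>+w\<in>C. emeasure (K w) S \<partial>distr M borel W)" .
    qed
    fix w
    have "is_gauss (K w) (mean_vec M X + A *v (w - mean_vec M W)) (cov_mat M V V)"
      unfolding is_gauss_def
    proof (intro conjI allI Kprob)
      show "sets (K w) = sets borel" by (simp add: K_def)
      show "transpose (cov_mat M V V) = cov_mat M V V" by (rule transpose_cov_mat)
      fix l
      have "(\<integral>x. iexp (l \<bullet> x) \<partial>K w) = (\<integral>\<omega>. iexp (l \<bullet> (A *v w)) * iexp (l \<bullet> V \<omega>) \<partial>M)"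
        by (subst Kint) (simp_all add: inner_add_right ring_distribs exp_add mult.commute)
      also have "\<dots> = iexp (l \<bullet> (A *v w)) * (\<integral>\<omega>. iexp (l \<bullet> V \<omega>) \<partial>M)" by simp
      also have "\<dots> = exp (\<i> * complex_of_real (l \<bullet> (mean_vec M X + A *v (w - mean_vec M W)))
          - complex_of_real (l \<bullet> (cov_mat M V V *v l)) / 2)"
        unfolding charV mV exp_add[symmetric]
        by (simp add: inner_diff_right inner_add_right matrix_vector_mult_diff_distrib algebra_simps)
      finally show "(\<integral>x. iexp (l \<bullet> x) \<partial>K w) = exp (\<i> * complex_of_real (l \<bullet> (mean_vec M X + A *v (w - mean_vec M W)))
          - complex_of_real (l \<bullet> (cov_mat M V V *v l)) / 2)" .
    qed
    then show "is_gauss (K w)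
        (mean_vec M X + (cov_mat M X W ** matrix_inv (cov_mat M W W)) *v (w - mean_vec M W))
        (cov_mat M X X - cov_mat M X W ** matrix_inv (cov_mat M W W) ** transpose (cov_mat M X W))"
      unfolding VV A_def[symmetric] .
  qed
  then show ?thesis by blast
qed

section \<open>Wiener integrals of deterministic integrands\<close>

text \<open>Integrands live on the whole line and are cut off by indicators where they are used, so
  that integrals up to different times are compared in a single inner product space.\<close>

definition L2_fun :: "(real \<Rightarrow> real^'p) \<Rightarrow> bool" where
  "L2_fun f \<longleftrightarrow> f \<in> borel_measurable borel \<and> integrable lborel (\<lambda>u. f u \<bullet> f u)"

lemma L2_fun_measurable[measurable_dest]: "L2_fun f \<Longrightarrow> f \<in> borel_measurable borel"
  by (simp add: L2_fun_def)

lemma inner_le_sum_squares: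
  fixes x y :: "'a::real_inner"
  shows "\<bar>x \<bullet> y\<bar> \<le> x \<bullet> x + y \<bullet> y"
proof -
  have "0 \<le> (x + y) \<bullet> (x + y)" "0 \<le> (x - y) \<bullet> (x - y)" by simp_all
  then have "\<bar>2 * (x \<bullet> y)\<bar> \<le> x \<bullet> x + y \<bullet> y"
    by (simp add: inner_add_left inner_add_right inner_diff_left inner_diff_right inner_commute)
  moreover have "0 \<le> x \<bullet> x" "0 \<le> y \<bullet> y" by simp_all
  ultimately show ?thesis by linarith
qed

lemma inner_add_self_le:
  fixes x y :: "'a::real_inner"
  shows "(x + y) \<bullet> (x + y) \<le> 2 * (x \<bullet> x) + 2 * (y \<bullet> y)"
proof -
  have "0 \<le> (x - y) \<bullet> (x - y)" by simp
  then show ?thesis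
    by (simp add: inner_add_left inner_add_right inner_diff_left inner_diff_right inner_commute)
qed

lemma L2_fun_inner:
  assumes [measurable]: "L2_fun f" "L2_fun g"
  shows "integrable lborel (\<lambda>u. f u \<bullet> g u)"
proof (rule Bochner_Integration.integrable_bound)
  show "integrable lborel (\<lambda>u. f u \<bullet> f u + g u \<bullet> g u)"
    using assms by (simp add: L2_fun_def)
  show "AE u in lborel. norm (f u \<bullet> g u) \<le> norm (f u \<bullet> f u + g u \<bullet> g u)"
    using inner_le_sum_squares[of "f u" "g u" for u] by (simp add: add_nonneg_nonneg)
qed measurable

lemma L2_fun_add:
  assumes [measurable]: "L2_fun f" "L2_fun g"
  shows "L2_fun (\<lambda>u. f u + g u)"
  unfolding L2_fun_def
  by (simp add: inner_add_left inner_add_right L2_fun_inner[OF assms(1) assms(1)] L2_fun_inner[OF assms(1) assms(2)]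
    L2_fun_inner[OF assms(2) assms(1)] L2_fun_inner[OF assms(2) assms(2)])

lemma L2_fun_scaleR:
  assumes [measurable]: "L2_fun f"
  shows "L2_fun (\<lambda>u. c *\<^sub>R f u)"
  using assms by (simp add: L2_fun_def)

lemma L2_fun_diff:
  assumes "L2_fun f" "L2_fun g"
  shows "L2_fun (\<lambda>u. f u - g u)"
  using L2_fun_add[OF assms(1) L2_fun_scaleR[OF assms(2), of "-1"]] by simp

lemma L2_fun_zero: "L2_fun (\<lambda>u. 0)"
  by (simp add: L2_fun_def)

lemma L2_fun_sum:
  assumes "\<And>i. i \<in> I \<Longrightarrow> L2_fun (f i)"
  shows "L2_fun (\<lambda>u. \<Sum>i\<in>I. f i u)"
  using assms by (induction I rule: infinite_finite_induct) (simp_all add: L2_fun_zero L2_fun_add)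

lemma L2_fun_indicator: "L2_fun (\<lambda>u. indicator {a<..b} u *\<^sub>R v)"
proof -
  have "(\<lambda>u. (indicator {a<..b} u *\<^sub>R v) \<bullet> (indicator {a<..b} u *\<^sub>R v)) = (\<lambda>u. indicator {a<..b} u *\<^sub>R (v \<bullet> v))"
    by (auto simp: indicator_def)
  then show ?thesis by (cases "a \<le> b") (simp_all add: L2_fun_def integrable_scaleR_left)
qed

lemma integral_inner_add_le:
  assumes "L2_fun f" "L2_fun g"
  shows "(\<integral>u. (f u + g u) \<bullet> (f u + g u) \<partial>lborel) \<le> 2 * (\<integral>u. f u \<bullet> f u \<partial>lborel) + 2 * (\<integral>u. g u \<bullet> g u \<partial>lborel)"
proof -
  have "(\<integral>u. (f u + g u) \<bullet> (f u + g u) \<partial>lborel) \<le> (\<integral>u. 2 * (f u \<bullet> f u) + 2 * (g u \<bullet> g u) \<partial>lborel)"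
    by (rule integral_mono) (use L2_fun_add[OF assms] assms in \<open>simp_all add: L2_fun_inner inner_add_self_le\<close>)
  then show ?thesis using assms by (simp add: L2_fun_inner)
qed

text \<open>The spanning family consists of the indicators of \<open>{0<..c}\<close>, not of
  disjoint intervals: the integral of such an indicator is simply \<open>B c\<close>, almost surely
  the increment from time 0, and adding two step functions only needs a common index set.\<close>

definition step_pair :: "(real \<Rightarrow> 'w \<Rightarrow> real^'p) \<Rightarrow> (real \<Rightarrow> real^'p) \<Rightarrow> ('w \<Rightarrow> real) \<Rightarrow> bool" where
  "step_pair B \<phi> S \<longleftrightarrow> (\<exists>C w. finite C \<and> C \<subseteq> {0..} \<and>
     \<phi> = (\<lambda>u. \<Sum>c\<in>C. indicator {0<..c} u *\<^sub>R w c) \<and> S = (\<lambda>\<omega>. \<Sum>c\<in>C. w c \<bullet> B c \<omega>))"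

lemma step_pair_L2_fun: "step_pair B \<phi> S \<Longrightarrow> L2_fun \<phi>"
  by (auto simp: step_pair_def intro!: L2_fun_sum L2_fun_indicator)

lemma step_pair_term: "0 \<le> c \<Longrightarrow> step_pair B (\<lambda>u. indicator {0<..c} u *\<^sub>R v) (\<lambda>\<omega>. v \<bullet> B c \<omega>)"
  unfolding step_pair_def by (rule exI[of _ "{c}"], rule exI[of _ "\<lambda>_. v"]) (simp del: sum_indicator_scaleR)

text \<open>Zero coefficients outside the original index set let two step functions be written over
  one common finite set.\<close>

lemma step_pair_superset:
  assumes "step_pair B \<phi> S"
  obtains C w where "finite C" "C \<subseteq> {0..}" "\<And>D. finite D \<Longrightarrow> C \<subseteq> D \<Longrightarrow>
     \<phi> = (\<lambda>u. \<Sum>c\<in>D. indicator {0<..c} u *\<^sub>R w c) \<and> S = (\<lambda>\<omega>. \<Sum>c\<in>D. w c \<bullet> B c \<omega>)"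
proof -
  obtain C w where C: "finite C" "C \<subseteq> {0..}" "\<phi> = (\<lambda>u. \<Sum>c\<in>C. indicator {0<..c} u *\<^sub>R w c)"
      "S = (\<lambda>\<omega>. \<Sum>c\<in>C. w c \<bullet> B c \<omega>)"
    using assms by (auto simp: step_pair_def)
  define w' where "w' c = (if c \<in> C then w c else 0)" for c
  show thesis
  proof (rule that[of C w'])
    fix D assume D: "finite D" "C \<subseteq> D"
    have "\<phi> u = (\<Sum>c\<in>D. indicator {0<..c} u *\<^sub>R w' c)" for u
      unfolding C by (rule sum.mono_neutral_cong_left) (use D C(1) in \<open>auto simp: w'_def\<close>)
    moreover have "S \<omega> = (\<Sum>c\<in>D. w' c \<bullet> B c \<omega>)" for \<omega>
      unfolding C by (rule sum.mono_neutral_cong_left) (use D C(1) in \<open>auto simp: w'_def\<close>)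
    ultimately show "\<phi> = (\<lambda>u. \<Sum>c\<in>D. indicator {0<..c} u *\<^sub>R w' c) \<and> S = (\<lambda>\<omega>. \<Sum>c\<in>D. w' c \<bullet> B c \<omega>)"
      by blast
  qed (use C in auto)
qed

lemma step_pair_add:
  assumes "step_pair B \<phi> S" "step_pair B \<psi> R"
  shows "step_pair B (\<lambda>u. \<phi> u + \<psi> u) (\<lambda>\<omega>. S \<omega> + R \<omega>)"
proof -
  obtain C w where C: "finite C" "C \<subseteq> {0..}" "\<And>D. finite D \<Longrightarrow> C \<subseteq> D \<Longrightarrow>
     \<phi> = (\<lambda>u. \<Sum>c\<in>D. indicator {0<..c} u *\<^sub>R w c) \<and> S = (\<lambda>\<omega>. \<Sum>c\<in>D. w c \<bullet> B c \<omega>)"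
    by (rule step_pair_superset[OF assms(1)]) blast
  obtain C' w' where C': "finite C'" "C' \<subseteq> {0..}" "\<And>D. finite D \<Longrightarrow> C' \<subseteq> D \<Longrightarrow>
     \<psi> = (\<lambda>u. \<Sum>c\<in>D. indicator {0<..c} u *\<^sub>R w' c) \<and> R = (\<lambda>\<omega>. \<Sum>c\<in>D. w' c \<bullet> B c \<omega>)"
    by (rule step_pair_superset[OF assms(2)]) blast
  have eqs: "\<phi> = (\<lambda>u. \<Sum>c\<in>C \<union> C'. indicator {0<..c} u *\<^sub>R w c)" "S = (\<lambda>\<omega>. \<Sum>c\<in>C \<union> C'. w c \<bullet> B c \<omega>)"
     "\<psi> = (\<lambda>u. \<Sum>c\<in>C \<union> C'. indicator {0<..c} u *\<^sub>R w' c)" "R = (\<lambda>\<omega>. \<Sum>c\<in>C \<union> C'. w' c \<bullet> B c \<omega>)"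
    using C(3)[of "C \<union> C'"] C'(3)[of "C \<union> C'"] C(1) C'(1) by simp_all
  show ?thesis
    unfolding step_pair_def
    by (rule exI[of _ "C \<union> C'"], rule exI[of _ "\<lambda>c. w c + w' c"])
       (use C(1,2) C'(1,2) in \<open>simp add: eqs scaleR_add_right inner_add_left sum.distrib del: sum_indicator_scaleR\<close>)
qed

lemma step_pair_scale:
  assumes "step_pair B \<phi> S"
  shows "step_pair B (\<lambda>u. a *\<^sub>R \<phi> u) (\<lambda>\<omega>. a * S \<omega>)"
proof -
  obtain C w where C: "finite C" "C \<subseteq> {0..}" "\<phi> = (\<lambda>u. \<Sum>c\<in>C. indicator {0<..c} u *\<^sub>R w c)"
      "S = (\<lambda>\<omega>. \<Sum>c\<in>C. w c \<bullet> B c \<omega>)"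
    using assms by (auto simp: step_pair_def)
  show ?thesis
    unfolding step_pair_def
    by (rule exI[of _ C], rule exI[of _ "\<lambda>c. a *\<^sub>R w c"]) (use C in \<open>simp add: scaleR_sum_right sum_distrib_left mult_ac del: sum_indicator_scaleR\<close>)
qed

text \<open>
  The truncated square metrises convergence in probability, so that the relation is closed under almost
  sure limits, which preserve characteristic functions.
\<close>
definition wiener_integral :: "'w measure \<Rightarrow> (real \<Rightarrow> 'w \<Rightarrow> real^'p) \<Rightarrow> (real \<Rightarrow> real^'p) \<Rightarrow> ('w \<Rightarrow> real) \<Rightarrow> bool" where
  "wiener_integral M B f X \<longleftrightarrow> L2_fun f \<and> X \<in> borel_measurable M \<and>
     (\<forall>\<epsilon>>0. \<exists>\<phi> S. step_pair B \<phi> S \<and> (\<integral>u. (\<phi> u - f u) \<bullet> (\<phi> u - f u) \<partial>lborel) < \<epsilon> \<and>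
        (\<integral>\<omega>. min 1 ((S \<omega> - X \<omega>)\<^sup>2) \<partial>M) < \<epsilon>)"

section \<open>Increments of the Wiener process and integrals of step functions\<close>

locale wiener = prob_space M for M :: "'w measure" +
  fixes F :: "real \<Rightarrow> 'w measure" and B :: "real \<Rightarrow> 'w \<Rightarrow> real^'p"
  assumes filtration: "usual_filtration M F" and wiener: "wiener_process M F B"
begin

lemma F_measurable_mono:
  assumes "0 \<le> s" "s \<le> t" "X \<in> borel_measurable (F s)"
  shows "X \<in> borel_measurable (F t)"
proof (rule measurable_from_subalg[OF _ assms(3)])
  show "subalgebra (F t) (F s)"
    using filtration assms(1,2) by (auto simp: usual_filtration_def subalgebra_def)
qed

lemma F_measurable: "0 \<le> s \<Longrightarrow> X \<in> borel_measurable (F s) \<Longrightarrow> X \<in> borel_measurable M"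
  using filtration by (auto simp: usual_filtration_def intro: measurable_from_subalg)

lemma B_adapted: "0 \<le> s \<Longrightarrow> B s \<in> borel_measurable (F s)"
  using wiener by (auto simp: wiener_process_def)

lemma B_measurable: "0 \<le> s \<Longrightarrow> B s \<in> borel_measurable M"
  using B_adapted F_measurable by blast

text \<open>Events of a linear functional of the increment are events of the increment, and those of
  \<open>X\<close> lie in \<open>F s\<close>, so both families inherit independence; being
  intersection-stable, they pass it on to the generated sigma-algebras.\<close>

lemma increment_indep:
  assumes s: "0 \<le> s" "s < t" and X: "X \<in> borel_measurable (F s)"
  shows "indep_var borel X borel (\<lambda>\<omega>. v \<bullet> (B t \<omega> - B s \<omega>))"
proof -
  have ind: "indep_set (sets (F s)) {(\<lambda>\<omega>. B t \<omega> - B s \<omega>) -` A \<inter> space M | A. A \<in> sets borel}"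
    using wiener s by (auto simp: wiener_process_def)
  note [measurable] = F_measurable[OF s(1) X] B_measurable[OF s(1)] B_measurable[OF order_trans[OF s(1) less_imp_le[OF s(2)]]]
  have spF: "space (F s) = space M" using filtration s by (auto simp: usual_filtration_def subalgebra_def)
  have stable: "Int_stable {Y -` A \<inter> space M | A. A \<in> sets borel}" for Y :: "'w \<Rightarrow> real"
    unfolding Int_stable_def
  proof safe
    fix a b :: "real set" assume "a \<in> sets borel" "b \<in> sets borel"
    then show "\<exists>A. (Y -` a \<inter> space M) \<inter> (Y -` b \<inter> space M) = Y -` A \<inter> space M \<and> A \<in> sets borel"
      by (intro exI[of _ "a \<inter> b"]) auto
  qed
  have XA: "{X -` A \<inter> space M | A. A \<in> sets borel} \<subseteq> sets (F s)"
    using measurable_sets[OF X] spF by auto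
  have YA: "{(\<lambda>\<omega>. v \<bullet> (B t \<omega> - B s \<omega>)) -` A \<inter> space M | A. A \<in> sets borel}
    \<subseteq> {(\<lambda>\<omega>. B t \<omega> - B s \<omega>) -` A \<inter> space M | A. A \<in> sets borel}"
  proof safe
    fix A :: "real set" assume A: "A \<in> sets borel"
    have "(\<lambda>x. v \<bullet> x) -` A \<inter> space borel \<in> sets borel" by (rule measurable_sets[OF _ A]) simp
    then show "\<exists>A'. (\<lambda>\<omega>. v \<bullet> (B t \<omega> - B s \<omega>)) -` A \<inter> space M = (\<lambda>\<omega>. B t \<omega> - B s \<omega>) -` A' \<inter> space M \<and> A' \<in> sets borel"
      by (intro exI[of _ "(\<lambda>x. v \<bullet> x) -` A"]) auto
  qed
  have "indep_set {X -` A \<inter> space M | A. A \<in> sets borel} {(\<lambda>\<omega>. v \<bullet> (B t \<omega> - B s \<omega>)) -` A \<inter> space M | A. A \<in> sets borel}"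
    unfolding indep_sets2_eq
  proof (intro conjI ballI)
    fix a b assume a: "a \<in> {X -` A \<inter> space M | A. A \<in> sets borel}"
      and b: "b \<in> {(\<lambda>\<omega>. v \<bullet> (B t \<omega> - B s \<omega>)) -` A \<inter> space M | A. A \<in> sets borel}"
    show "prob (a \<inter> b) = prob a * prob b"
      by (rule indep_setD[OF ind subsetD[OF XA a] subsetD[OF YA b]])
  qed (rule order_trans[OF XA indep_setD_ev1[OF ind]], rule order_trans[OF YA indep_setD_ev2[OF ind]])
  note ind' = indep_set_sigma_sets[OF this stable stable]
  have Xm: "random_variable borel X" and Ym: "random_variable borel (\<lambda>\<omega>. v \<bullet> (B t \<omega> - B s \<omega>))"
    by measurable
  show ?thesis unfolding indep_var_eq by (intro conjI Xm Ym ind')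
qed

lemma increment_char:
  assumes s: "0 \<le> s" "s < t"
  shows "(\<integral>\<omega>. iexp (v \<bullet> (B t \<omega> - B s \<omega>)) \<partial>M) = exp (- complex_of_real ((t - s) * (v \<bullet> v)) / 2)"
proof -
  note [measurable] = B_measurable[OF s(1)] B_measurable[OF order_trans[OF s(1) less_imp_le[OF s(2)]]]
  have "(\<integral>x. iexp (v \<bullet> x) \<partial>distr M borel (\<lambda>\<omega>. B t \<omega> - B s \<omega>)) =
    exp (\<i> * complex_of_real (v \<bullet> 0) - complex_of_real (v \<bullet> (((t - s) *\<^sub>R mat 1) *v v)) / 2)"
    using wiener s unfolding wiener_process_def is_gauss_def by blast
  then show ?thesis
    by (subst (asm) integral_distr) (simp_all add: scaleR_matrix_vector_assoc[symmetric])
qed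

lemma increment_moments:
  assumes s: "0 \<le> s" "s \<le> t"
  shows "integrable M (\<lambda>\<omega>. v \<bullet> (B t \<omega> - B s \<omega>))" "expectation (\<lambda>\<omega>. v \<bullet> (B t \<omega> - B s \<omega>)) = 0"
    "integrable M (\<lambda>\<omega>. (v \<bullet> (B t \<omega> - B s \<omega>))\<^sup>2)" "expectation (\<lambda>\<omega>. (v \<bullet> (B t \<omega> - B s \<omega>))\<^sup>2) = (t - s) * (v \<bullet> v)"
proof -
  have meas: "(\<lambda>\<omega>. v \<bullet> (B t \<omega> - B s \<omega>)) \<in> borel_measurable M"
    using B_measurable[OF s(1)] B_measurable[OF order_trans[OF s]] by measurable
  have ch: "(\<integral>\<omega>. iexp (\<theta> * (v \<bullet> (B t \<omega> - B s \<omega>))) \<partial>M) =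
      exp (\<i> * complex_of_real (\<theta> * 0) - complex_of_real (\<theta>\<^sup>2 * ((t - s) * (v \<bullet> v))) / 2)" for \<theta>
  proof (cases "s = t")
    case False
    then show ?thesis
      using increment_char[of s t "\<theta> *\<^sub>R v"] s by (simp add: power2_eq_square mult_ac)
  qed (simp add: prob_space)
  note mom = gauss_char_moments[OF meas ch]
  show "integrable M (\<lambda>\<omega>. v \<bullet> (B t \<omega> - B s \<omega>))" by (rule mom(2))
  show "expectation (\<lambda>\<omega>. v \<bullet> (B t \<omega> - B s \<omega>)) = 0" by (rule mom(3))
  show "integrable M (\<lambda>\<omega>. (v \<bullet> (B t \<omega> - B s \<omega>))\<^sup>2)" by (rule mom(4))
  show "expectation (\<lambda>\<omega>. (v \<bullet> (B t \<omega> - B s \<omega>))\<^sup>2) = (t - s) * (v \<bullet> v)" using mom(5) by simp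
qed

lemma step_measurable: "step_pair B \<phi> S \<Longrightarrow> S \<in> borel_measurable M"
proof -
  assume "step_pair B \<phi> S"
  then obtain C w where C: "C \<subseteq> {0..}" "S = (\<lambda>\<omega>. \<Sum>c\<in>C. w c \<bullet> B c \<omega>)" by (auto simp: step_pair_def)
  show ?thesis unfolding C(2)
    by (intro borel_measurable_sum borel_measurable_inner borel_measurable_const B_measurable) (use C in auto)
qed

text \<open>The largest time \<open>b\<close> is peeled off: with \<open>s\<close> the preceding
  time, \<open>w b \<bullet> B b\<close> is a functional of the increment after \<open>s\<close>,
  independent of the past, plus \<open>w b \<bullet> B s\<close>, which is absorbed into the
  coefficient at \<open>s\<close>. Keeping 0 in the index set guarantees a preceding time; the
  coefficients vary in the induction because they change.\<close>

lemma step_char_aux: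
  assumes "finite A" "A \<subseteq> {0<..}"
  shows "(\<integral>\<omega>. iexp (\<Sum>c\<in>insert 0 A. w c \<bullet> B c \<omega>) \<partial>M) =
    exp (- complex_of_real (\<integral>u. (\<Sum>c\<in>insert 0 A. indicator {0<..c} u *\<^sub>R w c) \<bullet> (\<Sum>c\<in>insert 0 A. indicator {0<..c} u *\<^sub>R w c) \<partial>lborel) / 2)"
  using assms
proof (induction A arbitrary: w rule: finite_linorder_max_induct)
  case empty
  have "AE \<omega> in M. B 0 \<omega> = 0" using wiener by (auto simp: wiener_process_def)
  then have "(\<integral>\<omega>. iexp (w 0 \<bullet> B 0 \<omega>) \<partial>M) = (\<integral>\<omega>. 1 \<partial>M)"
    by (intro integral_cong_AE) (use B_measurable[of 0] in \<open>auto\<close>)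
  then show ?case by (simp add: prob_space)
next
  case (insert b A)
  define s where "s = Max (insert 0 A)"
  have fin: "finite (insert 0 A)" using insert(1) by simp
  have s: "s \<in> insert 0 A" "\<And>c. c \<in> insert 0 A \<Longrightarrow> c \<le> s" "0 \<le> s"
    unfolding s_def using Max_in[OF fin] Max_ge[OF fin] by auto
  have sb: "s < b" using s(1) insert by auto
  have bA: "b \<notin> insert 0 A" using s(2)[of b] sb by auto
  define w' where "w' = w(s := w s + w b)"
  define X where "X \<omega> = (\<Sum>c\<in>insert 0 A. w' c \<bullet> B c \<omega>)" for \<omega>
  define \<phi> where "\<phi> u = (\<Sum>c\<in>insert 0 A. indicator {0<..c} u *\<^sub>R w' c)" for u
  \<comment> \<open>Stated for any additive \<open>g\<close>, so that one rearrangement serves both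
    the random sum and the integrand.\<close>
  have split: "(\<Sum>c\<in>insert 0 A. g c (w' c)) = (\<Sum>c\<in>insert 0 A. g c (w c)) + g s (w b)"
    if "\<And>c x y. g c (x + y) = g c x + g c y" for g :: "real \<Rightarrow> real^'p \<Rightarrow> 'z::comm_monoid_add"
    unfolding sum.remove[OF fin s(1)] w'_def by (simp add: that ac_simps)
  have sum: "(\<Sum>c\<in>insert 0 (insert b A). w c \<bullet> B c \<omega>) = X \<omega> + w b \<bullet> (B b \<omega> - B s \<omega>)" for \<omega>
  proof -
    have "X \<omega> = (\<Sum>c\<in>insert 0 A. w c \<bullet> B c \<omega>) + w b \<bullet> B s \<omega>"
      unfolding X_def by (rule split) (simp add: inner_add_left)
    moreover have "(\<Sum>c\<in>insert b (insert 0 A). w c \<bullet> B c \<omega>) = w b \<bullet> B b \<omega> + (\<Sum>c\<in>insert 0 A. w c \<bullet> B c \<omega>)"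
      using bA insert(1) by simp
    ultimately show ?thesis by (simp add: insert_commute inner_diff_right)
  qed
  have sum\<phi>: "(\<Sum>c\<in>insert 0 (insert b A). indicator {0<..c} u *\<^sub>R w c) = \<phi> u + indicator {s<..b} u *\<^sub>R w b" for u
  proof -
    have "\<phi> u = (\<Sum>c\<in>insert 0 A. indicator {0<..c} u *\<^sub>R w c) + indicator {0<..s} u *\<^sub>R w b"
      unfolding \<phi>_def by (rule split) (simp add: scaleR_add_right)
    moreover have "(\<Sum>c\<in>insert b (insert 0 A). indicator {0<..c} u *\<^sub>R w c) = indicator {0<..b} u *\<^sub>R w b + (\<Sum>c\<in>insert 0 A. indicator {0<..c} u *\<^sub>R w c)"
      using bA insert(1) by (simp del: sum_indicator_scaleR)
    moreover have "indicator {0<..b} u = (indicator {0<..s} u + indicator {s<..b} u :: real)"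
      using s(3) sb by (auto simp: indicator_def)
    ultimately show ?thesis by (simp add: insert_commute scaleR_add_left)
  qed
  \<comment> \<open>The earlier part vanishes on \<open>{s<..b}\<close>, so no cross term arises in
    the squared norm and it grows by exactly \<open>(b - s) * (w b \<bullet> w b)\<close>.\<close>
  have \<phi>0: "indicator {s<..b} u *\<^sub>R \<phi> u = 0" for u
  proof (cases "u \<in> {s<..b}")
    case True
    then have "indicator {0<..c} u = (0::real)" if "c \<in> insert 0 A" for c
      using s(2)[OF that] by auto
    then show ?thesis by (simp add: \<phi>_def)
  qed simp
  have L\<phi>: "L2_fun \<phi>" unfolding \<phi>_def by (intro L2_fun_sum L2_fun_indicator)
  have pt: "(\<phi> u + indicator {s<..b} u *\<^sub>R w b) \<bullet> (\<phi> u + indicator {s<..b} u *\<^sub>R w b) =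
      \<phi> u \<bullet> \<phi> u + indicator {s<..b} u *\<^sub>R (w b \<bullet> w b)" for u
    using \<phi>0[of u] by (cases "u \<in> {s<..b}") auto
  have intphi: "(\<integral>u. (\<phi> u + indicator {s<..b} u *\<^sub>R w b) \<bullet> (\<phi> u + indicator {s<..b} u *\<^sub>R w b) \<partial>lborel) =
      (\<integral>u. \<phi> u \<bullet> \<phi> u \<partial>lborel) + (b - s) * (w b \<bullet> w b)"
    unfolding pt using sb L2_fun_inner[OF L\<phi> L\<phi>] by (subst Bochner_Integration.integral_add) simp_all
  have XF: "X \<in> borel_measurable (F s)"
    unfolding X_def
  proof (intro borel_measurable_sum borel_measurable_inner borel_measurable_const)
    fix c assume c: "c \<in> insert 0 A"
    then have "0 \<le> c" using insert(4) by auto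
    then show "B c \<in> borel_measurable (F s)" using F_measurable_mono B_adapted s(2)[OF c] by blast
  qed
  note ind = increment_indep[OF s(3) sb XF, of "w b"]
  have [measurable]: "X \<in> borel_measurable M" using F_measurable[OF s(3) XF] .
  have [measurable]: "(\<lambda>\<omega>. w b \<bullet> (B b \<omega> - B s \<omega>)) \<in> borel_measurable M"
    using indep_var_rv2[OF ind] .
  have "(\<integral>\<omega>. iexp (X \<omega> + w b \<bullet> (B b \<omega> - B s \<omega>)) \<partial>M) = (\<integral>\<omega>. iexp (X \<omega>) * iexp (w b \<bullet> (B b \<omega> - B s \<omega>)) \<partial>M)"
    by (simp add: ring_distribs exp_add)
  also have "\<dots> = (\<integral>\<omega>. iexp (X \<omega>) \<partial>M) * (\<integral>\<omega>. iexp (w b \<bullet> (B b \<omega> - B s \<omega>)) \<partial>M)"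
    by (intro indep_var_lebesgue_integral indep_var_compose[unfolded comp_def, OF ind] integrable_iexp) simp_all
  also have "(\<integral>\<omega>. iexp (X \<omega>) \<partial>M) = exp (- complex_of_real (\<integral>u. \<phi> u \<bullet> \<phi> u \<partial>lborel) / 2)"
    unfolding X_def \<phi>_def using insert by simp
  also have "(\<integral>\<omega>. iexp (w b \<bullet> (B b \<omega> - B s \<omega>)) \<partial>M) = exp (- complex_of_real ((b - s) * (w b \<bullet> w b)) / 2)"
    by (rule increment_char[OF s(3) sb])
  finally show ?case
    unfolding sum sum\<phi> intphi by (simp add: exp_add[symmetric] add_divide_distrib diff_divide_distrib algebra_simps)
qed

lemma step_char:
  assumes "step_pair B \<phi> S"
  shows "(\<integral>\<omega>. iexp (S \<omega>) \<partial>M) = exp (- complex_of_real (\<integral>u. \<phi> u \<bullet> \<phi> u \<partial>lborel) / 2)"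
proof -
  obtain C w where C: "finite C" "C \<subseteq> {0..}" "\<And>D. finite D \<Longrightarrow> C \<subseteq> D \<Longrightarrow>
     \<phi> = (\<lambda>u. \<Sum>c\<in>D. indicator {0<..c} u *\<^sub>R w c) \<and> S = (\<lambda>\<omega>. \<Sum>c\<in>D. w c \<bullet> B c \<omega>)"
    by (rule step_pair_superset[OF assms]) blast
  have "\<phi> = (\<lambda>u. \<Sum>c\<in>insert 0 (C - {0}). indicator {0<..c} u *\<^sub>R w c)" "S = (\<lambda>\<omega>. \<Sum>c\<in>insert 0 (C - {0}). w c \<bullet> B c \<omega>)"
    using C(3)[of "insert 0 (C - {0})"] C(1) by auto
  moreover have "C - {0} \<subseteq> {0<..}" using C(2) by force
  ultimately show ?thesis using step_char_aux[of "C - {0}" w] C(1) by simp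
qed


section \<open>Closure properties of the Wiener integral relation\<close>

lemma integrable_min_square:
  fixes X :: "'w \<Rightarrow> real"
  assumes [measurable]: "X \<in> borel_measurable M"
  shows "integrable M (\<lambda>\<omega>. min 1 ((X \<omega>)\<^sup>2))"
  by (rule integrable_const_bound[where B=1]) auto

text \<open>The truncated square obeys the triangle inequality up to the factor 2, like the squared
  \<open>L\<^sup>2\<close> norm; errors are therefore split into quarters below.\<close>

lemma expectation_min_square_add_le:
  fixes X Y :: "'w \<Rightarrow> real"
  assumes [measurable]: "X \<in> borel_measurable M" "Y \<in> borel_measurable M"
  shows "expectation (\<lambda>\<omega>. min 1 ((X \<omega> + Y \<omega>)\<^sup>2)) \<le>
    2 * expectation (\<lambda>\<omega>. min 1 ((X \<omega>)\<^sup>2)) + 2 * expectation (\<lambda>\<omega>. min 1 ((Y \<omega>)\<^sup>2))"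
proof -
  have "min 1 ((x + y)\<^sup>2) \<le> 2 * min 1 (x\<^sup>2) + 2 * min 1 (y\<^sup>2)" for x y :: real
  proof -
    have "(x + y)\<^sup>2 \<le> 2 * x\<^sup>2 + 2 * y\<^sup>2" using inner_add_self_le[of x y] by (simp add: power2_eq_square)
    moreover have "0 \<le> x\<^sup>2" "0 \<le> y\<^sup>2" by simp_all
    ultimately show ?thesis unfolding min_def by (simp split: if_splits; linarith)
  qed
  then have "expectation (\<lambda>\<omega>. min 1 ((X \<omega> + Y \<omega>)\<^sup>2)) \<le>
     expectation (\<lambda>\<omega>. 2 * min 1 ((X \<omega>)\<^sup>2) + 2 * min 1 ((Y \<omega>)\<^sup>2))"
    by (intro integral_mono integrable_min_square Bochner_Integration.integrable_add integrable_mult_right) simp_all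
  then show ?thesis by (simp add: integrable_min_square)
qed

lemma wiener_integral_step:
  assumes "step_pair B \<phi> S"
  shows "wiener_integral M B \<phi> S"
  unfolding wiener_integral_def
  by (intro conjI allI impI step_pair_L2_fun[OF assms] step_measurable[OF assms] exI[of _ \<phi>] exI[of _ S] assms) simp_all

lemma wiener_integral_L2: "wiener_integral M B f X \<Longrightarrow> L2_fun f"
  by (simp add: wiener_integral_def)

lemma wiener_integral_measurable[measurable_dest]: "wiener_integral M B f X \<Longrightarrow> X \<in> borel_measurable M"
  by (simp add: wiener_integral_def)

text \<open>Approximants may themselves be Wiener integrals, since each can in turn be replaced by a
  step function. Almost sure limits and Ito integrals enter the relation through this
  closedness.\<close>

lemma wiener_integral_approx:
  assumes f: "L2_fun f" and X[measurable]: "X \<in> borel_measurable M"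
    and approx: "\<And>\<epsilon>. 0 < \<epsilon> \<Longrightarrow> \<exists>g Y. wiener_integral M B g Y \<and> (\<integral>u. (g u - f u) \<bullet> (g u - f u) \<partial>lborel) < \<epsilon> \<and>
        (\<integral>\<omega>. min 1 ((Y \<omega> - X \<omega>)\<^sup>2) \<partial>M) < \<epsilon>"
  shows "wiener_integral M B f X"
  unfolding wiener_integral_def
proof (intro conjI allI impI f X)
  fix \<epsilon> :: real assume "0 < \<epsilon>"
  then have e: "0 < \<epsilon> / 4" by simp
  obtain g Y where g: "wiener_integral M B g Y" "(\<integral>u. (g u - f u) \<bullet> (g u - f u) \<partial>lborel) < \<epsilon> / 4"
        "(\<integral>\<omega>. min 1 ((Y \<omega> - X \<omega>)\<^sup>2) \<partial>M) < \<epsilon> / 4"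
    using approx[OF e] by blast
  obtain \<phi> S where p: "step_pair B \<phi> S" "(\<integral>u. (\<phi> u - g u) \<bullet> (\<phi> u - g u) \<partial>lborel) < \<epsilon> / 4"
        "(\<integral>\<omega>. min 1 ((S \<omega> - Y \<omega>)\<^sup>2) \<partial>M) < \<epsilon> / 4"
    using g(1) e unfolding wiener_integral_def by blast
  note [measurable] = wiener_integral_measurable[OF g(1)] step_measurable[OF p(1)]
  have "(\<integral>u. (\<phi> u - f u) \<bullet> (\<phi> u - f u) \<partial>lborel) \<le>
      2 * (\<integral>u. (\<phi> u - g u) \<bullet> (\<phi> u - g u) \<partial>lborel) + 2 * (\<integral>u. (g u - f u) \<bullet> (g u - f u) \<partial>lborel)"
    using integral_inner_add_le[OF L2_fun_diff[OF step_pair_L2_fun[OF p(1)] wiener_integral_L2[OF g(1)]]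
        L2_fun_diff[OF wiener_integral_L2[OF g(1)] f]] by simp
  also have "\<dots> < \<epsilon>" using g(2) p(2) by linarith
  finally have 1: "(\<integral>u. (\<phi> u - f u) \<bullet> (\<phi> u - f u) \<partial>lborel) < \<epsilon>" .
  have "expectation (\<lambda>\<omega>. min 1 ((S \<omega> - X \<omega>)\<^sup>2)) \<le>
      2 * expectation (\<lambda>\<omega>. min 1 ((S \<omega> - Y \<omega>)\<^sup>2)) + 2 * expectation (\<lambda>\<omega>. min 1 ((Y \<omega> - X \<omega>)\<^sup>2))"
    using expectation_min_square_add_le[of "\<lambda>\<omega>. S \<omega> - Y \<omega>" "\<lambda>\<omega>. Y \<omega> - X \<omega>"] by simp
  also have "\<dots> < \<epsilon>" using g(3) p(3) by linarith
  finally show "\<exists>\<phi> S. step_pair B \<phi> S \<and> (\<integral>u. (\<phi> u - f u) \<bullet> (\<phi> u - f u) \<partial>lborel) < \<epsilon> \<and>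
        (\<integral>\<omega>. min 1 ((S \<omega> - X \<omega>)\<^sup>2) \<partial>M) < \<epsilon>"
    using p(1) 1 by blast
qed

lemma wiener_integral_cong_AE:
  assumes X: "wiener_integral M B f X" and [measurable]: "Y \<in> borel_measurable M" and eq: "AE \<omega> in M. X \<omega> = Y \<omega>"
  shows "wiener_integral M B f Y"
proof (rule wiener_integral_approx[OF wiener_integral_L2[OF X]])
  fix \<epsilon> :: real assume "0 < \<epsilon>"
  note [measurable] = wiener_integral_measurable[OF X]
  have "expectation (\<lambda>\<omega>. min 1 ((X \<omega> - Y \<omega>)\<^sup>2)) = expectation (\<lambda>\<omega>. 0)"
    by (rule integral_cong_AE) (use eq in auto)
  then show "\<exists>g Y'. wiener_integral M B g Y' \<and> (\<integral>u. (g u - f u) \<bullet> (g u - f u) \<partial>lborel) < \<epsilon> \<and>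
        (\<integral>\<omega>. min 1 ((Y' \<omega> - Y \<omega>)\<^sup>2) \<partial>M) < \<epsilon>"
    using X \<open>0 < \<epsilon>\<close> by (intro exI[of _ f] exI[of _ X]) simp
qed fact

lemma wiener_integral_add:
  assumes f: "wiener_integral M B f X" and g: "wiener_integral M B g Y"
  shows "wiener_integral M B (\<lambda>u. f u + g u) (\<lambda>\<omega>. X \<omega> + Y \<omega>)"
  unfolding wiener_integral_def
proof (intro conjI allI impI)
  note [measurable] = wiener_integral_measurable[OF f] wiener_integral_measurable[OF g]
  show "(\<lambda>\<omega>. X \<omega> + Y \<omega>) \<in> borel_measurable M" by measurable
  show "L2_fun (\<lambda>u. f u + g u)" by (intro L2_fun_add wiener_integral_L2[OF f] wiener_integral_L2[OF g])
  fix \<epsilon> :: real assume "0 < \<epsilon>"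
  then have e: "0 < \<epsilon> / 4" by simp
  obtain \<phi> S where p: "step_pair B \<phi> S" "(\<integral>u. (\<phi> u - f u) \<bullet> (\<phi> u - f u) \<partial>lborel) < \<epsilon> / 4"
        "(\<integral>\<omega>. min 1 ((S \<omega> - X \<omega>)\<^sup>2) \<partial>M) < \<epsilon> / 4"
    using f e unfolding wiener_integral_def by blast
  obtain \<psi> R where q: "step_pair B \<psi> R" "(\<integral>u. (\<psi> u - g u) \<bullet> (\<psi> u - g u) \<partial>lborel) < \<epsilon> / 4"
        "(\<integral>\<omega>. min 1 ((R \<omega> - Y \<omega>)\<^sup>2) \<partial>M) < \<epsilon> / 4"
    using g e unfolding wiener_integral_def by blast
  note [measurable] = step_measurable[OF p(1)] step_measurable[OF q(1)]
  have "(\<integral>u. (\<phi> u + \<psi> u - (f u + g u)) \<bullet> (\<phi> u + \<psi> u - (f u + g u)) \<partial>lborel) \<le>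
      2 * (\<integral>u. (\<phi> u - f u) \<bullet> (\<phi> u - f u) \<partial>lborel) + 2 * (\<integral>u. (\<psi> u - g u) \<bullet> (\<psi> u - g u) \<partial>lborel)"
    using integral_inner_add_le[OF L2_fun_diff[OF step_pair_L2_fun[OF p(1)] wiener_integral_L2[OF f]]
        L2_fun_diff[OF step_pair_L2_fun[OF q(1)] wiener_integral_L2[OF g]]]
    by (simp add: algebra_simps)
  also have "\<dots> < \<epsilon>" using p(2) q(2) by linarith
  finally have 1: "(\<integral>u. (\<phi> u + \<psi> u - (f u + g u)) \<bullet> (\<phi> u + \<psi> u - (f u + g u)) \<partial>lborel) < \<epsilon>" .
  have "expectation (\<lambda>\<omega>. min 1 ((S \<omega> + R \<omega> - (X \<omega> + Y \<omega>))\<^sup>2)) \<le>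
      2 * expectation (\<lambda>\<omega>. min 1 ((S \<omega> - X \<omega>)\<^sup>2)) + 2 * expectation (\<lambda>\<omega>. min 1 ((R \<omega> - Y \<omega>)\<^sup>2))"
    using expectation_min_square_add_le[of "\<lambda>\<omega>. S \<omega> - X \<omega>" "\<lambda>\<omega>. R \<omega> - Y \<omega>"] by (simp add: algebra_simps)
  also have "\<dots> < \<epsilon>" using p(3) q(3) by linarith
  finally have 2: "expectation (\<lambda>\<omega>. min 1 ((S \<omega> + R \<omega> - (X \<omega> + Y \<omega>))\<^sup>2)) < \<epsilon>" .
  show "\<exists>\<phi> S. step_pair B \<phi> S \<and> (\<integral>u. (\<phi> u - (f u + g u)) \<bullet> (\<phi> u - (f u + g u)) \<partial>lborel) < \<epsilon> \<and>
        (\<integral>\<omega>. min 1 ((S \<omega> - (X \<omega> + Y \<omega>))\<^sup>2) \<partial>M) < \<epsilon>"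
    by (intro exI[of _ "\<lambda>u. \<phi> u + \<psi> u"] exI[of _ "\<lambda>\<omega>. S \<omega> + R \<omega>"] conjI step_pair_add[OF p(1) q(1)] 1 2)
qed

lemma wiener_integral_scale:
  assumes f: "wiener_integral M B f X"
  shows "wiener_integral M B (\<lambda>u. c *\<^sub>R f u) (\<lambda>\<omega>. c * X \<omega>)"
  unfolding wiener_integral_def
proof (intro conjI allI impI)
  note [measurable] = wiener_integral_measurable[OF f]
  show "(\<lambda>\<omega>. c * X \<omega>) \<in> borel_measurable M" by measurable
  show "L2_fun (\<lambda>u. c *\<^sub>R f u)" by (intro L2_fun_scaleR wiener_integral_L2[OF f])
  \<comment> \<open>The factor is \<open>1 + c\<^sup>2\<close> and not \<open>c\<^sup>2\<close>: it
    is nonzero for \<open>c = 0\<close>, and being at least 1 it can be pulled out of the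
    truncation.\<close>
  have k: "0 < 1 + c\<^sup>2" by (simp add: add_pos_nonneg)
  fix \<epsilon> :: real assume \<epsilon>: "0 < \<epsilon>"
  then have e: "0 < \<epsilon> / (1 + c\<^sup>2)" using k by simp
  obtain \<phi> S where p: "step_pair B \<phi> S" "(\<integral>u. (\<phi> u - f u) \<bullet> (\<phi> u - f u) \<partial>lborel) < \<epsilon> / (1 + c\<^sup>2)"
        "(\<integral>\<omega>. min 1 ((S \<omega> - X \<omega>)\<^sup>2) \<partial>M) < \<epsilon> / (1 + c\<^sup>2)"
    using f e unfolding wiener_integral_def by blast
  note [measurable] = step_measurable[OF p(1)]
  have "(\<integral>u. (c *\<^sub>R \<phi> u - c *\<^sub>R f u) \<bullet> (c *\<^sub>R \<phi> u - c *\<^sub>R f u) \<partial>lborel) = (\<integral>u. c\<^sup>2 * ((\<phi> u - f u) \<bullet> (\<phi> u - f u)) \<partial>lborel)"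
    by (rule Bochner_Integration.integral_cong) (simp_all add: scaleR_diff_right[symmetric] power2_eq_square mult.assoc)
  also have "\<dots> = c\<^sup>2 * (\<integral>u. (\<phi> u - f u) \<bullet> (\<phi> u - f u) \<partial>lborel)" by simp
  also have "\<dots> \<le> (1 + c\<^sup>2) * (\<integral>u. (\<phi> u - f u) \<bullet> (\<phi> u - f u) \<partial>lborel)"
    by (rule mult_right_mono) simp_all
  also have "\<dots> < \<epsilon>" using p(2) k by (simp add: pos_less_divide_eq mult.commute)
  finally have 1: "(\<integral>u. (c *\<^sub>R \<phi> u - c *\<^sub>R f u) \<bullet> (c *\<^sub>R \<phi> u - c *\<^sub>R f u) \<partial>lborel) < \<epsilon>" .
  have "min 1 ((c * x - c * y)\<^sup>2) \<le> (1 + c\<^sup>2) * min 1 ((x - y)\<^sup>2)" for x y :: real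
  proof -
    have "(c * x - c * y)\<^sup>2 = c\<^sup>2 * (x - y)\<^sup>2" by (simp add: right_diff_distrib[symmetric] power_mult_distrib)
    moreover have "c\<^sup>2 * (x - y)\<^sup>2 \<le> (1 + c\<^sup>2) * (x - y)\<^sup>2" by (rule mult_right_mono) simp_all
    ultimately have "(c * x - c * y)\<^sup>2 \<le> (1 + c\<^sup>2) * (x - y)\<^sup>2" by simp
    then have "min 1 ((c * x - c * y)\<^sup>2) \<le> min (1 + c\<^sup>2) ((1 + c\<^sup>2) * (x - y)\<^sup>2)"
      by (rule min.mono[rotated]) simp
    then show ?thesis using k by (simp add: min_mult_distrib_left)
  qed
  then have "expectation (\<lambda>\<omega>. min 1 ((c * S \<omega> - c * X \<omega>)\<^sup>2)) \<le> expectation (\<lambda>\<omega>. (1 + c\<^sup>2) * min 1 ((S \<omega> - X \<omega>)\<^sup>2))"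
    by (intro integral_mono integrable_min_square integrable_mult_right) simp_all
  also have "\<dots> = (1 + c\<^sup>2) * expectation (\<lambda>\<omega>. min 1 ((S \<omega> - X \<omega>)\<^sup>2))" by simp
  also have "\<dots> < \<epsilon>" using p(3) k by (simp add: pos_less_divide_eq mult.commute)
  finally have 2: "expectation (\<lambda>\<omega>. min 1 ((c * S \<omega> - c * X \<omega>)\<^sup>2)) < \<epsilon>" .
  show "\<exists>\<phi> S. step_pair B \<phi> S \<and> (\<integral>u. (\<phi> u - c *\<^sub>R f u) \<bullet> (\<phi> u - c *\<^sub>R f u) \<partial>lborel) < \<epsilon> \<and>
        (\<integral>\<omega>. min 1 ((S \<omega> - c * X \<omega>)\<^sup>2) \<partial>M) < \<epsilon>"
    by (intro exI[of _ "\<lambda>u. c *\<^sub>R \<phi> u"] exI[of _ "\<lambda>\<omega>. c * S \<omega>"] conjI step_pair_scale[OF p(1)] 1 2)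
qed

lemma wiener_integral_zero: "wiener_integral M B (\<lambda>u. 0) (\<lambda>\<omega>. 0)"
  by (rule wiener_integral_step) (auto simp: step_pair_def intro: exI[of _ "{}"])

lemma wiener_integral_sum:
  assumes "\<And>i. i \<in> I \<Longrightarrow> wiener_integral M B (f i) (X i)"
  shows "wiener_integral M B (\<lambda>u. \<Sum>i\<in>I. f i u) (\<lambda>\<omega>. \<Sum>i\<in>I. X i \<omega>)"
  using assms
  by (induction I rule: infinite_finite_induct) (simp_all add: wiener_integral_zero wiener_integral_add)

lemma wiener_integral_diff:
  assumes "wiener_integral M B f X" "wiener_integral M B g Y"
  shows "wiener_integral M B (\<lambda>u. f u - g u) (\<lambda>\<omega>. X \<omega> - Y \<omega>)"
  using wiener_integral_add[OF assms(1) wiener_integral_scale[OF assms(2), of "-1"]] by simp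

lemma wiener_integral_increment:
  assumes "0 \<le> s" "s \<le> t"
  shows "wiener_integral M B (\<lambda>u. indicator {s<..t} u *\<^sub>R v) (\<lambda>\<omega>. v \<bullet> (B t \<omega> - B s \<omega>))"
proof -
  have "wiener_integral M B (\<lambda>u. indicator {0<..t} u *\<^sub>R v - indicator {0<..s} u *\<^sub>R v) (\<lambda>\<omega>. v \<bullet> B t \<omega> - v \<bullet> B s \<omega>)"
    using assms by (intro wiener_integral_diff wiener_integral_step step_pair_term) simp_all
  moreover have "indicator {0<..t} u *\<^sub>R v - indicator {0<..s} u *\<^sub>R v = indicator {s<..t} u *\<^sub>R v" for u
    using assms by (auto simp: indicator_def)
  ultimately show ?thesis by (simp add: inner_diff_right)
qed

text \<open>Along step approximants both the characteristic functions and the squared norms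
  converge, so the formula for step functions passes to the limit. On the random side only
  convergence in probability is available, which suffices because \<open>iexp\<close> is bounded and
  Lipschitz.\<close>

lemma wiener_integral_char:
  assumes X: "wiener_integral M B f X"
  shows "(\<integral>\<omega>. iexp (X \<omega>) \<partial>M) = exp (- complex_of_real (\<integral>u. f u \<bullet> f u \<partial>lborel) / 2)"
proof -
  note Xm[measurable] = wiener_integral_measurable[OF X] and Lf = wiener_integral_L2[OF X]
  define c where "c = (\<integral>u. f u \<bullet> f u \<partial>lborel)"
  define a where "a n = inverse (real (Suc n))" for n
  have a: "0 < a n" for n by (simp add: a_def)
  have a0: "a \<longlonglongrightarrow> 0" unfolding a_def by (rule LIMSEQ_inverse_real_of_nat)
  \<comment> \<open>The tolerance is \<open>a n * a n\<close> because the estimates below divide it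
    by \<open>a n\<close> and leave \<open>a n\<close>, which tends to 0.\<close>
  define P where "P n \<phi> S \<longleftrightarrow> step_pair B \<phi> S \<and> (\<integral>u. (\<phi> u - f u) \<bullet> (\<phi> u - f u) \<partial>lborel) < a n * a n \<and>
        (\<integral>\<omega>. min 1 ((S \<omega> - X \<omega>)\<^sup>2) \<partial>M) < a n * a n" for n \<phi> S
  have "\<forall>n. \<exists>\<phi> S. P n \<phi> S"
    using X a unfolding wiener_integral_def P_def by simp
  then obtain \<phi> S where P: "\<And>n. P n (\<phi> n) (S n)" by metis
  have p: "step_pair B (\<phi> n) (S n)" "(\<integral>u. (\<phi> n u - f u) \<bullet> (\<phi> n u - f u) \<partial>lborel) < a n * a n"
        "(\<integral>\<omega>. min 1 ((S n \<omega> - X \<omega>)\<^sup>2) \<partial>M) < a n * a n" for n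
    using P[of n] unfolding P_def by blast+
  note Sm[measurable] = step_measurable[OF p(1)]
  have L\<phi>: "L2_fun (\<phi> n)" for n by (rule step_pair_L2_fun[OF p(1)])
  have 1: "norm ((\<integral>\<omega>. iexp (S n \<omega>) \<partial>M) - (\<integral>\<omega>. iexp (X \<omega>) \<partial>M)) \<le> 2 * a n" for n
  proof -
    \<comment> \<open>The difference is at most \<open>2 * z\<close> with
      \<open>z = min 1 \<bar>x - y\<bar>\<close>, and
      \<open>2 * z \<le> a n + z\<^sup>2 / a n\<close> trades the truncated distance for the
      truncated square.\<close>
    have pt: "norm (iexp x - iexp y) \<le> a n + min 1 ((x - y)\<^sup>2) / a n" for x y :: real
    proof -
      define z where "z = min 1 \<bar>x - y\<bar>"
      have z: "0 \<le> z" by (simp add: z_def)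
      have "iexp x - iexp y = iexp y * (iexp (x - y) - 1)" by (simp add: exp_diff ring_distribs)
      then have n: "norm (iexp x - iexp y) = norm (iexp (x - y) - 1)" by (simp add: norm_mult)
      have b1: "norm (iexp (x - y) - 1) \<le> \<bar>x - y\<bar>" using iexp_approx1[of "x - y" 0] by simp
      have b2: "norm (iexp (x - y) - 1) \<le> 2" using iexp_approx2[of "x - y" 0] by simp
      have "norm (iexp (x - y) - 1) \<le> 2 * \<bar>x - y\<bar>" by (rule order_trans[OF b1]) simp
      with b2 have "norm (iexp x - iexp y) \<le> min 2 (2 * \<bar>x - y\<bar>)"
        unfolding n by (rule min.boundedI)
      also have "\<dots> = 2 * z" by (simp add: z_def min_def)
      also have "2 * z \<le> a n + z\<^sup>2 / a n"
      proof -
        have "0 \<le> (a n - z)\<^sup>2 / a n" using a[of n] by simp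
        also have "(a n - z)\<^sup>2 / a n = a n + z\<^sup>2 / a n - 2 * z"
          using a[of n] by (simp add: power2_eq_square field_simps)
        finally show ?thesis by simp
      qed
      also have "z\<^sup>2 = min 1 ((x - y)\<^sup>2)"
        using abs_square_less_1[of "x - y"] by (cases "\<bar>x - y\<bar> < 1") (auto simp: z_def min_def)
      finally show ?thesis .
    qed
    have i1: "integrable M (\<lambda>\<omega>. iexp (S n \<omega>))" "integrable M (\<lambda>\<omega>. iexp (X \<omega>))"
      by (intro integrable_iexp; simp)+
    have im: "integrable M (\<lambda>\<omega>. min 1 ((S n \<omega> - X \<omega>)\<^sup>2))" by (rule integrable_min_square) measurable
    have "norm ((\<integral>\<omega>. iexp (S n \<omega>) \<partial>M) - (\<integral>\<omega>. iexp (X \<omega>) \<partial>M)) = norm (\<integral>\<omega>. iexp (S n \<omega>) - iexp (X \<omega>) \<partial>M)"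
      using i1 by simp
    also have "\<dots> \<le> (\<integral>\<omega>. a n + min 1 ((S n \<omega> - X \<omega>)\<^sup>2) / a n \<partial>M)"
      by (rule order_trans[OF integral_norm_bound integral_mono]) (use i1 im pt in auto)
    also have "\<dots> = a n + (\<integral>\<omega>. min 1 ((S n \<omega> - X \<omega>)\<^sup>2) \<partial>M) / a n"
      using im by (simp add: prob_space)
    also have "\<dots> \<le> a n + (a n * a n) / a n"
      using p(3)[of n] a[of n] by (intro add_left_mono divide_right_mono) simp_all
    finally show ?thesis using a[of n] by simp
  qed
  \<comment> \<open>The cross term \<open>2 * (g u \<bullet> f u)\<close> is controlled by the same
    weighted inequality, which charges the small error with \<open>1 / a n\<close> and the fixed
    \<open>f\<close> with \<open>a n\<close>.\<close>
  have 2: "\<bar>(\<integral>u. \<phi> n u \<bullet> \<phi> n u \<partial>lborel) - c\<bar> \<le> a n * a n + (a n + a n * c)" for n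
  proof -
    define g where "g u = \<phi> n u - f u" for u
    have Lg: "L2_fun g" unfolding g_def by (rule L2_fun_diff[OF L\<phi> Lf])
    note i = L2_fun_inner[OF Lg Lg] L2_fun_inner[OF Lg Lf] L2_fun_inner[OF Lf Lf]
    have gg: "(\<integral>u. g u \<bullet> g u \<partial>lborel) \<le> a n * a n" "0 \<le> (\<integral>u. g u \<bullet> g u \<partial>lborel)"
      using p(2)[of n] by (simp_all add: g_def)
    have "\<phi> n u \<bullet> \<phi> n u = f u \<bullet> f u + (g u \<bullet> g u + 2 * (g u \<bullet> f u))" for u
      by (simp add: g_def inner_diff_left inner_diff_right inner_commute)
    then have "(\<integral>u. \<phi> n u \<bullet> \<phi> n u \<partial>lborel) - c = (\<integral>u. g u \<bullet> g u \<partial>lborel) + 2 * (\<integral>u. g u \<bullet> f u \<partial>lborel)"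
      using i by (simp add: c_def)
    moreover have "\<bar>2 * (\<integral>u. g u \<bullet> f u \<partial>lborel)\<bar> \<le> a n + a n * c"
    proof -
      have pt: "\<bar>2 * (g u \<bullet> f u)\<bar> \<le> (g u \<bullet> g u) / a n + a n * (f u \<bullet> f u)" for u
      proof -
        have "0 \<le> (g u + a n *\<^sub>R f u) \<bullet> (g u + a n *\<^sub>R f u)" "0 \<le> (g u - a n *\<^sub>R f u) \<bullet> (g u - a n *\<^sub>R f u)"
          by simp_all
        then have "a n * \<bar>2 * (g u \<bullet> f u)\<bar> \<le> g u \<bullet> g u + a n * (a n * (f u \<bullet> f u))"
          using a[of n] by (auto simp: abs_if inner_add_left inner_add_right inner_diff_left inner_diff_right inner_commute)
        also have "\<dots> = a n * ((g u \<bullet> g u) / a n + a n * (f u \<bullet> f u))"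
          using a[of n] by (simp add: field_simps)
        finally show ?thesis using a[of n] by (simp only: mult_le_cancel_left_pos)
      qed
      have "norm (\<integral>u. 2 * (g u \<bullet> f u) \<partial>lborel) \<le> (\<integral>u. (g u \<bullet> g u) / a n + a n * (f u \<bullet> f u) \<partial>lborel)"
        by (rule order_trans[OF integral_norm_bound integral_mono]) (use i pt in auto)
      also have "\<dots> = (\<integral>u. g u \<bullet> g u \<partial>lborel) / a n + a n * c" using i by (simp add: c_def)
      also have "\<dots> \<le> (a n * a n) / a n + a n * c"
        using gg a[of n] by (intro add_right_mono divide_right_mono) simp_all
      finally show ?thesis using a[of n] i by simp
    qed
    ultimately show ?thesis using gg by linarith
  qed
  have "(\<lambda>n. (\<integral>\<omega>. iexp (S n \<omega>) \<partial>M) - (\<integral>\<omega>. iexp (X \<omega>) \<partial>M)) \<longlonglongrightarrow> 0"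
    by (rule Lim_null_comparison[OF always_eventually[OF allI[OF 1]]]) (use tendsto_mult_right_zero[OF a0] in simp)
  then have l1: "(\<lambda>n. \<integral>\<omega>. iexp (S n \<omega>) \<partial>M) \<longlonglongrightarrow> (\<integral>\<omega>. iexp (X \<omega>) \<partial>M)"
    by (rule LIM_zero_cancel)
  have "(\<lambda>n. (\<integral>u. \<phi> n u \<bullet> \<phi> n u \<partial>lborel) - c) \<longlonglongrightarrow> 0"
  proof (rule Lim_null_comparison[OF always_eventually])
    show "\<forall>n. norm ((\<integral>u. \<phi> n u \<bullet> \<phi> n u \<partial>lborel) - c) \<le> a n * a n + (a n + a n * c)" using 2 by simp
    have "(\<lambda>n. a n * a n + (a n + a n * c)) \<longlonglongrightarrow> 0 * 0 + (0 + 0 * c)" by (intro tendsto_intros a0)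
    then show "(\<lambda>n. a n * a n + (a n + a n * c)) \<longlonglongrightarrow> 0" by simp
  qed
  then have "(\<lambda>n. \<integral>u. \<phi> n u \<bullet> \<phi> n u \<partial>lborel) \<longlonglongrightarrow> c" by (rule LIM_zero_cancel)
  then have "(\<lambda>n. exp (- complex_of_real (\<integral>u. \<phi> n u \<bullet> \<phi> n u \<partial>lborel) / 2)) \<longlonglongrightarrow> exp (- complex_of_real c / 2)"
    by (intro tendsto_intros) simp_all
  then have "(\<lambda>n. \<integral>\<omega>. iexp (S n \<omega>) \<partial>M) \<longlonglongrightarrow> exp (- complex_of_real c / 2)"
    by (simp only: step_char[OF p(1)])
  with l1 show ?thesis unfolding c_def by (rule LIMSEQ_unique)
qed


section \<open>Isometry and Gauss vectors of Wiener integrals\<close>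

lemma wiener_integral_moments:
  assumes X: "wiener_integral M B f X"
  shows "integrable M X" "expectation X = 0" "integrable M (\<lambda>\<omega>. (X \<omega>)\<^sup>2)"
    "expectation (\<lambda>\<omega>. (X \<omega>)\<^sup>2) = (\<integral>u. f u \<bullet> f u \<partial>lborel)"
proof -
  \<comment> \<open>Scaling the pair by \<open>\<theta>\<close> turns the value at one frequency
    into the whole characteristic function.\<close>
  have ch: "(\<integral>\<omega>. iexp (\<theta> * X \<omega>) \<partial>M) =
      exp (\<i> * complex_of_real (\<theta> * 0) - complex_of_real (\<theta>\<^sup>2 * (\<integral>u. f u \<bullet> f u \<partial>lborel)) / 2)" for \<theta>
    using wiener_integral_char[OF wiener_integral_scale[OF X, of \<theta>]]
    by (simp add: power2_eq_square mult.assoc)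
  note mom = gauss_char_moments[OF wiener_integral_measurable[OF X] ch]
  show "integrable M X" by (rule mom(2))
  show "expectation X = 0" by (rule mom(3))
  show "integrable M (\<lambda>\<omega>. (X \<omega>)\<^sup>2)" by (rule mom(4))
  show "expectation (\<lambda>\<omega>. (X \<omega>)\<^sup>2) = (\<integral>u. f u \<bullet> f u \<partial>lborel)" using mom(5) by simp
qed

text \<open>Polarisation: the isometry for \<open>X + Y\<close> is compared with those for
  \<open>X\<close> and \<open>Y\<close>.\<close>

lemma wiener_integral_covariance:
  assumes X: "wiener_integral M B f X" and Y: "wiener_integral M B g Y"
  shows "expectation (\<lambda>\<omega>. X \<omega> * Y \<omega>) = (\<integral>u. f u \<bullet> g u \<partial>lborel)"
proof -
  note i = L2_fun_inner[OF wiener_integral_L2[OF X] wiener_integral_L2[OF X]]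
    L2_fun_inner[OF wiener_integral_L2[OF X] wiener_integral_L2[OF Y]]
    L2_fun_inner[OF wiener_integral_L2[OF Y] wiener_integral_L2[OF Y]]
  note m = wiener_integral_moments[OF X] wiener_integral_moments[OF Y]
  have iXY: "integrable M (\<lambda>\<omega>. X \<omega> * Y \<omega>)"
    by (rule integrable_mult_of_squares[OF wiener_integral_measurable[OF X] wiener_integral_measurable[OF Y] m(3) m(7)])
  have "(\<integral>\<omega>. (X \<omega>)\<^sup>2 + ((Y \<omega>)\<^sup>2 + 2 * (X \<omega> * Y \<omega>)) \<partial>M) = (\<integral>\<omega>. (X \<omega> + Y \<omega>)\<^sup>2 \<partial>M)"
    by (rule Bochner_Integration.integral_cong) (simp_all add: power2_sum mult_ac)
  also have "\<dots> = (\<integral>u. (f u + g u) \<bullet> (f u + g u) \<partial>lborel)"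
    by (rule wiener_integral_moments(4)[OF wiener_integral_add[OF X Y]])
  also have "\<dots> = (\<integral>u. f u \<bullet> f u + (g u \<bullet> g u + 2 * (f u \<bullet> g u)) \<partial>lborel)"
    by (rule Bochner_Integration.integral_cong) (simp_all add: inner_add_left inner_add_right inner_commute)
  finally show ?thesis using i iXY m by simp
qed

text \<open>The truncated squares are dominated by 1, so almost sure convergence yields the
  approximation without any moment bound on the limit.\<close>

lemma wiener_integral_AE_limit:
  assumes X: "\<And>n. wiener_integral M B (f n) (X n)" and g: "L2_fun g" and Y[measurable]: "Y \<in> borel_measurable M"
    and f: "(\<lambda>n. \<integral>u. (f n u - g u) \<bullet> (f n u - g u) \<partial>lborel) \<longlonglongrightarrow> 0"
    and lim: "AE \<omega> in M. (\<lambda>n. X n \<omega>) \<longlonglongrightarrow> Y \<omega>"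
  shows "wiener_integral M B g Y"
proof (rule wiener_integral_approx[OF g Y])
  fix \<epsilon> :: real assume e: "0 < \<epsilon>"
  note [measurable] = wiener_integral_measurable[OF X]
  have "(\<lambda>n. expectation (\<lambda>\<omega>. min 1 ((X n \<omega> - Y \<omega>)\<^sup>2))) \<longlonglongrightarrow> expectation (\<lambda>\<omega>. 0)"
  proof (rule integral_dominated_convergence[where w="\<lambda>_. 1"])
    show "AE \<omega> in M. (\<lambda>n. min 1 ((X n \<omega> - Y \<omega>)\<^sup>2)) \<longlonglongrightarrow> 0"
      using lim
    proof eventually_elim
      case (elim \<omega>)
      then have "(\<lambda>n. min 1 ((X n \<omega> - Y \<omega>)\<^sup>2)) \<longlonglongrightarrow> min 1 ((Y \<omega> - Y \<omega>)\<^sup>2)"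
        by (intro tendsto_intros)
      then show ?case by simp
    qed
  qed auto
  then have "\<forall>\<^sub>F n in sequentially. expectation (\<lambda>\<omega>. min 1 ((X n \<omega> - Y \<omega>)\<^sup>2)) < \<epsilon>"
    using e by (intro order_tendstoD(2)[where y=0]) simp_all
  moreover have "\<forall>\<^sub>F n in sequentially. (\<integral>u. (f n u - g u) \<bullet> (f n u - g u) \<partial>lborel) < \<epsilon>"
    using order_tendstoD(2)[OF f e] .
  ultimately have "\<forall>\<^sub>F n in sequentially. expectation (\<lambda>\<omega>. min 1 ((X n \<omega> - Y \<omega>)\<^sup>2)) < \<epsilon> \<and> (\<integral>u. (f n u - g u) \<bullet> (f n u - g u) \<partial>lborel) < \<epsilon>"
    by eventually_elim simp
  then obtain n where "expectation (\<lambda>\<omega>. min 1 ((X n \<omega> - Y \<omega>)\<^sup>2)) < \<epsilon>" "(\<integral>u. (f n u - g u) \<bullet> (f n u - g u) \<partial>lborel) < \<epsilon>"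
    by (auto simp: eventually_sequentially)
  then show "\<exists>f' X'. wiener_integral M B f' X' \<and> (\<integral>u. (f' u - g u) \<bullet> (f' u - g u) \<partial>lborel) < \<epsilon> \<and>
        (\<integral>\<omega>. min 1 ((X' \<omega> - Y \<omega>)\<^sup>2) \<partial>M) < \<epsilon>"
    by (intro exI[of _ "f n"] exI[of _ "X n"] conjI X)
qed

lemma wiener_integral_vec_measurable:
  assumes "\<And>i. wiener_integral M B (f i) (\<lambda>\<omega>. X \<omega> $ i - m $ i)"
  shows "X \<in> borel_measurable M"
proof (rule borel_measurable_vecI)
  fix i
  note [measurable] = wiener_integral_measurable[OF assms[of i]]
  have "(\<lambda>\<omega>. (X \<omega> $ i - m $ i) + m $ i) \<in> borel_measurable M" by (rule borel_measurable_add) measurable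
  then show "(\<lambda>\<omega>. X \<omega> $ i) \<in> borel_measurable M" by simp
qed

lemma wiener_integral_mean_vec:
  assumes "\<And>i. wiener_integral M B (f i) (\<lambda>\<omega>. X \<omega> $ i - m $ i)"
  shows "mean_vec M X = m"
proof -
  have "expectation (\<lambda>\<omega>. X \<omega> $ i) = m $ i" for i
  proof -
    have "expectation (\<lambda>\<omega>. X \<omega> $ i) = expectation (\<lambda>\<omega>. (X \<omega> $ i - m $ i) + m $ i)" by simp
    also have "\<dots> = m $ i"
      using wiener_integral_moments(1,2)[OF assms[of i]]
      by (subst Bochner_Integration.integral_add) (simp_all add: prob_space)
    finally show ?thesis .
  qed
  then show ?thesis by (simp add: mean_vec_def vec_eq_iff)
qed

lemma wiener_integral_cov_mat:
  assumes X: "\<And>i. wiener_integral M B (f i) (\<lambda>\<omega>. X \<omega> $ i - m $ i)"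
    and Y: "\<And>j. wiener_integral M B (g j) (\<lambda>\<omega>. Y \<omega> $ j - k $ j)"
  shows "cov_mat M X Y = (\<chi> i j. \<integral>u. f i u \<bullet> g j u \<partial>lborel)"
  unfolding cov_mat_def wiener_integral_mean_vec[OF X] wiener_integral_mean_vec[OF Y]
    wiener_integral_covariance[OF X Y] ..

lemma wiener_integral_inner:
  assumes X: "\<And>i. wiener_integral M B (f i) (\<lambda>\<omega>. X \<omega> $ i - m $ i)"
  shows "wiener_integral M B (\<lambda>u. \<Sum>i\<in>UNIV. l $ i *\<^sub>R f i u) (\<lambda>\<omega>. l \<bullet> (X \<omega> - m))"
  unfolding inner_vec_def inner_real_def vector_minus_component
  by (intro wiener_integral_sum wiener_integral_scale X)

text \<open>Every linear form of the centred vector is a Wiener integral of the same linear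
  combination of integrands, so its characteristic function is known; the covariance is the Gram
  matrix of the integrands, singular or not.\<close>

lemma wiener_integral_gauss:
  assumes X: "\<And>i. wiener_integral M B (f i) (\<lambda>\<omega>. X \<omega> $ i - m $ i)"
  shows "is_gauss (distr M borel X) m (\<chi> i j. \<integral>u. f i u \<bullet> f j u \<partial>lborel)"
  unfolding is_gauss_def
proof (intro conjI allI)
  note Xm[measurable] = wiener_integral_vec_measurable[OF X]
  show "prob_space (distr M borel X)" by (rule prob_space_distr) measurable
  show "transpose (\<chi> i j. \<integral>u. f i u \<bullet> f j u \<partial>lborel) = (\<chi> i j. \<integral>u. f i u \<bullet> f j u \<partial>lborel)"
    by (simp add: transpose_def vec_eq_iff inner_commute)
  fix l
  have i: "integrable lborel (\<lambda>u. f i u \<bullet> f j u)" for i j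
    by (rule L2_fun_inner[OF wiener_integral_L2[OF X] wiener_integral_L2[OF X]])
  have "(\<integral>u. (\<Sum>i\<in>UNIV. l $ i *\<^sub>R f i u) \<bullet> (\<Sum>i\<in>UNIV. l $ i *\<^sub>R f i u) \<partial>lborel)
     = (\<integral>u. (\<Sum>i\<in>UNIV. \<Sum>j\<in>UNIV. l $ i * (l $ j * (f j u \<bullet> f i u))) \<partial>lborel)"
    by (simp add: inner_sum_left inner_sum_right sum_distrib_left)
  also have "\<dots> = l \<bullet> ((\<chi> i j. \<integral>u. f i u \<bullet> f j u \<partial>lborel) *v l)"
    using i by (simp add: inner_vec_def[of l] matrix_vector_mult_def sum_distrib_left mult_ac inner_commute)
  finally have q: "(\<integral>u. (\<Sum>i\<in>UNIV. l $ i *\<^sub>R f i u) \<bullet> (\<Sum>i\<in>UNIV. l $ i *\<^sub>R f i u) \<partial>lborel) =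
     l \<bullet> ((\<chi> i j. \<integral>u. f i u \<bullet> f j u \<partial>lborel) *v l)" .
  have "(\<integral>x. iexp (l \<bullet> x) \<partial>distr M borel X) = (\<integral>\<omega>. iexp (l \<bullet> m) * iexp (l \<bullet> (X \<omega> - m)) \<partial>M)"
    by (subst integral_distr) (simp_all add: inner_diff_right exp_add[symmetric] algebra_simps)
  also have "\<dots> = iexp (l \<bullet> m) * (\<integral>\<omega>. iexp (l \<bullet> (X \<omega> - m)) \<partial>M)" by simp
  also have "\<dots> = exp (\<i> * complex_of_real (l \<bullet> m) - complex_of_real (l \<bullet> ((\<chi> i j. \<integral>u. f i u \<bullet> f j u \<partial>lborel) *v l)) / 2)"
    unfolding wiener_integral_char[OF wiener_integral_inner[OF X]] q by (simp add: exp_add[symmetric])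
  finally show "(\<integral>x. iexp (l \<bullet> x) \<partial>distr M borel X) =
    exp (\<i> * complex_of_real (l \<bullet> m) - complex_of_real (l \<bullet> ((\<chi> i j. \<integral>u. f i u \<bullet> f j u \<partial>lborel) *v l)) / 2)" .
qed simp

lemma wiener_integral_jointly_gauss:
  fixes X :: "'w \<Rightarrow> real^'k" and Y :: "'w \<Rightarrow> real^'m"
  assumes X: "\<And>i. wiener_integral M B (f i) (\<lambda>\<omega>. X \<omega> $ i - m $ i)"
    and Y: "\<And>j. wiener_integral M B (g j) (\<lambda>\<omega>. Y \<omega> $ j - k $ j)"
  shows "jointly_gauss M X Y"
proof -
  have "wiener_integral M B (case_sum f g s) (\<lambda>\<omega>. stack (X \<omega>) (Y \<omega>) $ s - stack m k $ s)" for s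
    using X Y by (cases s) (simp_all add: stack_def)
  from wiener_integral_gauss[OF this] show ?thesis
    using wiener_integral_vec_measurable[OF X] wiener_integral_vec_measurable[OF Y]
    unfolding jointly_gauss_def by blast
qed

end

section \<open>Ito integrals of deterministic integrands\<close>

lemma disjoint_intervals_sum:
  fixes \<tau> :: "nat \<Rightarrow> real" and h :: "nat \<Rightarrow> 'b::real_vector"
  assumes mono: "\<And>i. i < k \<Longrightarrow> \<tau> i \<le> \<tau> (Suc i)" and i: "i < k" "u \<in> {\<tau> i<..\<tau> (Suc i)}"
  shows "(\<Sum>j<k. indicator {\<tau> j<..\<tau> (Suc j)} u *\<^sub>R h j) = h i"
proof -
  have le: "\<tau> m \<le> \<tau> n" if "m \<le> n" "n \<le> k" for m n
    using that
  proof (induction n rule: dec_induct)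
    case (step n)
    then show ?case using mono[of n] by auto
  qed simp
  have "indicator {\<tau> j<..\<tau> (Suc j)} u = (0::real)" if "j < k" "j \<noteq> i" for j
  proof (cases "j < i")
    case True
    then show ?thesis using le[of "Suc j" i] i by auto
  next
    case False
    then show ?thesis using le[of "Suc i" j] i that by auto
  qed
  then have "(\<Sum>j<k. indicator {\<tau> j<..\<tau> (Suc j)} u *\<^sub>R h j) = (\<Sum>j<k. if j = i then h j else 0)"
    using i(2) by (intro sum.cong) auto
  then show ?thesis using i(1) by simp
qed

text \<open>Variance plus squared bias: among constants the expectation is nearest in mean square,
  and the excess of any other constant is measured exactly.\<close>

lemma (in prob_space) expectation_square_decomp:
  fixes x :: "'a \<Rightarrow> real"
  assumes "integrable M x" "integrable M (\<lambda>\<omega>. (x \<omega>)\<^sup>2)"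
  shows "expectation (\<lambda>\<omega>. (x \<omega> - c)\<^sup>2) = expectation (\<lambda>\<omega>. (x \<omega> - expectation x)\<^sup>2) + (expectation x - c)\<^sup>2"
proof -
  have "(x \<omega> - c)\<^sup>2 = (x \<omega> - expectation x)\<^sup>2 + (2 * (expectation x - c) * (x \<omega> - expectation x) + (expectation x - c)\<^sup>2)" for \<omega>
    by (simp add: power2_eq_square algebra_simps)
  moreover have "integrable M (\<lambda>\<omega>. (x \<omega> - expectation x)\<^sup>2)"
    using assms by (simp add: power2_diff)
  ultimately show ?thesis using assms by (simp add: prob_space)
qed

context wiener
begin

text \<open>The expectations factorise because the increment is independent of \<open>F s\<close>.
  The case \<open>s = t\<close> is separate, as independence is given for \<open>s < t\<close>;
  there the increment is 0.\<close>

lemma increment_mult: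
  assumes s: "0 \<le> s" "s \<le> t" and X: "X \<in> borel_measurable (F s)" "integrable M X"
  shows "expectation (\<lambda>\<omega>. X \<omega> * (v \<bullet> (B t \<omega> - B s \<omega>))) = 0"
    "integrable M (\<lambda>\<omega>. X \<omega> * (v \<bullet> (B t \<omega> - B s \<omega>))\<^sup>2)"
    "expectation (\<lambda>\<omega>. X \<omega> * (v \<bullet> (B t \<omega> - B s \<omega>))\<^sup>2) = expectation X * ((t - s) * (v \<bullet> v))"
proof -
  note m = increment_moments[OF s, of v]
  have "expectation (\<lambda>\<omega>. X \<omega> * (v \<bullet> (B t \<omega> - B s \<omega>))) = 0 \<and>
    integrable M (\<lambda>\<omega>. X \<omega> * (v \<bullet> (B t \<omega> - B s \<omega>))\<^sup>2) \<and>
    expectation (\<lambda>\<omega>. X \<omega> * (v \<bullet> (B t \<omega> - B s \<omega>))\<^sup>2) = expectation X * ((t - s) * (v \<bullet> v))"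
  proof (cases "s = t")
    case False
    then have st: "s < t" using s by simp
    note ind = increment_indep[OF s(1) st X(1), of v]
    have ind2: "indep_var borel X borel (\<lambda>\<omega>. (v \<bullet> (B t \<omega> - B s \<omega>))\<^sup>2)"
      using indep_var_compose[OF ind, of "\<lambda>x. x" borel "\<lambda>x. x\<^sup>2" borel] by (simp add: comp_def)
    show ?thesis
      using indep_var_lebesgue_integral[OF ind X(2) m(1)] indep_var_lebesgue_integral[OF ind2 X(2) m(3)]
        indep_var_integrable[OF ind2 X(2) m(3)] m by simp
  qed simp
  then show "expectation (\<lambda>\<omega>. X \<omega> * (v \<bullet> (B t \<omega> - B s \<omega>))) = 0"
    "integrable M (\<lambda>\<omega>. X \<omega> * (v \<bullet> (B t \<omega> - B s \<omega>))\<^sup>2)"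
    "expectation (\<lambda>\<omega>. X \<omega> * (v \<bullet> (B t \<omega> - B s \<omega>))\<^sup>2) = expectation X * ((t - s) * (v \<bullet> v))" by blast+
qed

text \<open>Ito isometry for scalar coefficients and one direction \<open>v\<close>. The partial sum
  times the next coefficient is \<open>F (\<tau> k)\<close>-measurable, so its product with the next
  increment has expectation 0 and only diagonal terms remain. Adaptedness of the partial sum is
  carried through the induction for this reason.\<close>

lemma simple_sum_isometry:
  fixes x :: "nat \<Rightarrow> 'w \<Rightarrow> real"
  assumes "0 \<le> \<tau> 0" "\<And>i. i < k \<Longrightarrow> \<tau> i \<le> \<tau> (Suc i)" "\<And>i. i < k \<Longrightarrow> x i \<in> borel_measurable (F (\<tau> i))"
    "\<And>i. i < k \<Longrightarrow> \<exists>c. \<forall>\<omega>\<in>space M. \<bar>x i \<omega>\<bar> \<le> c"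
  shows "0 \<le> \<tau> k" "(\<lambda>\<omega>. \<Sum>i<k. x i \<omega> * (v \<bullet> (B (\<tau> (Suc i)) \<omega> - B (\<tau> i) \<omega>))) \<in> borel_measurable (F (\<tau> k))"
    "integrable M (\<lambda>\<omega>. (\<Sum>i<k. x i \<omega> * (v \<bullet> (B (\<tau> (Suc i)) \<omega> - B (\<tau> i) \<omega>)))\<^sup>2)"
    "expectation (\<lambda>\<omega>. (\<Sum>i<k. x i \<omega> * (v \<bullet> (B (\<tau> (Suc i)) \<omega> - B (\<tau> i) \<omega>)))\<^sup>2) =
      (\<Sum>i<k. expectation (\<lambda>\<omega>. (x i \<omega>)\<^sup>2) * ((\<tau> (Suc i) - \<tau> i) * (v \<bullet> v)))"
proof -
  have "0 \<le> \<tau> k \<and> (\<lambda>\<omega>. \<Sum>i<k. x i \<omega> * (v \<bullet> (B (\<tau> (Suc i)) \<omega> - B (\<tau> i) \<omega>))) \<in> borel_measurable (F (\<tau> k)) \<and>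
    integrable M (\<lambda>\<omega>. (\<Sum>i<k. x i \<omega> * (v \<bullet> (B (\<tau> (Suc i)) \<omega> - B (\<tau> i) \<omega>)))\<^sup>2) \<and>
    expectation (\<lambda>\<omega>. (\<Sum>i<k. x i \<omega> * (v \<bullet> (B (\<tau> (Suc i)) \<omega> - B (\<tau> i) \<omega>)))\<^sup>2) =
      (\<Sum>i<k. expectation (\<lambda>\<omega>. (x i \<omega>)\<^sup>2) * ((\<tau> (Suc i) - \<tau> i) * (v \<bullet> v)))"
    using assms
  proof (induction k)
    case (Suc k)
    define S where "S \<omega> = (\<Sum>i<k. x i \<omega> * (v \<bullet> (B (\<tau> (Suc i)) \<omega> - B (\<tau> i) \<omega>)))" for \<omega>
    define b where "b \<omega> = v \<bullet> (B (\<tau> (Suc k)) \<omega> - B (\<tau> k) \<omega>)" for \<omega>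
    have prems: "0 \<le> \<tau> 0" "\<And>i. i < k \<Longrightarrow> \<tau> i \<le> \<tau> (Suc i)" "\<And>i. i < k \<Longrightarrow> x i \<in> borel_measurable (F (\<tau> i))"
      "\<And>i. i < k \<Longrightarrow> \<exists>c. \<forall>\<omega>\<in>space M. \<bar>x i \<omega>\<bar> \<le> c"
      using Suc.prems by simp_all
    from Suc.IH[OF prems, folded S_def]
    have IH: "0 \<le> \<tau> k" "S \<in> borel_measurable (F (\<tau> k))" "integrable M (\<lambda>\<omega>. (S \<omega>)\<^sup>2)"
      "expectation (\<lambda>\<omega>. (S \<omega>)\<^sup>2) = (\<Sum>i<k. expectation (\<lambda>\<omega>. (x i \<omega>)\<^sup>2) * ((\<tau> (Suc i) - \<tau> i) * (v \<bullet> v)))"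
      unfolding S_def[abs_def] by blast+
    have le: "\<tau> k \<le> \<tau> (Suc k)" and xF: "x k \<in> borel_measurable (F (\<tau> k))" using Suc.prems by simp_all
    have c1: "0 \<le> \<tau> (Suc k)" using IH(1) le by simp
    have xM[measurable]: "x k \<in> borel_measurable M" by (rule F_measurable[OF IH(1) xF])
    have SM[measurable]: "S \<in> borel_measurable M" by (rule F_measurable[OF IH(1) IH(2)])
    obtain c where c: "\<And>\<omega>. \<omega> \<in> space M \<Longrightarrow> \<bar>x k \<omega>\<bar> \<le> c" using Suc.prems(4)[of k] by auto
    have x2: "integrable M (\<lambda>\<omega>. (x k \<omega>)\<^sup>2)"
      by (rule integrable_const_bound[where B="c\<^sup>2"]) (use c in \<open>auto intro!: AE_I2 abs_le_square_iff[THEN iffD1] order_trans[OF c abs_ge_self]\<close>)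
    have Sx: "integrable M (\<lambda>\<omega>. S \<omega> * x k \<omega>)" by (rule integrable_mult_of_squares[OF SM xM IH(3) x2])
    have SxF: "(\<lambda>\<omega>. S \<omega> * x k \<omega>) \<in> borel_measurable (F (\<tau> k))" using IH(2) xF by (rule borel_measurable_times)
    have x2F: "(\<lambda>\<omega>. (x k \<omega>)\<^sup>2) \<in> borel_measurable (F (\<tau> k))" using xF by (rule borel_measurable_power)
    note m1 = increment_mult[OF IH(1) le SxF Sx, of v, folded b_def]
    note m2 = increment_mult[OF IH(1) le x2F x2, of v, folded b_def]
    have Bm: "B (\<tau> k) \<in> borel_measurable (F (\<tau> (Suc k)))" "B (\<tau> (Suc k)) \<in> borel_measurable (F (\<tau> (Suc k)))"
      using F_measurable_mono[OF IH(1) le B_adapted[OF IH(1)]] B_adapted[of "\<tau> (Suc k)"] IH(1) le by auto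
    have bm: "b \<in> borel_measurable (F (\<tau> (Suc k)))" unfolding b_def using Bm by measurable
    have bM[measurable]: "b \<in> borel_measurable M" by (rule F_measurable[OF order_trans[OF IH(1) le] bm])
    have sum: "(\<Sum>i<Suc k. x i \<omega> * (v \<bullet> (B (\<tau> (Suc i)) \<omega> - B (\<tau> i) \<omega>))) = S \<omega> + x k \<omega> * b \<omega>" for \<omega>
      by (simp add: S_def b_def)
    have c2: "(\<lambda>\<omega>. \<Sum>i<Suc k. x i \<omega> * (v \<bullet> (B (\<tau> (Suc i)) \<omega> - B (\<tau> i) \<omega>))) \<in> borel_measurable (F (\<tau> (Suc k)))"
      unfolding sum by (intro borel_measurable_add borel_measurable_times bm F_measurable_mono[OF IH(1) le] IH xF)
    have sq: "(S \<omega> + x k \<omega> * b \<omega>)\<^sup>2 = (S \<omega>)\<^sup>2 + (2 * ((S \<omega> * x k \<omega>) * b \<omega>) + (x k \<omega>)\<^sup>2 * (b \<omega>)\<^sup>2)" for \<omega>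
      by (simp add: power2_sum power_mult_distrib algebra_simps)
    have i3: "integrable M (\<lambda>\<omega>. S \<omega> * x k \<omega> * b \<omega>)"
    proof -
      have "integrable M (\<lambda>\<omega>. S \<omega> * (x k \<omega> * b \<omega>))"
        by (rule integrable_mult_of_squares) (use IH(3) m2(2) in \<open>simp_all add: power_mult_distrib\<close>)
      then show ?thesis by (simp add: mult.assoc)
    qed
    have c3: "integrable M (\<lambda>\<omega>. (\<Sum>i<Suc k. x i \<omega> * (v \<bullet> (B (\<tau> (Suc i)) \<omega> - B (\<tau> i) \<omega>)))\<^sup>2)"
      unfolding sum sq by (intro Bochner_Integration.integrable_add integrable_mult_right i3 IH(3) m2(2))
    have c4: "expectation (\<lambda>\<omega>. (\<Sum>i<Suc k. x i \<omega> * (v \<bullet> (B (\<tau> (Suc i)) \<omega> - B (\<tau> i) \<omega>)))\<^sup>2) =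
        (\<Sum>i<Suc k. expectation (\<lambda>\<omega>. (x i \<omega>)\<^sup>2) * ((\<tau> (Suc i) - \<tau> i) * (v \<bullet> v)))"
      unfolding sum sq using i3 IH(3,4) m1(1) m2(2,3) by simp
    show ?case by (intro conjI c1 c2 c3 c4)
  qed simp
  then show "0 \<le> \<tau> k" "(\<lambda>\<omega>. \<Sum>i<k. x i \<omega> * (v \<bullet> (B (\<tau> (Suc i)) \<omega> - B (\<tau> i) \<omega>))) \<in> borel_measurable (F (\<tau> k))"
    "integrable M (\<lambda>\<omega>. (\<Sum>i<k. x i \<omega> * (v \<bullet> (B (\<tau> (Suc i)) \<omega> - B (\<tau> i) \<omega>)))\<^sup>2)"
    "expectation (\<lambda>\<omega>. (\<Sum>i<k. x i \<omega> * (v \<bullet> (B (\<tau> (Suc i)) \<omega> - B (\<tau> i) \<omega>)))\<^sup>2) =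
      (\<Sum>i<k. expectation (\<lambda>\<omega>. (x i \<omega>)\<^sup>2) * ((\<tau> (Suc i) - \<tau> i) * (v \<bullet> v)))" by blast+
qed

lemma simple_integral_measurable:
  fixes \<xi> :: "nat \<Rightarrow> 'w \<Rightarrow> real^'p^'d"
  assumes "simple_integrand M F t k \<tau> \<xi>"
  shows "(\<lambda>\<omega>. simple_integral B k \<tau> \<xi> \<omega> $ a) \<in> borel_measurable M"
proof -
  have \<tau>: "0 \<le> \<tau> 0" "\<And>i. i < k \<Longrightarrow> \<tau> i \<le> \<tau> (Suc i)" "\<And>i. i < k \<Longrightarrow> \<xi> i \<in> borel_measurable (F (\<tau> i))"
    using assms unfolding simple_integrand_def by blast+
  have \<tau>0: "0 \<le> \<tau> i" if "i \<le> k" for i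
    using that by (induction i) (use \<tau>(1,2) in \<open>auto intro: order_trans\<close>)
  have "(\<lambda>\<omega>. \<Sum>i<k. \<Sum>l\<in>UNIV. \<xi> i \<omega> $ a $ l * (B (\<tau> (Suc i)) \<omega> $ l - B (\<tau> i) \<omega> $ l)) \<in> borel_measurable M"
    by (intro borel_measurable_sum borel_measurable_times borel_measurable_diff borel_measurable_vec_nth
      B_measurable \<tau>0 F_measurable[OF _ \<tau>(3)]) auto
  then show ?thesis by (simp add: simple_integral_def matrix_vector_mult_def)
qed

text \<open>
  Replacing the random coefficients of an approximating simple process by their expectations moves
  it closer to the deterministic \<open>G\<close>, and the isometry bounds the change of the integral.
\<close>
lemma simple_integral_expectation:
  fixes \<xi> :: "nat \<Rightarrow> 'w \<Rightarrow> real^'p^'d" and \<delta> :: real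
  assumes simple: "simple_integrand M F t k \<tau> \<xi>"
    and Gm[measurable]: "(\<lambda>u. indicator {0..t} u *\<^sub>R G u) \<in> borel_measurable borel"
    and L: "L2_fun (\<lambda>u. indicator {0<..t} u *\<^sub>R (G u $ a))"
    and e: "(\<integral>\<^sup>+\<omega>. (\<integral>\<^sup>+u\<in>{0..t}. ennreal ((norm (simple_value k \<tau> \<xi> u \<omega> - G u))\<^sup>2) \<partial>lborel) \<partial>M) < ennreal \<delta>"
  obtains g Y where "wiener_integral M B g Y"
    "(\<integral>u. (g u - indicator {0<..t} u *\<^sub>R (G u $ a)) \<bullet> (g u - indicator {0<..t} u *\<^sub>R (G u $ a)) \<partial>lborel) < \<delta>"
    "expectation (\<lambda>\<omega>. min 1 ((Y \<omega> - simple_integral B k \<tau> \<xi> \<omega> $ a)\<^sup>2)) \<le> CARD('p) * \<delta>"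
proof -
  have \<tau>: "0 \<le> \<tau> 0" "\<And>i. i < k \<Longrightarrow> \<tau> i \<le> \<tau> (Suc i)" "\<tau> k \<le> t"
    and \<xi>F: "\<And>i. i < k \<Longrightarrow> \<xi> i \<in> borel_measurable (F (\<tau> i))"
    and \<xi>b: "\<And>i. i < k \<Longrightarrow> \<exists>c. \<forall>\<omega>\<in>space M. norm (\<xi> i \<omega>) \<le> c"
    using simple unfolding simple_integrand_def by blast+
  have mono: "\<tau> m \<le> \<tau> n" if "m \<le> n" "n \<le> k" for m n
    using that
  proof (induction n rule: dec_induct)
    case (step n)
    then show ?case using \<tau>(2)[of n] by auto
  qed simp
  have \<tau>0: "0 \<le> \<tau> i" if "i \<le> k" for i using mono[of 0 i] \<tau>(1) that by simp
  have \<xi>M: "\<xi> i \<in> borel_measurable M" if "i < k" for i using F_measurable[OF \<tau>0 \<xi>F] that by simp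
  have \<xi>lm: "(\<lambda>\<omega>. \<xi> i \<omega> $ a $ l) \<in> borel_measurable M" if "i < k" for i l
    by (intro borel_measurable_vec_nth \<xi>M that)
  have \<xi>lF: "(\<lambda>\<omega>. \<xi> i \<omega> $ a $ l) \<in> borel_measurable (F (\<tau> i))" if "i < k" for i l
    by (intro borel_measurable_vec_nth \<xi>F that)
  have \<xi>lb: "\<exists>c. \<forall>\<omega>\<in>space M. \<bar>\<xi> i \<omega> $ a $ l\<bar> \<le> c" if i: "i < k" for i l
  proof -
    obtain c where "\<And>\<omega>. \<omega> \<in> space M \<Longrightarrow> norm (\<xi> i \<omega>) \<le> c" using \<xi>b[OF i] by blast
    moreover have "\<bar>\<xi> i \<omega> $ a $ l\<bar> \<le> norm (\<xi> i \<omega>)" for \<omega>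
      using component_le_norm_cart[of "\<xi> i \<omega> $ a" l] Finite_Cartesian_Product.norm_nth_le[of "\<xi> i \<omega>" a] by linarith
    ultimately show ?thesis by (meson order_trans)
  qed
  have \<xi>1: "integrable M (\<lambda>\<omega>. \<xi> i \<omega> $ a $ l)" if i: "i < k" for i l
  proof -
    obtain c where "\<And>\<omega>. \<omega> \<in> space M \<Longrightarrow> \<bar>\<xi> i \<omega> $ a $ l\<bar> \<le> c" using \<xi>lb[OF i] by blast
    then show ?thesis by (intro integrable_const_bound[where B=c] \<xi>lm i) auto
  qed
  have \<xi>2: "integrable M (\<lambda>\<omega>. (\<xi> i \<omega> $ a $ l)\<^sup>2)" if i: "i < k" for i l
  proof -
    obtain c where "\<And>\<omega>. \<omega> \<in> space M \<Longrightarrow> \<bar>\<xi> i \<omega> $ a $ l\<bar> \<le> c" using \<xi>lb[OF i] by blast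
    then show ?thesis
      by (intro integrable_const_bound[where B="c\<^sup>2"] borel_measurable_power \<xi>lm i)
         (auto intro!: AE_I2 abs_le_square_iff[THEN iffD1] order_trans[OF _ abs_ge_self])
  qed
  \<comment> \<open>Only row \<open>a\<close> matters: \<open>\<eta>\<close> holds its mean
    coefficients, \<open>z\<close> the fluctuations and \<open>V\<close> their total variance.
    \<open>W\<close> is that variance as a function of time, so its integral is what the isometry
    gives for the integrated fluctuation, summed over coordinates.\<close>
  define \<eta> where "\<eta> i = (\<chi> l. expectation (\<lambda>\<omega>. \<xi> i \<omega> $ a $ l))" for i
  define z where "z i l \<omega> = \<xi> i \<omega> $ a $ l - \<eta> i $ l" for i l \<omega>
  define V where "V i = (\<Sum>l\<in>UNIV. expectation (\<lambda>\<omega>. (z i l \<omega>)\<^sup>2))" for i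
  define g where "g u = (\<Sum>i<k. indicator {\<tau> i<..\<tau> (Suc i)} u *\<^sub>R \<eta> i)" for u
  define Y where "Y \<omega> = (\<Sum>i<k. \<eta> i \<bullet> (B (\<tau> (Suc i)) \<omega> - B (\<tau> i) \<omega>))" for \<omega>
  define W where "W u = (\<Sum>i<k. indicator {\<tau> i<..\<tau> (Suc i)} u *\<^sub>R V i)" for u
  define f where "f u = indicator {0<..t} u *\<^sub>R (G u $ a)" for u
  have V0: "0 \<le> V i" for i unfolding V_def by (intro sum_nonneg) simp
  have gY: "wiener_integral M B g Y"
    unfolding g_def Y_def by (intro wiener_integral_sum wiener_integral_increment) (use \<tau>(2) \<tau>0 in auto)
  have Lg: "L2_fun (\<lambda>u. g u - f u)" unfolding f_def by (rule L2_fun_diff[OF wiener_integral_L2[OF gY] L])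
  \<comment> \<open>At fixed \<open>u\<close> at most one interval is active, and the mean-square
    distance of the row from \<open>f u\<close> splits into variance plus squared bias; dropping the
    other rows of the Frobenius norm gives the inequality.\<close>
  have decomp: "(\<integral>\<^sup>+\<omega>. ennreal ((norm (simple_value k \<tau> \<xi> u \<omega> - G u))\<^sup>2) \<partial>M) \<ge> ennreal (W u + (g u - f u) \<bullet> (g u - f u))"
    if u: "u \<in> {0<..t}" for u
  proof -
    have fu: "f u = G u $ a" using u by (simp add: f_def)
    have ge: "(simple_value k \<tau> \<xi> u \<omega> $ a - f u) \<bullet> (simple_value k \<tau> \<xi> u \<omega> $ a - f u) \<le> (norm (simple_value k \<tau> \<xi> u \<omega> - G u))\<^sup>2" for \<omega>
      using Finite_Cartesian_Product.norm_nth_le[of "simple_value k \<tau> \<xi> u \<omega> - G u" a]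
      by (simp add: fu power2_norm_eq_inner[symmetric] power_mono)
    have sv: "simple_value k \<tau> \<xi> u \<omega> $ a = (\<Sum>i<k. indicator {\<tau> i<..\<tau> (Suc i)} u *\<^sub>R (\<xi> i \<omega> $ a))" for \<omega>
      by (simp add: simple_value_def del: sum_indicator_scaleR)
    have "expectation (\<lambda>\<omega>. (simple_value k \<tau> \<xi> u \<omega> $ a - f u) \<bullet> (simple_value k \<tau> \<xi> u \<omega> $ a - f u)) = W u + (g u - f u) \<bullet> (g u - f u)
       \<and> integrable M (\<lambda>\<omega>. (simple_value k \<tau> \<xi> u \<omega> $ a - f u) \<bullet> (simple_value k \<tau> \<xi> u \<omega> $ a - f u))"
    proof (cases "\<exists>i<k. u \<in> {\<tau> i<..\<tau> (Suc i)}")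
      case True
      then obtain i where i: "i < k" "u \<in> {\<tau> i<..\<tau> (Suc i)}" by blast
      have d: "simple_value k \<tau> \<xi> u \<omega> $ a = \<xi> i \<omega> $ a" "g u = \<eta> i" "W u = V i" for \<omega>
        unfolding sv g_def W_def by (rule disjoint_intervals_sum[OF \<tau>(2) i]; assumption)+
      have int: "integrable M (\<lambda>\<omega>. (\<xi> i \<omega> $ a $ l - f u $ l)\<^sup>2)" for l
        using \<xi>1[OF i(1)] \<xi>2[OF i(1)] by (simp add: power2_diff)
      have "expectation (\<lambda>\<omega>. (\<xi> i \<omega> $ a - f u) \<bullet> (\<xi> i \<omega> $ a - f u)) = (\<Sum>l\<in>UNIV. expectation (\<lambda>\<omega>. (\<xi> i \<omega> $ a $ l - f u $ l)\<^sup>2))"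
        using int by (simp add: inner_vec_def power2_eq_square[symmetric])
      also have "\<dots> = (\<Sum>l\<in>UNIV. expectation (\<lambda>\<omega>. (z i l \<omega>)\<^sup>2) + (\<eta> i $ l - f u $ l)\<^sup>2)"
        unfolding z_def \<eta>_def vec_lambda_beta
        by (intro sum.cong refl expectation_square_decomp \<xi>1[OF i(1)] \<xi>2[OF i(1)])
      also have "\<dots> = V i + (\<eta> i - f u) \<bullet> (\<eta> i - f u)"
        by (simp add: V_def inner_vec_def power2_eq_square sum.distrib)
      finally show ?thesis
        using int unfolding d by (simp add: inner_vec_def power2_eq_square[symmetric])
    next
      case False
      then have 0: "indicator {\<tau> i<..\<tau> (Suc i)} u = (0::real)" if "i < k" for i using that by auto
      show ?thesis unfolding sv W_def g_def by (simp add: 0 prob_space del: sum_indicator_scaleR)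
    qed
    then have eq: "expectation (\<lambda>\<omega>. (simple_value k \<tau> \<xi> u \<omega> $ a - f u) \<bullet> (simple_value k \<tau> \<xi> u \<omega> $ a - f u)) = W u + (g u - f u) \<bullet> (g u - f u)"
      and int: "integrable M (\<lambda>\<omega>. (simple_value k \<tau> \<xi> u \<omega> $ a - f u) \<bullet> (simple_value k \<tau> \<xi> u \<omega> $ a - f u))" by blast+
    have "ennreal (W u + (g u - f u) \<bullet> (g u - f u)) = (\<integral>\<^sup>+\<omega>. ennreal ((simple_value k \<tau> \<xi> u \<omega> $ a - f u) \<bullet> (simple_value k \<tau> \<xi> u \<omega> $ a - f u)) \<partial>M)"
      unfolding eq[symmetric] using int by (intro nn_integral_eq_integral[symmetric]) auto
    also have "\<dots> \<le> (\<integral>\<^sup>+\<omega>. ennreal ((norm (simple_value k \<tau> \<xi> u \<omega> - G u))\<^sup>2) \<partial>M)"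
      by (intro nn_integral_mono ennreal_leI ge)
    finally show ?thesis .
  qed
  have out: "W u = 0" "g u = 0" "f u = 0" if "u \<notin> {0<..t}" for u
  proof -
    have 0: "indicator {\<tau> i<..\<tau> (Suc i)} u = (0::real)" if "i < k" for i
      using \<open>u \<notin> {0<..t}\<close> \<tau>0[of i] mono[of "Suc i" k] \<tau>(3) that by (auto simp: indicator_def)
    show "W u = 0" "g u = 0" unfolding W_def g_def by (simp_all add: 0 del: sum_indicator_scaleR)
    show "f u = 0" using that by (simp add: f_def)
  qed
  have W0: "0 \<le> W u" for u unfolding W_def using V0 by (intro sum_nonneg) (simp add: indicator_def)
  have iW: "integrable lborel W"
    unfolding W_def[abs_def] using \<tau>(2) by (intro Bochner_Integration.integrable_sum integrable_scaleR_left) simp_all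
  have intW: "(\<integral>u. W u \<partial>lborel) = (\<Sum>i<k. (\<tau> (Suc i) - \<tau> i) * V i)"
    unfolding W_def using \<tau>(2) by (subst Bochner_Integration.integral_sum) (simp_all del: sum_indicator_scaleR add: integrable_scaleR_left)
  note ig = L2_fun_inner[OF Lg Lg]
  have gf0: "0 \<le> (\<integral>u. (g u - f u) \<bullet> (g u - f u) \<partial>lborel)" by simp
  have W00: "0 \<le> (\<integral>u. W u \<partial>lborel)" using W0 by simp
  interpret P: pair_sigma_finite M lborel ..
  have "ennreal ((\<integral>u. W u \<partial>lborel) + (\<integral>u. (g u - f u) \<bullet> (g u - f u) \<partial>lborel)) = ennreal (\<integral>u. W u + (g u - f u) \<bullet> (g u - f u) \<partial>lborel)"
    using iW ig by simp
  also have "\<dots> = (\<integral>\<^sup>+u. ennreal (W u + (g u - f u) \<bullet> (g u - f u)) \<partial>lborel)"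
    using iW ig W0 by (intro nn_integral_eq_integral[symmetric]) (auto intro!: add_nonneg_nonneg)
  also have "\<dots> \<le> (\<integral>\<^sup>+u. (\<integral>\<^sup>+\<omega>. ennreal ((norm (simple_value k \<tau> \<xi> u \<omega> - G u))\<^sup>2) * indicator {0..t} u \<partial>M) \<partial>lborel)"
  proof (rule nn_integral_mono)
    fix u
    show "ennreal (W u + (g u - f u) \<bullet> (g u - f u)) \<le> (\<integral>\<^sup>+\<omega>. ennreal ((norm (simple_value k \<tau> \<xi> u \<omega> - G u))\<^sup>2) * indicator {0..t} u \<partial>M)"
      using decomp[of u] out[of u] by (cases "u \<in> {0<..t}") auto
  qed
  \<comment> \<open>\<open>G\<close> is known to be measurable only after the cut-off to
    \<open>{0..t}\<close>; inserting the cut-off changes nothing here and makes the integrand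
    jointly measurable, as the exchange of integrals requires.\<close>
  also have "\<dots> = (\<integral>\<^sup>+u. (\<integral>\<^sup>+\<omega>. ennreal ((norm (simple_value k \<tau> \<xi> u \<omega> - indicator {0..t} u *\<^sub>R G u))\<^sup>2) * indicator {0..t} u \<partial>M) \<partial>lborel)"
    by (intro nn_integral_cong) (auto simp: indicator_def)
  also have "\<dots> = (\<integral>\<^sup>+\<omega>. (\<integral>\<^sup>+u. ennreal ((norm (simple_value k \<tau> \<xi> u \<omega> - indicator {0..t} u *\<^sub>R G u))\<^sup>2) * indicator {0..t} u \<partial>lborel) \<partial>M)"
  proof (rule P.Fubini')
    have sv: "(\<lambda>p. simple_value k \<tau> \<xi> (snd p) (fst p)) \<in> borel_measurable (M \<Otimes>\<^sub>M lborel)"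
      unfolding simple_value_def
    proof (rule borel_measurable_sum)
      fix i assume "i \<in> {..<k}"
      then have [measurable]: "\<xi> i \<in> borel_measurable M" using \<xi>M by simp
      show "(\<lambda>p. indicator {\<tau> i<..\<tau> (Suc i)} (snd p) *\<^sub>R \<xi> i (fst p)) \<in> borel_measurable (M \<Otimes>\<^sub>M lborel)" by measurable
    qed
    have G': "(\<lambda>p. indicator {0..t} (snd p) *\<^sub>R G (snd p)) \<in> borel_measurable (M \<Otimes>\<^sub>M lborel)"
      by (rule measurable_compose[OF measurable_snd, where g="\<lambda>u. indicator {0..t} u *\<^sub>R G u"]) simp
    note [measurable] = borel_measurable_diff[OF sv G']
    show "(\<lambda>(\<omega>, u). ennreal ((norm (simple_value k \<tau> \<xi> u \<omega> - indicator {0..t} u *\<^sub>R G u))\<^sup>2) * indicator {0..t} u) \<in> borel_measurable (M \<Otimes>\<^sub>M lborel)"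
      unfolding case_prod_beta' by measurable
  qed
  also have "\<dots> = (\<integral>\<^sup>+\<omega>. (\<integral>\<^sup>+u\<in>{0..t}. ennreal ((norm (simple_value k \<tau> \<xi> u \<omega> - G u))\<^sup>2) \<partial>lborel) \<partial>M)"
    by (intro nn_integral_cong) (auto simp: indicator_def)
  finally have "ennreal ((\<integral>u. W u \<partial>lborel) + (\<integral>u. (g u - f u) \<bullet> (g u - f u) \<partial>lborel)) < ennreal \<delta>"
    using e by (rule le_less_trans)
  then have less: "(\<integral>u. W u \<partial>lborel) + (\<integral>u. (g u - f u) \<bullet> (g u - f u) \<partial>lborel) < \<delta>"
    by (rule ennreal_less_iff[OF add_nonneg_nonneg[OF W00 gf0], THEN iffD1])
  show thesis
  proof (rule that[OF gY])
    show "(\<integral>u. (g u - indicator {0<..t} u *\<^sub>R (G u $ a)) \<bullet> (g u - indicator {0<..t} u *\<^sub>R (G u $ a)) \<partial>lborel) < \<delta>"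
      using less W00 unfolding f_def by linarith
    \<comment> \<open>The isometry is scalar, so the integrated fluctuation is split along the
      coordinates of \<open>B\<close>; squaring the sum costs the factor
      \<open>CARD('p)\<close>.\<close>
    define R where "R l \<omega> = (\<Sum>i<k. z i l \<omega> * (axis l 1 \<bullet> (B (\<tau> (Suc i)) \<omega> - B (\<tau> i) \<omega>)))" for l \<omega>
    have zF: "z i l \<in> borel_measurable (F (\<tau> i))" if "i < k" for i l
      unfolding z_def[abs_def] using \<xi>lF[OF that] by simp
    have zb: "\<exists>c. \<forall>\<omega>\<in>space M. \<bar>z i l \<omega>\<bar> \<le> c" if i: "i < k" for i l
    proof -
      obtain c where c: "\<And>\<omega>. \<omega> \<in> space M \<Longrightarrow> \<bar>\<xi> i \<omega> $ a $ l\<bar> \<le> c" using \<xi>lb[OF i] by blast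
      have "\<bar>z i l \<omega>\<bar> \<le> c + \<bar>\<eta> i $ l\<bar>" if "\<omega> \<in> space M" for \<omega> using c[OF that] unfolding z_def by linarith
      then show ?thesis by blast
    qed
    have R2: "integrable M (\<lambda>\<omega>. (R l \<omega>)\<^sup>2)" for l
      unfolding R_def by (rule simple_sum_isometry(3)[OF \<tau>(1,2) zF zb])
    have ER: "expectation (\<lambda>\<omega>. (R l \<omega>)\<^sup>2) = (\<Sum>i<k. expectation (\<lambda>\<omega>. (z i l \<omega>)\<^sup>2) * (\<tau> (Suc i) - \<tau> i))" for l
      unfolding R_def by (subst simple_sum_isometry(4)[OF \<tau>(1,2) zF zb]) (simp_all add: inner_axis_axis)
    have YR: "Y \<omega> - simple_integral B k \<tau> \<xi> \<omega> $ a = - (\<Sum>l\<in>UNIV. R l \<omega>)" for \<omega>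
    proof -
      have "(\<Sum>l\<in>UNIV. R l \<omega>) = (\<Sum>i<k. \<Sum>l\<in>UNIV. z i l \<omega> * (B (\<tau> (Suc i)) \<omega> $ l - B (\<tau> i) \<omega> $ l))"
        unfolding R_def by (subst sum.swap) (simp add: inner_axis')
      then show ?thesis
        by (simp add: Y_def simple_integral_def z_def inner_vec_def matrix_vector_mult_def sum_subtractf left_diff_distrib)
    qed
    have "expectation (\<lambda>\<omega>. min 1 ((Y \<omega> - simple_integral B k \<tau> \<xi> \<omega> $ a)\<^sup>2)) \<le> expectation (\<lambda>\<omega>. CARD('p) * (\<Sum>l\<in>UNIV. (R l \<omega>)\<^sup>2))"
    proof (rule integral_mono)
      show "integrable M (\<lambda>\<omega>. CARD('p) * (\<Sum>l\<in>UNIV. (R l \<omega>)\<^sup>2))"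
        by (intro integrable_mult_right Bochner_Integration.integrable_sum R2)
      have "R l \<in> borel_measurable M" for l
        unfolding R_def[abs_def] by (rule F_measurable[OF simple_sum_isometry(1,2)[OF \<tau>(1,2) zF zb]])
      then show "integrable M (\<lambda>\<omega>. min 1 ((Y \<omega> - simple_integral B k \<tau> \<xi> \<omega> $ a)\<^sup>2))"
        unfolding YR by (intro integrable_min_square borel_measurable_uminus borel_measurable_sum)
      fix \<omega>
      have "min 1 ((Y \<omega> - simple_integral B k \<tau> \<xi> \<omega> $ a)\<^sup>2) \<le> (\<Sum>l\<in>UNIV. R l \<omega>)\<^sup>2" unfolding YR by simp
      also have "\<dots> \<le> CARD('p) * (\<Sum>l\<in>UNIV. (R l \<omega>)\<^sup>2)"
        using sum_squared_le_sum_of_squares[of "\<lambda>l. R l \<omega>" "UNIV :: 'p set"] by (simp add: mult.commute)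
      finally show "min 1 ((Y \<omega> - simple_integral B k \<tau> \<xi> \<omega> $ a)\<^sup>2) \<le> CARD('p) * (\<Sum>l\<in>UNIV. (R l \<omega>)\<^sup>2)" .
    qed
    also have "\<dots> = CARD('p) * (\<Sum>l\<in>UNIV. \<Sum>i<k. expectation (\<lambda>\<omega>. (z i l \<omega>)\<^sup>2) * (\<tau> (Suc i) - \<tau> i))"
      using R2 by (simp add: ER)
    also have "(\<Sum>l\<in>UNIV. \<Sum>i<k. expectation (\<lambda>\<omega>. (z i l \<omega>)\<^sup>2) * (\<tau> (Suc i) - \<tau> i)) = (\<integral>u. W u \<partial>lborel)"
      unfolding intW V_def by (subst sum.swap) (simp add: sum_distrib_left mult.commute)
    also have "CARD('p) * (\<integral>u. W u \<partial>lborel) \<le> CARD('p) * \<delta>"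
    proof (rule mult_left_mono)
      show "(\<integral>u. W u \<partial>lborel) \<le> \<delta>" using less gf0 by linarith
    qed simp
    finally show "expectation (\<lambda>\<omega>. min 1 ((Y \<omega> - simple_integral B k \<tau> \<xi> \<omega> $ a)\<^sup>2)) \<le> CARD('p) * \<delta>" by simp
  qed
qed


text \<open>A simple integral is close to the given version in mean square, and by the isometry
  close to the Wiener integral of its averaged coefficients; closedness of the relation does the
  rest. Hence every version of the Ito integral of a deterministic integrand is a Wiener integral,
  row by row.\<close>

lemma has_ito_integral_wiener_integral:
  fixes X :: "'w \<Rightarrow> real^'d" and G :: "real \<Rightarrow> real^'p^'d"
  assumes ito: "has_ito_integral M F B (\<lambda>u \<omega>. G u) t X"
    and Gm: "(\<lambda>u. indicator {0..t} u *\<^sub>R G u) \<in> borel_measurable borel"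
    and L: "L2_fun (\<lambda>u. indicator {0<..t} u *\<^sub>R (G u $ a))"
  shows "wiener_integral M B (\<lambda>u. indicator {0<..t} u *\<^sub>R (G u $ a)) (\<lambda>\<omega>. X \<omega> $ a)"
proof -
  obtain k \<tau> \<xi> where simple: "\<And>n. simple_integrand M F t (k n) (\<tau> n) (\<xi> n)"
    and e: "(\<lambda>n. \<integral>\<^sup>+\<omega>. (\<integral>\<^sup>+u\<in>{0..t}.
            ennreal ((norm (simple_value (k n) (\<tau> n) (\<xi> n) u \<omega> - G u))\<^sup>2) \<partial>lborel) \<partial>M) \<longlonglongrightarrow> 0"
    and d: "(\<lambda>n. \<integral>\<^sup>+\<omega>. ennreal ((norm (simple_integral B (k n) (\<tau> n) (\<xi> n) \<omega> - X \<omega>))\<^sup>2) \<partial>M) \<longlonglongrightarrow> 0"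
    using ito unfolding has_ito_integral_def by blast
  have Xm: "X \<in> borel_measurable M" using ito unfolding has_ito_integral_def by blast
  have Xa[measurable]: "(\<lambda>\<omega>. X \<omega> $ a) \<in> borel_measurable M" by (rule borel_measurable_vec_nth[OF Xm])
  show ?thesis
  proof (rule wiener_integral_approx[OF L Xa])
    fix \<epsilon> :: real assume \<epsilon>: "0 < \<epsilon>"
    \<comment> \<open>Chosen so that \<open>CARD('p) * \<delta> = \<epsilon> / 8\<close>; with
      \<open>\<epsilon> / 8\<close> for the other error and the factor 2 of the truncated triangle
      inequality, the total is at most \<open>\<epsilon> / 2\<close>.\<close>
    define \<delta> where "\<delta> = \<epsilon> / (8 * CARD('p))"
    have c1: "1 \<le> real CARD('p)" by (simp add: Suc_leI)
    have \<delta>: "0 < \<delta>" "CARD('p) * \<delta> = \<epsilon> / 8" "\<delta> \<le> \<epsilon>"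
    proof -
      show "0 < \<delta>" unfolding \<delta>_def using \<epsilon> c1 by (intro divide_pos_pos mult_pos_pos) linarith+
      show p\<delta>: "CARD('p) * \<delta> = \<epsilon> / 8" unfolding \<delta>_def using c1 by (simp add: field_simps)
      have "\<delta> \<le> CARD('p) * \<delta>" using c1 \<open>0 < \<delta>\<close> by simp
      then show "\<delta> \<le> \<epsilon>" using p\<delta> \<epsilon> by linarith
    qed
    have "\<forall>\<^sub>F n in sequentially. (\<integral>\<^sup>+\<omega>. (\<integral>\<^sup>+u\<in>{0..t}.
            ennreal ((norm (simple_value (k n) (\<tau> n) (\<xi> n) u \<omega> - G u))\<^sup>2) \<partial>lborel) \<partial>M) < ennreal \<delta>"
      by (rule order_tendstoD(2)[OF e]) (use \<delta> in simp)
    moreover have "\<forall>\<^sub>F n in sequentially. (\<integral>\<^sup>+\<omega>. ennreal ((norm (simple_integral B (k n) (\<tau> n) (\<xi> n) \<omega> - X \<omega>))\<^sup>2) \<partial>M) < ennreal (\<epsilon> / 8)"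
      by (rule order_tendstoD(2)[OF d]) (use \<epsilon> in simp)
    ultimately have "\<forall>\<^sub>F n in sequentially. (\<integral>\<^sup>+\<omega>. (\<integral>\<^sup>+u\<in>{0..t}.
            ennreal ((norm (simple_value (k n) (\<tau> n) (\<xi> n) u \<omega> - G u))\<^sup>2) \<partial>lborel) \<partial>M) < ennreal \<delta> \<and>
       (\<integral>\<^sup>+\<omega>. ennreal ((norm (simple_integral B (k n) (\<tau> n) (\<xi> n) \<omega> - X \<omega>))\<^sup>2) \<partial>M) < ennreal (\<epsilon> / 8)"
      by (rule eventually_conj)
    then obtain n where n1: "(\<integral>\<^sup>+\<omega>. (\<integral>\<^sup>+u\<in>{0..t}.
            ennreal ((norm (simple_value (k n) (\<tau> n) (\<xi> n) u \<omega> - G u))\<^sup>2) \<partial>lborel) \<partial>M) < ennreal \<delta>"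
      and n2: "(\<integral>\<^sup>+\<omega>. ennreal ((norm (simple_integral B (k n) (\<tau> n) (\<xi> n) \<omega> - X \<omega>))\<^sup>2) \<partial>M) < ennreal (\<epsilon> / 8)"
      unfolding eventually_sequentially by blast
    define S where "S \<omega> = simple_integral B (k n) (\<tau> n) (\<xi> n) \<omega> $ a" for \<omega>
    obtain g Y where gY: "wiener_integral M B g Y"
      and g: "(\<integral>u. (g u - indicator {0<..t} u *\<^sub>R (G u $ a)) \<bullet> (g u - indicator {0<..t} u *\<^sub>R (G u $ a)) \<partial>lborel) < \<delta>"
      and Y: "expectation (\<lambda>\<omega>. min 1 ((Y \<omega> - S \<omega>)\<^sup>2)) \<le> CARD('p) * \<delta>"
      by (rule simple_integral_expectation[OF simple Gm L n1, folded S_def])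
    note [measurable] = wiener_integral_measurable[OF gY]
    have Sm[measurable]: "S \<in> borel_measurable M"
      unfolding S_def[abs_def] by (rule simple_integral_measurable[OF simple])
    have "ennreal (expectation (\<lambda>\<omega>. min 1 ((S \<omega> - X \<omega> $ a)\<^sup>2))) = (\<integral>\<^sup>+\<omega>. ennreal (min 1 ((S \<omega> - X \<omega> $ a)\<^sup>2)) \<partial>M)"
      by (intro nn_integral_eq_integral[symmetric] integrable_min_square) auto
    also have "\<dots> \<le> (\<integral>\<^sup>+\<omega>. ennreal ((norm (simple_integral B (k n) (\<tau> n) (\<xi> n) \<omega> - X \<omega>))\<^sup>2) \<partial>M)"
    proof (intro nn_integral_mono ennreal_leI)
      fix \<omega>
      have "\<bar>S \<omega> - X \<omega> $ a\<bar> \<le> norm (simple_integral B (k n) (\<tau> n) (\<xi> n) \<omega> - X \<omega>)"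
        using component_le_norm_cart[of "simple_integral B (k n) (\<tau> n) (\<xi> n) \<omega> - X \<omega>" a] by (simp add: S_def)
      then have "(S \<omega> - X \<omega> $ a)\<^sup>2 \<le> (norm (simple_integral B (k n) (\<tau> n) (\<xi> n) \<omega> - X \<omega>))\<^sup>2"
        by (intro abs_le_square_iff[THEN iffD1]) simp
      then show "min 1 ((S \<omega> - X \<omega> $ a)\<^sup>2) \<le> (norm (simple_integral B (k n) (\<tau> n) (\<xi> n) \<omega> - X \<omega>))\<^sup>2"
        by (rule min.coboundedI2)
    qed
    finally have "ennreal (expectation (\<lambda>\<omega>. min 1 ((S \<omega> - X \<omega> $ a)\<^sup>2))) < ennreal (\<epsilon> / 8)"
      using n2 by (rule le_less_trans)
    then have SX: "expectation (\<lambda>\<omega>. min 1 ((S \<omega> - X \<omega> $ a)\<^sup>2)) < \<epsilon> / 8"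
      by (subst (asm) ennreal_less_iff) simp_all
    have "expectation (\<lambda>\<omega>. min 1 ((Y \<omega> - X \<omega> $ a)\<^sup>2)) \<le>
      2 * expectation (\<lambda>\<omega>. min 1 ((Y \<omega> - S \<omega>)\<^sup>2)) + 2 * expectation (\<lambda>\<omega>. min 1 ((S \<omega> - X \<omega> $ a)\<^sup>2))"
      using expectation_min_square_add_le[of "\<lambda>\<omega>. Y \<omega> - S \<omega>" "\<lambda>\<omega>. S \<omega> - X \<omega> $ a"] by simp
    also have "\<dots> < \<epsilon>" using Y SX \<delta>(2) \<epsilon> by linarith
    finally have YX: "expectation (\<lambda>\<omega>. min 1 ((Y \<omega> - X \<omega> $ a)\<^sup>2)) < \<epsilon>" .
    show "\<exists>g Y. wiener_integral M B g Y \<and>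
       (\<integral>u. (g u - indicator {0<..t} u *\<^sub>R (G u $ a)) \<bullet> (g u - indicator {0<..t} u *\<^sub>R (G u $ a)) \<partial>lborel) < \<epsilon> \<and>
       expectation (\<lambda>\<omega>. min 1 ((Y \<omega> - X \<omega> $ a)\<^sup>2)) < \<epsilon>"
      using gY less_le_trans[OF g \<delta>(3)] YX by blast
  qed
qed

end

section \<open>Evolution matrices\<close>

lemma continuous_on_matrix_mult[continuous_intros]:
  fixes A :: "'a::topological_space \<Rightarrow> real^'m^'k" and C :: "'a \<Rightarrow> real^'n^'m"
  assumes "continuous_on S A" "continuous_on S C"
  shows "continuous_on S (\<lambda>x. A x ** C x)"
  unfolding matrix_matrix_mult_def using assms by (intro continuous_intros)

lemma continuous_on_matrix_vector_mult[continuous_intros]: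
  fixes A :: "'a::topological_space \<Rightarrow> real^'m^'k" and y :: "'a \<Rightarrow> real^'m"
  assumes "continuous_on S A" "continuous_on S y"
  shows "continuous_on S (\<lambda>x. A x *v y x)"
  unfolding matrix_vector_mult_def using assms by (intro continuous_intros)

lemma continuous_on_transpose[continuous_intros]:
  fixes A :: "'a::topological_space \<Rightarrow> real^'m^'k"
  assumes "continuous_on S A"
  shows "continuous_on S (\<lambda>x. transpose (A x))"
  unfolding transpose_def using assms by (intro continuous_intros)

lemma has_vector_derivative_matrix_vector_mult:
  fixes A :: "real \<Rightarrow> real^'m^'k"
  assumes "(A has_vector_derivative A') F"
  shows "((\<lambda>t. A t *v x) has_vector_derivative A' *v x) F"
proof -
  have "bounded_linear (\<lambda>A :: real^'m^'k. A *v x)"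
    by (intro linear_conv_bounded_linear[THEN iffD1] linearI)
       (simp_all add: matrix_vector_mult_add_rdistrib scaleR_matrix_vector_assoc)
  from bounded_linear.has_vector_derivative[OF this assms] show ?thesis .
qed

lemma has_vector_derivative_entry:
  fixes A :: "real \<Rightarrow> real^'m^'k"
  assumes "(A has_vector_derivative A') F"
  shows "((\<lambda>t. A t $ i $ j) has_real_derivative A' $ i $ j) F"
proof -
  have "bounded_linear (\<lambda>A :: real^'m^'k. A $ i $ j)"
    by (intro linear_conv_bounded_linear[THEN iffD1] linearI) simp_all
  from bounded_linear.has_vector_derivative[OF this assms] show ?thesis
    by (simp add: has_real_derivative_iff_has_vector_derivative)
qed

lemma has_vector_derivative_vec_nth:
  fixes y :: "real \<Rightarrow> real^'k"
  assumes "(y has_vector_derivative y') F"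
  shows "((\<lambda>t. y t $ i) has_real_derivative y' $ i) F"
  using bounded_linear.has_vector_derivative[OF bounded_linear_vec_nth assms]
  by (simp add: has_real_derivative_iff_has_vector_derivative)

lemma abs_inner_matrix_vector_le:
  fixes A :: "real^'k^'k"
  shows "\<bar>y \<bullet> (A *v y)\<bar> \<le> (\<Sum>i\<in>UNIV. \<Sum>j\<in>UNIV. \<bar>A $ i $ j\<bar>) * (y \<bullet> y)"
proof -
  have "y \<bullet> (A *v y) = (\<Sum>i\<in>UNIV. \<Sum>j\<in>UNIV. A $ i $ j * (y $ i * y $ j))"
    by (simp add: inner_vec_def matrix_vector_mult_def sum_distrib_left mult_ac)
  also have "\<bar>\<dots>\<bar> \<le> (\<Sum>i\<in>UNIV. \<Sum>j\<in>UNIV. \<bar>A $ i $ j\<bar> * (y \<bullet> y))"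
  proof (intro order_trans[OF sum_abs] sum_mono)
    fix i j
    have "\<bar>y $ i\<bar> * \<bar>y $ j\<bar> \<le> norm y * norm y"
      by (intro mult_mono component_le_norm_cart) simp_all
    then show "\<bar>A $ i $ j * (y $ i * y $ j)\<bar> \<le> \<bar>A $ i $ j\<bar> * (y \<bullet> y)"
      by (simp add: abs_mult mult_left_mono dot_square_norm power2_eq_square)
  qed
  finally show ?thesis by (simp add: sum_distrib_right)
qed

text \<open>Gronwall: \<open>exp (c t) (y \<bullet> y)\<close> with \<open>c = 2 L\<close> or \<open>c = - 2 L\<close> is monotone when \<open>L\<close> bounds the norm of \<open>Q\<close>.\<close>
lemma linear_ode_zero:
  fixes y :: "real \<Rightarrow> real^'k" and Q :: "real \<Rightarrow> real^'k^'k"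
  assumes Q: "continuous_on {0..} Q"
    and y: "\<And>t. 0 \<le> t \<Longrightarrow> (y has_vector_derivative Q t *v y t) (at t within {0..})"
    and s: "0 \<le> s" "y s = 0" and t: "0 \<le> t"
  shows "y t = 0"
proof -
  define N where "N = max s t"
  \<comment> \<open>The sum of the absolute entries bounds the quadratic form and is visibly
    continuous, so it has a finite bound \<open>L\<close> on \<open>{0..N}\<close>, an interval
    containing both times.\<close>
  define q where "q u = (\<Sum>i\<in>UNIV. \<Sum>j\<in>UNIV. \<bar>Q u $ i $ j\<bar>)" for u
  have "continuous_on {0..N} Q" by (rule continuous_on_subset[OF Q]) auto
  then have "continuous_on {0..N} q" unfolding q_def by (intro continuous_intros)
  then have "compact (q ` {0..N})" by (intro compact_continuous_image) simp_all
  then obtain L where "\<forall>x\<in>q ` {0..N}. norm x \<le> L" using compact_imp_bounded bounded_iff by metis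
  then have L: "q u \<le> L" if "u \<in> {0..N}" for u
  proof -
    have "norm (q u) \<le> L" using \<open>\<forall>x\<in>q ` {0..N}. norm x \<le> L\<close> that by blast
    then show ?thesis by (auto simp: abs_le_iff)
  qed
  have ycont: "continuous_on {0..} y"
    unfolding continuous_on_eq_continuous_within using has_vector_derivative_continuous[OF y] by simp
  have der: "((\<lambda>u. exp (c * u) * (y u \<bullet> y u)) has_real_derivative exp (c * u) * (c * (y u \<bullet> y u) + 2 * (y u \<bullet> (Q u *v y u)))) (at u)"
    if "0 < u" for u c
  proof -
    have "(y has_vector_derivative Q u *v y u) (at u within {0..})" using y that by simp
    moreover have "at u within {0..} = at u" using that by (intro at_within_interior) auto
    ultimately have yu: "(y has_derivative (\<lambda>h. h *\<^sub>R (Q u *v y u))) (at u)" by (simp add: has_vector_derivative_def)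
    have "((\<lambda>u. exp (c * u) * (y u \<bullet> y u)) has_derivative
       (\<lambda>h. (exp (c * u) * (c * (y u \<bullet> y u) + 2 * (y u \<bullet> (Q u *v y u)))) * h)) (at u)"
      by (rule derivative_eq_intros yu refl | simp add: fun_eq_iff algebra_simps inner_commute)+
    then show ?thesis unfolding has_field_derivative_def .
  qed
  have bound: "\<bar>2 * (y u \<bullet> (Q u *v y u))\<bar> \<le> 2 * L * (y u \<bullet> y u)" if "u \<in> {0..N}" for u
  proof -
    have "\<bar>y u \<bullet> (Q u *v y u)\<bar> \<le> q u * (y u \<bullet> y u)" unfolding q_def by (rule abs_inner_matrix_vector_le)
    also have "\<dots> \<le> L * (y u \<bullet> y u)" by (intro mult_right_mono L that) simp
    finally show ?thesis by simp
  qed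
  have gcont: "continuous_on {a..b} (\<lambda>u. exp (c * u) * (y u \<bullet> y u))" if "0 \<le> a" for a b c
    by (intro continuous_intros continuous_on_subset[OF ycont]) (use that in auto)
  \<comment> \<open>Both time directions are treated, since \<open>E t s\<close> is considered for
    \<open>t < s\<close> too: the weight with \<open>- (2 * L)\<close> serves the forward case, that
    with \<open>2 * L\<close> the backward one.\<close>
  have "y t \<bullet> y t \<le> 0"
  proof (cases "s \<le> t")
    case True
    have "exp (- (2 * L) * t) * (y t \<bullet> y t) \<le> exp (- (2 * L) * s) * (y s \<bullet> y s)"
    proof (rule DERIV_nonpos_imp_decreasing_open[OF True, where f="\<lambda>u. exp (- (2 * L) * u) * (y u \<bullet> y u)"])
      fix u assume u: "s < u" "u < t"
      have u0: "0 < u" using u s(1) by simp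
      have "- (2 * L) * (y u \<bullet> y u) + 2 * (y u \<bullet> (Q u *v y u)) \<le> 0"
        using bound[of u] u s(1) by (auto simp: N_def abs_le_iff)
      then have "exp (- (2 * L) * u) * (- (2 * L) * (y u \<bullet> y u) + 2 * (y u \<bullet> (Q u *v y u))) \<le> 0"
        by (rule mult_nonneg_nonpos[OF exp_ge_zero])
      with der[OF u0] show "\<exists>y'. ((\<lambda>u. exp (- (2 * L) * u) * (y u \<bullet> y u)) has_real_derivative y') (at u) \<and> y' \<le> 0"
        by blast
    qed (rule gcont[OF s(1)])
    then show ?thesis using s(2) by (simp add: mult_le_0_iff)
  next
    case False
    have "exp ((2 * L) * t) * (y t \<bullet> y t) \<le> exp ((2 * L) * s) * (y s \<bullet> y s)"
    proof (rule DERIV_nonneg_imp_increasing_open[where f="\<lambda>u. exp ((2 * L) * u) * (y u \<bullet> y u)"])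
      show "t \<le> s" using False by simp
      fix u assume u: "t < u" "u < s"
      have u0: "0 < u" using u t by simp
      have "0 \<le> (2 * L) * (y u \<bullet> y u) + 2 * (y u \<bullet> (Q u *v y u))"
        using bound[of u] u t by (auto simp: N_def abs_le_iff)
      then have "0 \<le> exp ((2 * L) * u) * ((2 * L) * (y u \<bullet> y u) + 2 * (y u \<bullet> (Q u *v y u)))"
        by (rule mult_nonneg_nonneg[OF exp_ge_zero])
      with der[OF u0] show "\<exists>y'. ((\<lambda>u. exp ((2 * L) * u) * (y u \<bullet> y u)) has_real_derivative y') (at u) \<and> 0 \<le> y'"
        by blast
    qed (rule gcont[OF t])
    then show ?thesis using s(2) by (simp add: mult_le_0_iff)
  qed
  then have "y t \<bullet> y t = 0" using inner_ge_zero[of "y t"] by linarith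
  then show ?thesis by simp
qed

lemma matrix_diff_ldistrib: "A ** (C - D) = A ** C - A ** D" for A :: "real^'m^'k"
  by (simp add: matrix_matrix_mult_def vec_eq_iff right_diff_distrib sum_subtractf)

lemma matrix_diff_rdistrib: "(A - C) ** D = A ** D - C ** D" for D :: "real^'m^'k"
  by (simp add: matrix_matrix_mult_def vec_eq_iff left_diff_distrib sum_subtractf)

text \<open>Divide \<open>N y - N x = - (N y ** (A y - A x) ** N x)\<close> by \<open>y - x\<close>
  and let \<open>y\<close> tend to \<open>x\<close>: the left factor converges by continuity of
  \<open>N\<close>, the middle one by differentiability of \<open>A\<close>.\<close>

lemma has_real_derivative_matrix_inverse:
  fixes A N :: "real \<Rightarrow> real^'k^'k"
  assumes A: "(A has_vector_derivative A') (at x within S)" and x: "x \<in> S"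
    and inv: "\<And>y. y \<in> S \<Longrightarrow> A y ** N y = mat 1" "\<And>y. y \<in> S \<Longrightarrow> N y ** A y = mat 1"
    and N: "continuous_on S N"
  shows "((\<lambda>y. N y $ i $ j) has_real_derivative (- (N x ** A' ** N x)) $ i $ j) (at x within S)"
  unfolding has_field_derivative_iff
proof -
  have Aent: "((\<lambda>y. (A y $ k $ l - A x $ k $ l) / (y - x)) \<longlongrightarrow> A' $ k $ l) (at x within S)" for k l
    using has_vector_derivative_entry[OF A] by (simp add: has_field_derivative_iff)
  have Nent: "((\<lambda>y. N y $ i $ k) \<longlongrightarrow> N x $ i $ k) (at x within S)" for k
    using N x by (intro tendsto_intros) (simp add: continuous_on_def)
  have "((\<lambda>y. - (\<Sum>l\<in>UNIV. (\<Sum>k\<in>UNIV. N y $ i $ k * ((A y $ k $ l - A x $ k $ l) / (y - x))) * N x $ l $ j))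
    \<longlongrightarrow> - (\<Sum>l\<in>UNIV. (\<Sum>k\<in>UNIV. N x $ i $ k * A' $ k $ l) * N x $ l $ j)) (at x within S)"
    by (intro tendsto_intros Aent Nent)
  moreover have "- (\<Sum>l\<in>UNIV. (\<Sum>k\<in>UNIV. N x $ i $ k * A' $ k $ l) * N x $ l $ j) = (- (N x ** A' ** N x)) $ i $ j"
    by (simp add: matrix_matrix_mult_def)
  moreover have "\<forall>\<^sub>F y in at x within S. - (\<Sum>l\<in>UNIV. (\<Sum>k\<in>UNIV. N y $ i $ k * ((A y $ k $ l - A x $ k $ l) / (y - x))) * N x $ l $ j)
     = (N y $ i $ j - N x $ i $ j) / (y - x)"
    unfolding eventually_at_filter
  proof (rule always_eventually, intro allI impI)
    fix y assume y: "y \<noteq> x" "y \<in> S"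
    have "N y ** (A y - A x) ** N x = (N y ** A y) ** N x - N y ** (A x ** N x)"
      by (simp add: matrix_diff_ldistrib matrix_diff_rdistrib matrix_mul_assoc)
    also have "\<dots> = N x - N y" using inv y x by simp
    finally have "(N y - N x) $ i $ j = - ((N y ** (A y - A x) ** N x) $ i $ j)" by simp
    then have "N y $ i $ j - N x $ i $ j = - (\<Sum>l\<in>UNIV. (\<Sum>k\<in>UNIV. N y $ i $ k * (A y $ k $ l - A x $ k $ l)) * N x $ l $ j)"
      by (simp add: matrix_matrix_mult_def)
    then show "- (\<Sum>l\<in>UNIV. (\<Sum>k\<in>UNIV. N y $ i $ k * ((A y $ k $ l - A x $ k $ l) / (y - x))) * N x $ l $ j)
     = (N y $ i $ j - N x $ i $ j) / (y - x)"
      by (simp add: sum_divide_distrib[symmetric])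
  qed
  ultimately show "((\<lambda>y. (N y $ i $ j - N x $ i $ j) / (y - x)) \<longlongrightarrow> (- (N x ** A' ** N x)) $ i $ j) (at x within S)"
    using Lim_transform_eventually by fastforce
qed

lemma continuous_on_det:
  fixes A :: "'a::topological_space \<Rightarrow> real^'k^'k"
  assumes "continuous_on S A"
  shows "continuous_on S (\<lambda>x. det (A x))"
  unfolding det_def using assms by (intro continuous_intros)

text \<open>Cramer's rule writes the entries of the inverse as quotients of determinants, which
  depend continuously on the entries of \<open>A\<close>; a right inverse already makes the
  denominator nonzero.\<close>

lemma continuous_on_matrix_inverse:
  fixes A N :: "'a::topological_space \<Rightarrow> real^'k^'k"
  assumes A: "continuous_on S A" and inv: "\<And>y. y \<in> S \<Longrightarrow> A y ** N y = mat 1"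
  shows "continuous_on S N"
proof -
  have det: "det (A y) \<noteq> 0" if "y \<in> S" for y
    using inv[OF that] by (metis det_I det_mul mult_zero_left zero_neq_one)
  define R where "R y k j = (\<chi> i l. if l = k then (axis j 1 :: real^'k) $ i else A y $ i $ l)" for y k j
  have N: "N y $ k $ j = det (R y k j) / det (A y)" if y: "y \<in> S" for y k j
  proof -
    have "A y *v (N y *v axis j 1) = axis j 1" by (simp add: matrix_vector_mul_assoc inv[OF y])
    then have "N y *v axis j 1 = (\<chi> k. det (\<chi> i l. if l = k then axis j 1 $ i else A y $ i $ l) / det (A y))"
      using cramer[OF det[OF y]] by blast
    then have "(N y *v axis j 1) $ k = det (R y k j) / det (A y)" by (simp add: R_def)
    then show ?thesis by (simp add: matrix_vector_mult_basis column_def)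
  qed
  have Rc: "continuous_on S (\<lambda>y. R y k j)" for k j
    unfolding R_def
  proof (intro continuous_on_vec_lambda)
    fix i l
    show "continuous_on S (\<lambda>y. if l = k then (axis j 1 :: real^'k) $ i else A y $ i $ l)"
      using A by (cases "l = k") (auto intro!: continuous_intros)
  qed
  have "continuous_on S (\<lambda>y. \<chi> k j. det (R y k j) / det (A y))"
    using det by (intro continuous_on_vec_lambda continuous_on_divide continuous_on_det A Rc) auto
  then show ?thesis by (rule continuous_on_eq) (simp add: vec_eq_iff N)
qed

section \<open>The evolution equation and variation of constants\<close>

locale evolution =
  fixes Q :: "real \<Rightarrow> real^'d^'d" and E :: "real \<Rightarrow> real \<Rightarrow> real^'d^'d"
  assumes Q_cont: "continuous_on {0..} Q" and evol: "evolution_matrices Q E"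
begin

lemma E_same: "0 \<le> s \<Longrightarrow> E s s = mat 1"
  using evol by (simp add: evolution_matrices_def)

lemma E_deriv: "0 \<le> s \<Longrightarrow> 0 \<le> t \<Longrightarrow> ((\<lambda>v. E v s) has_vector_derivative (Q t ** E t s)) (at t within {0..})"
  using evol by (simp add: evolution_matrices_def)

lemma E_cont: "0 \<le> s \<Longrightarrow> continuous_on {0..} (\<lambda>v. E v s)"
  unfolding continuous_on_eq_continuous_within using has_vector_derivative_continuous[OF E_deriv] by simp

text \<open>As functions of \<open>t\<close>, both sides applied to a vector solve the same linear
  equation and agree at \<open>t = s\<close>; uniqueness then covers all nonnegative times, before
  and after \<open>s\<close>.\<close>

lemma E_mult:
  assumes "0 \<le> t" "0 \<le> s" "0 \<le> r"
  shows "E t s ** E s r = E t r"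
proof -
  have "E t s *v (E s r *v x) - E t r *v x = 0" for x
  proof (rule linear_ode_zero[OF Q_cont _ assms(2) _ assms(1), where y="\<lambda>t. E t s *v (E s r *v x) - E t r *v x"])
    fix t :: real assume t: "0 \<le> t"
    have "((\<lambda>t. E t s *v (E s r *v x) - E t r *v x) has_vector_derivative
        (Q t ** E t s) *v (E s r *v x) - (Q t ** E t r) *v x) (at t within {0..})"
      by (intro has_vector_derivative_diff has_vector_derivative_matrix_vector_mult E_deriv assms t)
    then show "((\<lambda>t. E t s *v (E s r *v x) - E t r *v x) has_vector_derivative
        Q t *v (E t s *v (E s r *v x) - E t r *v x)) (at t within {0..})"
      by (simp add: matrix_vector_mul_assoc[symmetric] matrix_vector_mult_diff_distrib)
  qed (simp add: E_same assms)
  then have "(E t s ** E s r) *v x = E t r *v x" for x by (simp add: matrix_vector_mul_assoc)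
  then show ?thesis by (simp add: matrix_eq)
qed

lemma E_inverse: "0 \<le> t \<Longrightarrow> E t 0 ** E 0 t = mat 1" "0 \<le> t \<Longrightarrow> E 0 t ** E t 0 = mat 1"
  by (simp_all add: E_mult E_same)

lemma E0_cont: "continuous_on {0..} (E 0)"
  by (rule continuous_on_matrix_inverse[OF E_cont[of 0]]) (simp_all add: E_inverse)

text \<open>The defining equation differentiates in the first argument. The derivative in the second
  one comes from reading \<open>E 0 v\<close> as the inverse of \<open>E v 0\<close>.\<close>

lemma E0_deriv:
  assumes "0 \<le> t"
  shows "((\<lambda>v. E 0 v $ i $ j) has_real_derivative - ((E 0 t ** Q t) $ i $ j)) (at t within {0..})"
proof -
  have "((\<lambda>v. E 0 v $ i $ j) has_real_derivative (- (E 0 t ** (Q t ** E t 0) ** E 0 t)) $ i $ j) (at t within {0..})"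
    by (rule has_real_derivative_matrix_inverse[OF E_deriv]) (use assms E0_cont E_inverse in auto)
  moreover have "E 0 t ** (Q t ** E t 0) ** E 0 t = E 0 t ** Q t"
    using E_inverse(1)[OF assms] by (simp add: matrix_mul_assoc[symmetric])
  ultimately show ?thesis by simp
qed

text \<open>Neither \<open>Z\<close> nor \<open>I\<close> need be differentiable, but
  \<open>Z - I\<close> is a constant plus an ordinary integral, so the product rule applies to
  \<open>E 0 u *v (Z u - I u)\<close>. What remains of \<open>I\<close> is a boundary term and an
  ordinary integral, the shape that integration by parts produces for a Wiener integral.\<close>

lemma variation_of_constants:
  fixes Z I :: "real \<Rightarrow> real^'d"
  assumes r: "continuous_on {0..} r" and Z: "continuous_on {0..} Z" and I: "continuous_on {0..} I"
    and eq: "\<And>t. 0 \<le> t \<Longrightarrow> Z t = a + integral {0..t} (\<lambda>s. Q s *v Z s + r s) + I t" and t: "0 \<le> t"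
  shows "E 0 t *v Z t = a + integral {0..t} (\<lambda>u. E 0 u *v r u) + E 0 t *v I t + integral {0..t} (\<lambda>u. (E 0 u ** Q u) *v I u)"
proof -
  define Y where "Y u = a + integral {0..u} (\<lambda>s. Q s *v Z s + r s)" for u
  have YZ: "Y u = Z u - I u" if "0 \<le> u" for u using eq[OF that] by (simp add: Y_def)
  have sub: "continuous_on {0..t} f" if "continuous_on {0..} f" for f :: "real \<Rightarrow> 'z::topological_space"
    by (rule continuous_on_subset[OF that]) auto
  note c = sub[OF r] sub[OF Z] sub[OF I] sub[OF Q_cont] sub[OF E0_cont]
  have Yd: "(Y has_vector_derivative Q u *v Z u + r u) (at u within {0..t})" if "u \<in> {0..t}" for u
    unfolding Y_def
    by (rule derivative_eq_intros integral_has_vector_derivative[OF _ that] continuous_intros c | simp)+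
  define f where "f u = (E 0 u ** Q u) *v I u + E 0 u *v r u" for u
  have fc: "continuous_on {0..t} f" unfolding f_def by (intro continuous_intros c)
  have comp: "((\<lambda>u. f u $ i) has_integral (E 0 t *v Y t - E 0 0 *v Y 0) $ i) {0..t}" for i
  proof -
    have "((\<lambda>u. (E 0 u *v Y u) $ i) has_real_derivative f u $ i) (at u within {0..t})" if u: "u \<in> {0..t}" for u
    proof -
      have E: "((\<lambda>v. E 0 v $ i $ j) has_real_derivative - ((E 0 u ** Q u) $ i $ j)) (at u within {0..t})" for j
        by (rule DERIV_subset[OF E0_deriv]) (use u in auto)
      have Yj: "((\<lambda>v. Y v $ j) has_real_derivative (Q u *v Z u + r u) $ j) (at u within {0..t})" for j
        by (rule has_vector_derivative_vec_nth[OF Yd[OF u]])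
      have "((\<lambda>u. \<Sum>j\<in>UNIV. E 0 u $ i $ j * Y u $ j) has_real_derivative
          (\<Sum>j\<in>UNIV. - ((E 0 u ** Q u) $ i $ j) * Y u $ j + E 0 u $ i $ j * (Q u *v Z u + r u) $ j)) (at u within {0..t})"
        by (rule derivative_eq_intros E Yj refl | simp add: mult.commute add.commute)+
      also have "(\<Sum>j\<in>UNIV. - ((E 0 u ** Q u) $ i $ j) * Y u $ j + E 0 u $ i $ j * (Q u *v Z u + r u) $ j)
          = (- ((E 0 u ** Q u) *v Y u) + E 0 u *v (Q u *v Z u + r u)) $ i"
        by (simp add: matrix_vector_mult_def sum.distrib sum_negf sum_subtractf)
      also have "- ((E 0 u ** Q u) *v Y u) + E 0 u *v (Q u *v Z u + r u) = f u"
        using u by (simp add: YZ f_def matrix_vector_mul_assoc matrix_vector_mult_diff_distrib matrix_vector_right_distrib)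
      finally show ?thesis by (simp add: matrix_vector_mult_def)
    qed
    from fundamental_theorem_of_calculus[OF t, of "\<lambda>u. (E 0 u *v Y u) $ i" "\<lambda>u. f u $ i"] this
    show ?thesis by (simp add: has_real_derivative_iff_has_vector_derivative)
  qed
  have int: "integral {0..t} f = E 0 t *v Y t - E 0 0 *v Y 0"
    using integral_unique[OF comp] integrable_continuous_interval[OF fc] by (simp add: vec_eq_iff)
  have "Y 0 = a" by (simp add: Y_def)
  then have "E 0 t *v Y t = a + integral {0..t} f" using int by (simp add: E_same)
  also have "integral {0..t} f = integral {0..t} (\<lambda>u. (E 0 u ** Q u) *v I u) + integral {0..t} (\<lambda>u. E 0 u *v r u)"
    unfolding f_def by (intro Henstock_Kurzweil_Integration.integral_add integrable_continuous_interval continuous_intros c)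
  finally show ?thesis using YZ[OF t] by (simp add: matrix_vector_mult_diff_distrib algebra_simps)
qed

end

section \<open>Linear processes\<close>

lemma L2_fun_continuous:
  fixes f :: "real \<Rightarrow> real^'p"
  assumes f: "continuous_on {0..t} f"
  shows "L2_fun (\<lambda>u. indicator {0<..t} u *\<^sub>R f u)"
proof -
  have "continuous_on {0<..t} f" by (rule continuous_on_subset[OF f]) auto
  then have m: "(\<lambda>u. indicator {0<..t} u *\<^sub>R f u) \<in> borel_measurable borel"
    by (intro borel_measurable_continuous_on_indicator) auto
  have "set_integrable lborel {0..t} (\<lambda>u. f u \<bullet> f u)"
    by (intro borel_integrable_atLeastAtMost' continuous_intros f)
  then have "set_integrable lborel {0<..t} (\<lambda>u. f u \<bullet> f u)"
    by (rule set_integrable_subset) auto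
  then have "integrable lborel (\<lambda>u. indicator {0<..t} u *\<^sub>R (f u \<bullet> f u))"
    by (simp add: set_integrable_def)
  moreover have "(\<lambda>u. indicator {0<..t} u *\<^sub>R (f u \<bullet> f u)) = (\<lambda>u. (indicator {0<..t} u *\<^sub>R f u) \<bullet> (indicator {0<..t} u *\<^sub>R f u))"
    by (auto simp: indicator_def)
  ultimately show ?thesis using m by (simp add: L2_fun_def)
qed

text \<open>Uniform continuity as an oscillation bound on all cells of the equidistant grid at once;
  it is applied to a path for the sums and to \<open>\<psi>\<close> for the integrands.\<close>

lemma uniform_grid:
  fixes f :: "real \<Rightarrow> real"
  assumes f: "continuous_on {0..t} f" and "0 \<le> t" "0 < \<epsilon>"
  obtains n0 where "\<And>n k u v. n0 \<le> n \<Longrightarrow> k < Suc n \<Longrightarrow>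
    u \<in> {t * real k / real (Suc n)..t * real (Suc k) / real (Suc n)} \<Longrightarrow>
    v \<in> {t * real k / real (Suc n)..t * real (Suc k) / real (Suc n)} \<Longrightarrow> \<bar>f u - f v\<bar> \<le> \<epsilon>"
proof -
  have "uniformly_continuous_on {0..t} f" by (rule compact_uniformly_continuous[OF f]) simp
  then obtain \<delta> where \<delta>: "0 < \<delta>" "\<And>u v. u \<in> {0..t} \<Longrightarrow> v \<in> {0..t} \<Longrightarrow> dist v u < \<delta> \<Longrightarrow> dist (f v) (f u) < \<epsilon>"
    using assms(3) unfolding uniformly_continuous_on_def by metis
  obtain n0 :: nat where n0: "t / \<delta> < real n0" using reals_Archimedean2 by blast
  show thesis
  proof (rule that[of n0])
    fix n k u v
    assume n: "n0 \<le> n" and k: "k < Suc n"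
      and u: "u \<in> {t * real k / real (Suc n)..t * real (Suc k) / real (Suc n)}"
      and v: "v \<in> {t * real k / real (Suc n)..t * real (Suc k) / real (Suc n)}"
    have "t / \<delta> < real (Suc n)" using n0 n by linarith
    then have h: "t / real (Suc n) < \<delta>" using \<delta>(1) by (simp add: divide_less_eq mult.commute del: of_nat_Suc)
    have "t * real (Suc k) / real (Suc n) = t * real k / real (Suc n) + t / real (Suc n)"
    proof -
      have "real (Suc k) = real k + 1" by simp
      then show ?thesis by (simp only: distrib_left mult_1_right add_divide_distrib)
    qed
    then have d: "dist v u < \<delta>" using u v h by (auto simp: dist_real_def)
    have "0 \<le> t * real k / real (Suc n)" using assms(2) by simp
    moreover have "t * real (Suc k) / real (Suc n) \<le> t"
      using k assms(2) by (simp add: divide_le_eq mult_left_mono del: of_nat_Suc)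
    ultimately have "u \<in> {0..t}" "v \<in> {0..t}" using u v by auto
    from \<delta>(2)[OF this d] show "\<bar>f u - f v\<bar> \<le> \<epsilon>" by (simp add: dist_real_def)
  qed
qed

text \<open>Summation by parts puts the increments on the differentiable \<open>\<psi>\<close>,
  because \<open>x\<close>, which will be a path, is only continuous. On each cell the increment of
  \<open>\<psi>\<close> times the right endpoint value of \<open>x\<close> is compared with the
  integral of \<open>\<psi>' u * x u\<close>.\<close>

lemma stieltjes_sum_limit:
  fixes \<psi> \<psi>' x :: "real \<Rightarrow> real"
  assumes t: "0 \<le> t" and \<psi>: "\<And>u. u \<in> {0..t} \<Longrightarrow> (\<psi> has_real_derivative \<psi>' u) (at u within {0..t})"
    and \<psi>': "continuous_on {0..t} \<psi>'" and x: "continuous_on {0..t} x"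
  shows "(\<lambda>n. \<Sum>k<Suc n. \<psi> (t * real k / real (Suc n)) * (x (t * real (Suc k) / real (Suc n)) - x (t * real k / real (Suc n))))
    \<longlonglongrightarrow> \<psi> t * x t - \<psi> 0 * x 0 - integral {0..t} (\<lambda>u. \<psi>' u * x u)"
proof (rule LIMSEQ_I)
  fix e :: real assume e: "0 < e"
  have "compact (\<psi>' ` {0..t})" by (intro compact_continuous_image \<psi>') simp
  then obtain K where "\<forall>y\<in>\<psi>' ` {0..t}. norm y \<le> K" using compact_imp_bounded bounded_iff by metis
  then have K: "\<bar>\<psi>' u\<bar> \<le> K" if "u \<in> {0..t}" for u using that by auto
  have K0: "0 \<le> K" using K[of 0] t by auto
  \<comment> \<open>The cell errors add up to at most \<open>K * \<epsilon> * t\<close>; the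
    \<open>+ 1\<close> keeps the denominator positive when \<open>K * t = 0\<close>.\<close>
  define \<epsilon> where "\<epsilon> = e / (K * t + 1)"
  have Kt: "0 \<le> K * t" using K0 t by simp
  have \<epsilon>: "0 < \<epsilon>" "K * \<epsilon> * t < e"
  proof -
    show "0 < \<epsilon>" unfolding \<epsilon>_def using e Kt by simp
    have "K * \<epsilon> * t = e * (K * t / (K * t + 1))" by (simp add: \<epsilon>_def)
    also have "\<dots> < e * 1" by (rule mult_strict_left_mono) (use e Kt in auto)
    finally show "K * \<epsilon> * t < e" by simp
  qed
  obtain n0 where n0: "\<And>n k u v. n0 \<le> n \<Longrightarrow> k < Suc n \<Longrightarrow>
    u \<in> {t * real k / real (Suc n)..t * real (Suc k) / real (Suc n)} \<Longrightarrow>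
    v \<in> {t * real k / real (Suc n)..t * real (Suc k) / real (Suc n)} \<Longrightarrow> \<bar>x u - x v\<bar> \<le> \<epsilon>"
    by (rule uniform_grid[OF x t \<epsilon>(1)]) blast
  show "\<exists>n0. \<forall>n\<ge>n0. norm ((\<Sum>k<Suc n. \<psi> (t * real k / real (Suc n)) * (x (t * real (Suc k) / real (Suc n)) - x (t * real k / real (Suc n))))
    - (\<psi> t * x t - \<psi> 0 * x 0 - integral {0..t} (\<lambda>u. \<psi>' u * x u))) < e"
  proof (intro exI[of _ n0] allI impI)
    fix n assume n: "n0 \<le> n"
    define s where "s k = t * real k / real (Suc n)" for k
    have s0: "s 0 = 0" and st: "s (Suc n) = t" by (simp_all add: s_def del: of_nat_Suc)
    have sh: "s (Suc k) - s k = t / real (Suc n)" for k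
      by (simp add: s_def diff_divide_distrib[symmetric] right_diff_distrib[symmetric])
    have sle: "s k \<le> s (Suc k)" for k
    proof -
      have "0 \<le> t / real (Suc n)" using t by simp
      then show ?thesis using sh[of k] by linarith
    qed
    have s_in: "{s k..s (Suc k)} \<subseteq> {0..t}" if "k < Suc n" for k
    proof -
      have "0 \<le> s k" using t by (simp add: s_def)
      moreover have "s (Suc k) \<le> t" unfolding s_def
        using that t by (simp add: divide_le_eq mult_left_mono del: of_nat_Suc)
      ultimately show ?thesis by auto
    qed
    define P where "P u = integral {0..u} (\<lambda>u. \<psi>' u * x u)" for u
    have Pd: "(P has_real_derivative \<psi>' u * x u) (at u within {0..t})" if "u \<in> {0..t}" for u
      unfolding P_def has_real_derivative_iff_has_vector_derivative
      by (intro integral_has_vector_derivative continuous_intros \<psi>' x that)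
    have step: "\<bar>(P (s (Suc k)) - P (s k)) - (\<psi> (s (Suc k)) - \<psi> (s k)) * x (s (Suc k))\<bar> \<le> (K * \<epsilon>) * (t / real (Suc n))"
      if k: "k < Suc n" for k
    proof -
      define c where "c = x (s (Suc k))"
      \<comment> \<open>Mean value inequality on the cell for \<open>P u - \<psi> u * c\<close>: its
        derivative \<open>\<psi>' u * (x u - c)\<close> is at most \<open>K * \<epsilon>\<close> in
        absolute value.\<close>
      have "norm ((P (s (Suc k)) - \<psi> (s (Suc k)) * c) - (P (s k) - \<psi> (s k) * c)) \<le> (K * \<epsilon>) * norm (s (Suc k) - s k)"
      proof (rule field_differentiable_bound[where S="{s k..s (Suc k)}" and f="\<lambda>u. P u - \<psi> u * c" and f'="\<lambda>u. \<psi>' u * x u - \<psi>' u * c"])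
        fix u assume u: "u \<in> {s k..s (Suc k)}"
        then have ut: "u \<in> {0..t}" using s_in[OF k] by auto
        have "((\<lambda>u. P u - \<psi> u * c) has_real_derivative \<psi>' u * x u - \<psi>' u * c) (at u within {0..t})"
          by (rule derivative_eq_intros Pd \<psi> ut refl | simp)+
        then show "((\<lambda>u. P u - \<psi> u * c) has_real_derivative \<psi>' u * x u - \<psi>' u * c) (at u within {s k..s (Suc k)})"
          by (rule DERIV_subset) (rule s_in[OF k])
        have "\<bar>x u - c\<bar> \<le> \<epsilon>" unfolding c_def
          by (rule n0[OF n k]) (use u sle[of k] in \<open>auto simp: s_def\<close>)
        then have "\<bar>\<psi>' u\<bar> * \<bar>x u - c\<bar> \<le> K * \<epsilon>" using K[OF ut] K0 by (intro mult_mono) auto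
        then show "norm (\<psi>' u * x u - \<psi>' u * c) \<le> K * \<epsilon>" by (simp add: right_diff_distrib[symmetric] abs_mult)
      qed (use sle[of k] in auto)
      then show ?thesis using sh[of k] t by (simp add: c_def algebra_simps del: of_nat_Suc)
    qed
    have tel: "(\<Sum>k<Suc n. f (s (Suc k)) - f (s k)) = f t - f 0" for f :: "real \<Rightarrow> real"
      using sum_lessThan_telescope[of "\<lambda>k. f (s k)" "Suc n"] by (simp only: s0 st)
    have "(\<Sum>k<Suc n. \<psi> (s k) * (x (s (Suc k)) - x (s k))) - (\<psi> t * x t - \<psi> 0 * x 0 - (P t - P 0))
      = (\<Sum>k<Suc n. \<psi> (s k) * (x (s (Suc k)) - x (s k)))
        - ((\<Sum>k<Suc n. \<psi> (s (Suc k)) * x (s (Suc k)) - \<psi> (s k) * x (s k)) - (\<Sum>k<Suc n. P (s (Suc k)) - P (s k)))"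
      unfolding tel[of P] tel[of "\<lambda>u. \<psi> u * x u"] ..
    also have "\<dots> = (\<Sum>k<Suc n. (P (s (Suc k)) - P (s k)) - (\<psi> (s (Suc k)) - \<psi> (s k)) * x (s (Suc k)))"
      unfolding sum_subtractf[symmetric] by (intro sum.cong refl) (simp add: algebra_simps)
    also have "\<bar>\<dots>\<bar> \<le> (\<Sum>k<Suc n. (K * \<epsilon>) * (t / real (Suc n)))"
      by (rule order_trans[OF sum_abs sum_mono]) (use step in auto)
    also have "\<dots> = K * \<epsilon> * t" by (simp del: of_nat_Suc)
    also have "\<dots> < e" by (rule \<epsilon>(2))
    finally show "norm ((\<Sum>k<Suc n. \<psi> (t * real k / real (Suc n)) * (x (t * real (Suc k) / real (Suc n)) - x (t * real k / real (Suc n))))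
    - (\<psi> t * x t - \<psi> 0 * x 0 - integral {0..t} (\<lambda>u. \<psi>' u * x u))) < e"
      by (simp add: s_def P_def del: sum.lessThan_Suc of_nat_Suc)
  qed
qed

context wiener
begin

text \<open>
  The Riemann-Stieltjes sums of \<open>\<psi>\<close> against \<open>X\<close> converge along almost every path, and their integrands
  converge in \<open>L\<^sup>2\<close>.
\<close>
lemma wiener_integral_by_parts:
  fixes g :: "real \<Rightarrow> real^'p" and X :: "real \<Rightarrow> 'w \<Rightarrow> real"
  assumes t: "0 \<le> t" and X: "\<And>u. u \<in> {0..t} \<Longrightarrow> wiener_integral M B (\<lambda>v. indicator {0<..u} v *\<^sub>R g v) (X u)"
    and Xc: "AE \<omega> in M. continuous_on {0..t} (\<lambda>u. X u \<omega>)"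
    and \<psi>: "\<And>u. u \<in> {0..t} \<Longrightarrow> (\<psi> has_real_derivative \<psi>' u) (at u within {0..t})"
    and \<psi>': "continuous_on {0..t} \<psi>'"
  obtains Y where "wiener_integral M B (\<lambda>u. indicator {0<..t} u *\<^sub>R (\<psi> u *\<^sub>R g u)) Y"
    "AE \<omega> in M. Y \<omega> = \<psi> t * X t \<omega> - integral {0..t} (\<lambda>u. \<psi>' u * X u \<omega>)"
proof -
  define s where "s n k = t * real k / real (Suc n)" for n k
  define S where "S n \<omega> = (\<Sum>k<Suc n. \<psi> (s n k) * (X (s n (Suc k)) \<omega> - X (s n k) \<omega>))" for n \<omega>
  define f where "f n u = (\<Sum>k<Suc n. \<psi> (s n k) *\<^sub>R (indicator {0<..s n (Suc k)} u *\<^sub>R g u - indicator {0<..s n k} u *\<^sub>R g u))" for n u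
  define g1 where "g1 u = indicator {0<..t} u *\<^sub>R g u" for u
  define h where "h u = indicator {0<..t} u *\<^sub>R (\<psi> u *\<^sub>R g u)" for u
  have s_in: "s n k \<in> {0..t}" if "k \<le> Suc n" for n k
    using that t unfolding s_def by (simp add: divide_le_eq mult_left_mono del: of_nat_Suc)
  have s_le: "s n k \<le> s n (Suc k)" for n k
    unfolding s_def using t by (intro divide_right_mono mult_left_mono) auto
  have S: "wiener_integral M B (f n) (S n)" for n
    unfolding f_def[abs_def] S_def[abs_def]
    by (intro wiener_integral_sum wiener_integral_scale wiener_integral_diff X s_in) auto
  have \<psi>c: "continuous_on {0..t} \<psi>"
    using DERIV_continuous_on[OF \<psi>] .
  have Lg: "L2_fun g1" unfolding g1_def using wiener_integral_L2[OF X[of t]] t by simp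
  have Lh: "L2_fun h"
  proof -
    have "(\<lambda>u. indicator {0..t} u *\<^sub>R \<psi> u) \<in> borel_measurable borel"
      by (intro borel_measurable_continuous_on_indicator \<psi>c) auto
    moreover have [measurable]: "g1 \<in> borel_measurable borel" using Lg by (simp add: L2_fun_def)
    ultimately have "(\<lambda>u. (indicator {0..t} u *\<^sub>R \<psi> u) *\<^sub>R g1 u) \<in> borel_measurable borel" by measurable
    moreover have h: "h = (\<lambda>u. (indicator {0..t} u *\<^sub>R \<psi> u) *\<^sub>R g1 u)" by (auto simp: h_def g1_def indicator_def)
    ultimately have [measurable]: "h \<in> borel_measurable borel" by simp
    have "compact (\<psi> ` {0..t})" by (intro compact_continuous_image \<psi>c) simp
    then obtain K where "\<forall>y\<in>\<psi> ` {0..t}. norm y \<le> K" using compact_imp_bounded bounded_iff by metis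
    then have K: "\<bar>\<psi> u\<bar> \<le> K" if "u \<in> {0..t}" for u using that by auto
    have "integrable lborel (\<lambda>u. h u \<bullet> h u)"
    proof (rule Bochner_Integration.integrable_bound)
      show "integrable lborel (\<lambda>u. K\<^sup>2 * (g1 u \<bullet> g1 u))" using Lg by (simp add: L2_fun_inner)
      have "h u \<bullet> h u \<le> K\<^sup>2 * (g1 u \<bullet> g1 u)" for u
      proof (cases "u \<in> {0<..t}")
        case True
        then have "(\<psi> u)\<^sup>2 \<le> K\<^sup>2" using K[of u] by (intro abs_le_square_iff[THEN iffD1]) auto
        then have "(\<psi> u)\<^sup>2 * (g u \<bullet> g u) \<le> K\<^sup>2 * (g u \<bullet> g u)" by (intro mult_right_mono) simp_all
        then show ?thesis using True by (simp add: h_def g1_def power2_eq_square mult.assoc)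
      qed (simp add: h_def)
      then show "AE u in lborel. norm (h u \<bullet> h u) \<le> norm (K\<^sup>2 * (g1 u \<bullet> g1 u))" by simp
    qed measurable
    then show ?thesis by (simp add: L2_fun_def)
  qed
  have f_lim: "(\<lambda>n. \<integral>u. (f n u - h u) \<bullet> (f n u - h u) \<partial>lborel) \<longlonglongrightarrow> 0"
  proof (rule LIMSEQ_I)
    fix e :: real assume e: "0 < e"
    define C where "C = (\<integral>u. g1 u \<bullet> g1 u \<partial>lborel)"
    have C: "0 \<le> C" by (simp add: C_def)
    \<comment> \<open>The squared distance will be at most \<open>\<epsilon>\<^sup>2 * C\<close>,
      hence the square root; the \<open>+ 1\<close> covers \<open>C = 0\<close>.\<close>
    define \<epsilon> where "\<epsilon> = sqrt (e / (C + 1))"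
    have \<epsilon>: "0 < \<epsilon>" "\<epsilon>\<^sup>2 * C < e"
    proof -
      show "0 < \<epsilon>" unfolding \<epsilon>_def using e C by simp
      have "\<epsilon>\<^sup>2 * C = e * (C / (C + 1))" unfolding \<epsilon>_def using e C by simp
      also have "\<dots> < e * 1" by (rule mult_strict_left_mono) (use e C in auto)
      finally show "\<epsilon>\<^sup>2 * C < e" by simp
    qed
    obtain n0 where n0: "\<And>n k u v. n0 \<le> n \<Longrightarrow> k < Suc n \<Longrightarrow>
      u \<in> {t * real k / real (Suc n)..t * real (Suc k) / real (Suc n)} \<Longrightarrow>
      v \<in> {t * real k / real (Suc n)..t * real (Suc k) / real (Suc n)} \<Longrightarrow> \<bar>\<psi> u - \<psi> v\<bar> \<le> \<epsilon>"
      by (rule uniform_grid[OF \<psi>c t \<epsilon>(1)]) blast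
    show "\<exists>n0. \<forall>n\<ge>n0. norm ((\<integral>u. (f n u - h u) \<bullet> (f n u - h u) \<partial>lborel) - 0) < e"
    proof (intro exI[of _ n0] allI impI)
      fix n assume n: "n0 \<le> n"
      \<comment> \<open>The integrand of the sum differs from \<open>h\<close> by the scalar
        \<open>d\<close> times \<open>g1\<close>, where \<open>d\<close> is the error of the
        left-endpoint step approximation of \<open>\<psi>\<close>; since its absolute value is at
        most \<open>\<epsilon>\<close>, the norm of \<open>g1\<close> controls the distance.\<close>
      define d where "d u = (\<Sum>k<Suc n. indicator {s n k<..s n (Suc k)} u * (\<psi> (s n k) - \<psi> u))" for u
      have ind: "indicator {0<..s n (Suc k)} u - indicator {0<..s n k} u = (indicator {s n k<..s n (Suc k)} u :: real)" if "k < Suc n" for k u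
        using s_le[of n k] s_in[of k n] that by (auto simp: indicator_def)
      have one: "(\<Sum>k<Suc n. indicator {s n k<..s n (Suc k)} u) = (indicator {0<..t} u :: real)" for u
      proof -
        have "(\<Sum>k<Suc n. indicator {s n k<..s n (Suc k)} u) = (\<Sum>k<Suc n. indicator {0<..s n (Suc k)} u - indicator {0<..s n k} u :: real)"
          by (intro sum.cong refl ind[symmetric]) simp
        also have "\<dots> = indicator {0<..s n (Suc n)} u - indicator {0<..s n 0} u"
          by (rule sum_lessThan_telescope)
        also have "\<dots> = indicator {0<..t} u" by (simp add: s_def del: of_nat_Suc)
        finally show ?thesis .
      qed
      have fh: "f n u - h u = d u *\<^sub>R g1 u" for u
      proof -
        have "f n u = (\<Sum>k<Suc n. indicator {s n k<..s n (Suc k)} u * \<psi> (s n k)) *\<^sub>R g u"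
          unfolding f_def scaleR_left.sum
          by (intro sum.cong refl) (simp add: scaleR_diff_left[symmetric] ind mult.commute)
        moreover have "h u = (\<Sum>k<Suc n. indicator {s n k<..s n (Suc k)} u * \<psi> u) *\<^sub>R g u"
          unfolding sum_distrib_right[symmetric] one h_def by simp
        ultimately have "f n u - h u = d u *\<^sub>R g u"
          by (simp only: d_def scaleR_diff_left[symmetric] sum_subtractf[symmetric] right_diff_distrib)
        moreover have "d u = indicator {0<..t} u * d u"
        proof (cases "u \<in> {0<..t}")
          case False
          then have "(\<Sum>k<Suc n. indicator {s n k<..s n (Suc k)} u) = (0::real)" using one[of u] by simp
          then have "\<forall>k\<in>{..<Suc n}. indicator {s n k<..s n (Suc k)} u = (0::real)"
            by (subst (asm) sum_nonneg_eq_0_iff) simp_all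
          then have "d u = 0" unfolding d_def by (intro sum.neutral) simp
          then show ?thesis by simp
        qed simp
        ultimately show ?thesis by (simp add: g1_def)
      qed
      have dle: "\<bar>d u\<bar> \<le> \<epsilon>" for u
      proof -
        have "\<bar>d u\<bar> \<le> (\<Sum>k<Suc n. indicator {s n k<..s n (Suc k)} u * \<epsilon>)"
          unfolding d_def
        proof (rule order_trans[OF sum_abs sum_mono])
          fix k assume "k \<in> {..<Suc n}"
          then have k: "k < Suc n" by simp
          have "\<bar>\<psi> (s n k) - \<psi> u\<bar> \<le> \<epsilon>" if "u \<in> {s n k<..s n (Suc k)}"
            using n0[OF n k, of "s n k" u] that s_le[of n k] by (auto simp: s_def)
          then show "\<bar>indicator {s n k<..s n (Suc k)} u * (\<psi> (s n k) - \<psi> u)\<bar> \<le> indicator {s n k<..s n (Suc k)} u * \<epsilon>"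
            by (auto simp: indicator_def)
        qed
        also have "\<dots> = indicator {0<..t} u * \<epsilon>" unfolding sum_distrib_right[symmetric] one ..
        also have "\<dots> \<le> \<epsilon>" using \<epsilon>(1) by (auto simp: indicator_def)
        finally show ?thesis .
      qed
      have "(\<integral>u. (f n u - h u) \<bullet> (f n u - h u) \<partial>lborel) \<le> (\<integral>u. \<epsilon>\<^sup>2 * (g1 u \<bullet> g1 u) \<partial>lborel)"
      proof (rule integral_mono)
        show "integrable lborel (\<lambda>u. (f n u - h u) \<bullet> (f n u - h u))"
          by (intro L2_fun_inner L2_fun_diff Lh wiener_integral_L2[OF S])
        show "integrable lborel (\<lambda>u. \<epsilon>\<^sup>2 * (g1 u \<bullet> g1 u))" using Lg by (simp add: L2_fun_inner)
        fix u
        have "(d u)\<^sup>2 \<le> \<epsilon>\<^sup>2" using dle[of u] by (intro abs_le_square_iff[THEN iffD1]) auto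
        then have "(d u)\<^sup>2 * (g1 u \<bullet> g1 u) \<le> \<epsilon>\<^sup>2 * (g1 u \<bullet> g1 u)" by (intro mult_right_mono) simp_all
        then show "(f n u - h u) \<bullet> (f n u - h u) \<le> \<epsilon>\<^sup>2 * (g1 u \<bullet> g1 u)"
          by (simp add: fh power2_eq_square mult.assoc)
      qed
      also have "\<dots> = \<epsilon>\<^sup>2 * C" by (simp add: C_def)
      also have "\<dots> < e" by (rule \<epsilon>(2))
      finally show "norm ((\<integral>u. (f n u - h u) \<bullet> (f n u - h u) \<partial>lborel) - 0) < e" by simp
    qed
  qed
  note Sm[measurable] = wiener_integral_measurable[OF S]
  \<comment> \<open>Taken as a limit of measurable sums, so that measurability is immediate; the
    explicit limit with the path integral agrees with it almost surely.\<close>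
  define Y0 where "Y0 \<omega> = lim (\<lambda>n. S n \<omega>)" for \<omega>
  have Y0m: "Y0 \<in> borel_measurable M" unfolding Y0_def by (rule borel_measurable_lim_metric) (rule Sm)
  have lim: "AE \<omega> in M. (\<lambda>n. S n \<omega>) \<longlonglongrightarrow> \<psi> t * X t \<omega> - \<psi> 0 * X 0 \<omega> - integral {0..t} (\<lambda>u. \<psi>' u * X u \<omega>)"
    using Xc
  proof eventually_elim
    case (elim \<omega>)
    show ?case unfolding S_def s_def by (rule stieltjes_sum_limit[OF t \<psi> \<psi>' elim])
  qed
  have lim': "AE \<omega> in M. (\<lambda>n. S n \<omega>) \<longlonglongrightarrow> Y0 \<omega>"
    using lim by eventually_elim (simp add: Y0_def limI)
  have W0: "wiener_integral M B h Y0"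
    by (rule wiener_integral_AE_limit[OF S Lh Y0m f_lim lim'])
  \<comment> \<open>\<open>X 0\<close> is a Wiener integral of the zero function, so adding
    \<open>\<psi> 0 * X 0\<close> removes the boundary term at 0 without changing the
    integrand.\<close>
  have X0: "wiener_integral M B (\<lambda>u. 0) (X 0)" using X[of 0] t by simp
  have "wiener_integral M B (\<lambda>u. h u + \<psi> 0 *\<^sub>R 0) (\<lambda>\<omega>. Y0 \<omega> + \<psi> 0 * X 0 \<omega>)"
    by (intro wiener_integral_add[OF W0] wiener_integral_scale[OF X0])
  then have "wiener_integral M B (\<lambda>u. indicator {0<..t} u *\<^sub>R (\<psi> u *\<^sub>R g u)) (\<lambda>\<omega>. Y0 \<omega> + \<psi> 0 * X 0 \<omega>)"
    by (simp add: h_def)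
  moreover have "AE \<omega> in M. Y0 \<omega> + \<psi> 0 * X 0 \<omega> = \<psi> t * X t \<omega> - integral {0..t} (\<lambda>u. \<psi>' u * X u \<omega>)"
    using lim lim' by eventually_elim (auto dest: LIMSEQ_unique)
  ultimately show thesis by (rule that)
qed

lemma has_ito_integral_continuous:
  fixes X :: "'w \<Rightarrow> real^'d" and G :: "real \<Rightarrow> real^'p^'d"
  assumes ito: "has_ito_integral M F B (\<lambda>u \<omega>. G u) t X" and G: "continuous_on {0..t} G"
  shows "wiener_integral M B (\<lambda>u. indicator {0<..t} u *\<^sub>R (G u $ a)) (\<lambda>\<omega>. X \<omega> $ a)"
  by (rule has_ito_integral_wiener_integral[OF ito])
     (auto intro!: borel_measurable_continuous_on_indicator L2_fun_continuous continuous_intros G)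

end

locale linear_sde = wiener M F B + evolution Q E
  for M :: "'w measure" and F and B :: "real \<Rightarrow> 'w \<Rightarrow> real^'p"
    and Q :: "real \<Rightarrow> real^'d^'d" and E :: "real \<Rightarrow> real \<Rightarrow> real^'d^'d" +
  fixes r :: "real \<Rightarrow> real^'d" and \<Sigma> :: "real \<Rightarrow> real^'p^'d"
  assumes r_cont: "continuous_on {0..} r" and \<Sigma>_cont: "continuous_on {0..} \<Sigma>"
begin

text \<open>Variation of constants leaves \<open>E 0 t *v I t\<close> plus the integral of
  \<open>(E 0 u ** Q u) *v I u\<close>. Entry by entry this is integration by parts with
  \<open>\<psi>\<close> an entry of \<open>E 0\<close>, whose derivative is minus the entry of
  \<open>E 0 u ** Q u\<close>; summing over \<open>j\<close> assembles row \<open>a\<close> of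
  \<open>E 0 u ** \<Sigma> u\<close>.\<close>

lemma linear_process_wiener_integral:
  assumes Z: "linear_process M F B Q r \<Sigma> x Z" and t: "0 \<le> t"
  shows "wiener_integral M B (\<lambda>u. indicator {0<..t} u *\<^sub>R ((E 0 u ** \<Sigma> u) $ a))
    (\<lambda>\<omega>. (E 0 t *v Z t \<omega> - x - integral {0..t} (\<lambda>u. E 0 u *v r u)) $ a)"
proof -
  obtain I where Zm: "\<And>t. 0 \<le> t \<Longrightarrow> Z t \<in> borel_measurable (F t)"
    and Zc: "AE \<omega> in M. continuous_on {0..} (\<lambda>t. Z t \<omega>)"
    and I: "\<And>t. 0 \<le> t \<Longrightarrow> has_ito_integral M F B (\<lambda>u \<omega>. \<Sigma> u) t (I t)"
    and Ic: "AE \<omega> in M. continuous_on {0..} (\<lambda>t. I t \<omega>)"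
    and eq: "AE \<omega> in M. \<forall>t\<ge>0. Z t \<omega> = x + integral {0..t} (\<lambda>s. Q s *v Z s \<omega> + r s) + I t \<omega>"
    using Z unfolding linear_process_def ito_integral_process_def by auto
  have sub: "continuous_on {0..t} f" if "continuous_on {0..} f" for f :: "real \<Rightarrow> 'z::topological_space" and t
    by (rule continuous_on_subset[OF that]) auto
  have Itj: "AE \<omega> in M. continuous_on {0..t} (\<lambda>u. I u \<omega> $ j)" for j
    using Ic by eventually_elim (intro continuous_intros sub)
  have "\<exists>Y. wiener_integral M B (\<lambda>u. indicator {0<..t} u *\<^sub>R (E 0 u $ a $ j *\<^sub>R \<Sigma> u $ j)) Y \<and>
     (AE \<omega> in M. Y \<omega> = E 0 t $ a $ j * I t \<omega> $ j - integral {0..t} (\<lambda>u. - ((E 0 u ** Q u) $ a $ j) * I u \<omega> $ j))" for j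
  proof (rule wiener_integral_by_parts[OF t, where g="\<lambda>u. \<Sigma> u $ j" and X="\<lambda>u \<omega>. I u \<omega> $ j"])
    show "wiener_integral M B (\<lambda>v. indicator {0<..u} v *\<^sub>R \<Sigma> v $ j) (\<lambda>\<omega>. I u \<omega> $ j)" if "u \<in> {0..t}" for u
      using that by (intro has_ito_integral_continuous I sub \<Sigma>_cont) auto
    show "AE \<omega> in M. continuous_on {0..t} (\<lambda>u. I u \<omega> $ j)" by (rule Itj)
    show "((\<lambda>v. E 0 v $ a $ j) has_real_derivative - ((E 0 u ** Q u) $ a $ j)) (at u within {0..t})" if "u \<in> {0..t}" for u
      by (rule DERIV_subset[OF E0_deriv]) (use that in auto)
    show "continuous_on {0..t} (\<lambda>u. - ((E 0 u ** Q u) $ a $ j))"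
      by (intro continuous_intros sub E0_cont Q_cont)
  qed blast
  from choice[OF allI[OF this]] obtain Y where
    YY: "\<forall>j. wiener_integral M B (\<lambda>u. indicator {0<..t} u *\<^sub>R (E 0 u $ a $ j *\<^sub>R \<Sigma> u $ j)) (Y j) \<and>
     (AE \<omega> in M. Y j \<omega> = E 0 t $ a $ j * I t \<omega> $ j - integral {0..t} (\<lambda>u. - ((E 0 u ** Q u) $ a $ j) * I u \<omega> $ j))" ..
  have Y: "wiener_integral M B (\<lambda>u. indicator {0<..t} u *\<^sub>R (E 0 u $ a $ j *\<^sub>R \<Sigma> u $ j)) (Y j)" for j
    using YY by blast
  have Yeq: "AE \<omega> in M. Y j \<omega> = E 0 t $ a $ j * I t \<omega> $ j - integral {0..t} (\<lambda>u. - ((E 0 u ** Q u) $ a $ j) * I u \<omega> $ j)" for j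
    using YY by blast
  have "wiener_integral M B (\<lambda>u. \<Sum>j\<in>UNIV. indicator {0<..t} u *\<^sub>R (E 0 u $ a $ j *\<^sub>R \<Sigma> u $ j)) (\<lambda>\<omega>. \<Sum>j\<in>UNIV. Y j \<omega>)"
    by (intro wiener_integral_sum Y)
  moreover have "(\<Sum>j\<in>UNIV. indicator {0<..t} u *\<^sub>R (E 0 u $ a $ j *\<^sub>R \<Sigma> u $ j)) = indicator {0<..t} u *\<^sub>R ((E 0 u ** \<Sigma> u) $ a)" for u
    by (simp add: vec_eq_iff matrix_matrix_mult_def sum_distrib_left)
  ultimately have W: "wiener_integral M B (\<lambda>u. indicator {0<..t} u *\<^sub>R ((E 0 u ** \<Sigma> u) $ a)) (\<lambda>\<omega>. \<Sum>j\<in>UNIV. Y j \<omega>)"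
    by simp
  show ?thesis
  proof (rule wiener_integral_cong_AE[OF W])
    have [measurable]: "Z t \<in> borel_measurable M" by (rule F_measurable[OF t Zm[OF t]])
    show "(\<lambda>\<omega>. (E 0 t *v Z t \<omega> - x - integral {0..t} (\<lambda>u. E 0 u *v r u)) $ a) \<in> borel_measurable M"
      by measurable
    have "AE \<omega> in M. \<forall>j\<in>UNIV. Y j \<omega> = E 0 t $ a $ j * I t \<omega> $ j - integral {0..t} (\<lambda>u. - ((E 0 u ** Q u) $ a $ j) * I u \<omega> $ j)"
      using Yeq by (intro AE_finite_allI) auto
    then show "AE \<omega> in M. (\<Sum>j\<in>UNIV. Y j \<omega>) = (E 0 t *v Z t \<omega> - x - integral {0..t} (\<lambda>u. E 0 u *v r u)) $ a"
      using Zc Ic eq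
    proof eventually_elim
      case (elim \<omega>)
      have "E 0 t *v Z t \<omega> = x + integral {0..t} (\<lambda>u. E 0 u *v r u) + E 0 t *v I t \<omega> + integral {0..t} (\<lambda>u. (E 0 u ** Q u) *v I u \<omega>)"
        using variation_of_constants[OF r_cont elim(2,3) _ t] elim(4) by blast
      then have "(E 0 t *v Z t \<omega> - x - integral {0..t} (\<lambda>u. E 0 u *v r u)) $ a =
          (E 0 t *v I t \<omega>) $ a + integral {0..t} (\<lambda>u. (E 0 u ** Q u) *v I u \<omega>) $ a" by simp
      also have "integral {0..t} (\<lambda>u. (E 0 u ** Q u) *v I u \<omega>) $ a = integral {0..t} (\<lambda>u. ((E 0 u ** Q u) *v I u \<omega>) $ a)"
        by (intro integral_component_eq_cart[symmetric] integrable_continuous_interval continuous_intros sub E0_cont Q_cont elim)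
      also have "\<dots> = integral {0..t} (\<lambda>u. \<Sum>j\<in>UNIV. (E 0 u ** Q u) $ a $ j * I u \<omega> $ j)"
        by (simp add: matrix_vector_mult_def)
      also have "\<dots> = (\<Sum>j\<in>UNIV. integral {0..t} (\<lambda>u. (E 0 u ** Q u) $ a $ j * I u \<omega> $ j))"
        by (intro Henstock_Kurzweil_Integration.integral_sum integrable_continuous_interval continuous_intros sub E0_cont Q_cont elim) simp
      finally show ?case using elim(1) by (simp add: matrix_vector_mult_def sum.distrib)
    qed
  qed
qed

end

section \<open>Means and covariances\<close>

lemma bounded_linear_matrix_mult:
  fixes A :: "real^'m^'k" and C :: "real^'l^'n"
  shows "bounded_linear (\<lambda>X :: real^'n^'m. A ** X ** C)"
  by (intro linear_conv_bounded_linear[THEN iffD1] linearI)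
     (simp_all add: vec_eq_iff matrix_matrix_mult_def sum.distrib distrib_left distrib_right sum_distrib_left sum_distrib_right mult_ac)

lemma integral_matrix_mult:
  fixes A :: "real^'m^'k" and C :: "real^'l^'n" and f :: "real \<Rightarrow> real^'n^'m"
  assumes "continuous_on {a..b} f"
  shows "integral {a..b} (\<lambda>u. A ** f u ** C) = A ** integral {a..b} f ** C"
  using integral_linear[OF integrable_continuous_interval[OF assms] bounded_linear_matrix_mult[of A C]]
  by (simp add: comp_def)

lemma integral_matrix_vector_mult:
  fixes A :: "real^'m^'k" and f :: "real \<Rightarrow> real^'m"
  assumes "continuous_on {a..b} f"
  shows "integral {a..b} (\<lambda>u. A *v f u) = A *v integral {a..b} f"
  using integral_linear[OF integrable_continuous_interval[OF assms] matrix_vector_mul_bounded_linear[of A]]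
  by (simp add: comp_def)

lemma integral_entry:
  fixes f :: "real \<Rightarrow> real^'m^'k"
  assumes "continuous_on {a..b} f"
  shows "integral {a..b} f $ i $ j = integral {a..b} (\<lambda>u. f u $ i $ j)"
proof -
  have "continuous_on {a..b} (\<lambda>u. f u $ i)" using assms by (intro continuous_intros)
  then show ?thesis
    using integrable_continuous_interval[OF assms] integrable_continuous_interval[of a b "\<lambda>u. f u $ i"]
      integral_linear[OF integrable_continuous_interval[OF assms] bounded_linear_vec_nth[of i]]
    by (simp add: comp_def)
qed

lemma pos_definite_invertible:
  fixes A :: "real^'k^'k"
  assumes "pos_definite A"
  shows "invertible A"
proof -
  have "x = 0" if "A *v x = 0" for x
    using assms that unfolding pos_definite_def by (metis inner_zero_right less_irrefl)
  then show ?thesis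
    by (simp add: invertible_left_inverse matrix_left_invertible_ker)
qed

lemma matrix_inv_eqI:
  fixes A :: "real^'k^'k"
  assumes "A ** C = mat 1"
  shows "matrix_inv A = C"
proof -
  have "invertible A" using assms invertible_right_inverse by blast
  then have "matrix_inv A ** (A ** C) = C" by (simp add: matrix_mul_assoc matrix_inv_mult)
  then show ?thesis by (simp add: assms)
qed

lemma transpose_diff: "transpose (A - C) = transpose A - transpose C"
  by (simp add: transpose_def vec_eq_iff)

lemma transpose_integral:
  fixes f :: "real \<Rightarrow> real^'m^'k"
  assumes "continuous_on {a..b} f"
  shows "transpose (integral {a..b} f) = integral {a..b} (\<lambda>u. transpose (f u))"
proof -
  have "continuous_on {a..b} (\<lambda>u. transpose (f u))" by (intro continuous_intros assms)
  then show ?thesis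
    using integral_entry[OF assms] by (simp add: vec_eq_iff integral_entry transpose_def)
qed

text \<open>The product of the cut-offs lives on \<open>{0<..min s t}\<close>, and the missing
  endpoint is a null set. This turns covariances, which are Lebesgue integrals, into the interval
  integrals by which \<open>kappa\<close> is defined.\<close>

lemma integral_inner_indicators:
  fixes K :: "real \<Rightarrow> real^'p^'k" and L :: "real \<Rightarrow> real^'p^'m"
  assumes K: "continuous_on {0..s} K" and L: "continuous_on {0..t} L"
  shows "(\<integral>u. (indicator {0<..s} u *\<^sub>R K u $ i) \<bullet> (indicator {0<..t} u *\<^sub>R L u $ j) \<partial>lborel)
    = integral {0..min s t} (\<lambda>u. K u ** transpose (L u)) $ i $ j"
proof -
  have K': "continuous_on {0..min s t} K" and L': "continuous_on {0..min s t} L"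
    by (auto intro: continuous_on_subset[OF K] continuous_on_subset[OF L])
  have c: "continuous_on {0..min s t} (\<lambda>u. K u ** transpose (L u))" by (intro continuous_intros K' L')
  have c': "continuous_on {0..min s t} (\<lambda>u. (K u ** transpose (L u)) $ i $ j)" by (intro continuous_intros c)
  have KL: "(K u ** transpose (L u)) $ i $ j = K u $ i \<bullet> L u $ j" for u
    by (simp add: matrix_matrix_mult_def transpose_def inner_vec_def)
  have int: "set_integrable lborel {0..min s t} (\<lambda>u. (K u ** transpose (L u)) $ i $ j)"
    by (rule borel_integrable_atLeastAtMost'[OF c'])
  have int': "set_integrable lborel {0<..min s t} (\<lambda>u. (K u ** transpose (L u)) $ i $ j)"
    by (rule set_integrable_subset[OF int]) auto
  have "(\<integral>u. (indicator {0<..s} u *\<^sub>R K u $ i) \<bullet> (indicator {0<..t} u *\<^sub>R L u $ j) \<partial>lborel)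
      = (\<integral>u. indicator {0<..min s t} u *\<^sub>R ((K u ** transpose (L u)) $ i $ j) \<partial>lborel)"
    by (intro Bochner_Integration.integral_cong) (auto simp: indicator_def KL)
  also have "\<dots> = (\<integral>u. indicator {0..min s t} u *\<^sub>R ((K u ** transpose (L u)) $ i $ j) \<partial>lborel)"
  proof (rule integral_cong_AE)
    show "AE u in lborel. indicator {0<..min s t} u *\<^sub>R ((K u ** transpose (L u)) $ i $ j) =
        indicator {0..min s t} u *\<^sub>R ((K u ** transpose (L u)) $ i $ j)"
      using AE_lborel_singleton[of "0::real"] by eventually_elim (auto simp: indicator_def)
  qed (use int int' in \<open>auto simp: set_integrable_def\<close>)
  also have "\<dots> = integral {0..min s t} (\<lambda>u. (K u ** transpose (L u)) $ i $ j)"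
    using set_borel_integral_eq_integral(2)[OF int] by (simp add: set_lebesgue_integral_def)
  finally show ?thesis by (simp add: integral_entry[OF c])
qed

lemma (in wiener) wiener_integral_matrix_mult:
  fixes A :: "real^'m^'k" and K :: "real \<Rightarrow> real^'p^'m"
  assumes "\<And>b. wiener_integral M B (\<lambda>u. indicator {0<..t} u *\<^sub>R (K u $ b)) (\<lambda>\<omega>. N \<omega> $ b)"
  shows "wiener_integral M B (\<lambda>u. indicator {0<..t} u *\<^sub>R ((A ** K u) $ a)) (\<lambda>\<omega>. (A *v N \<omega>) $ a)"
proof -
  have "wiener_integral M B (\<lambda>u. \<Sum>b\<in>UNIV. A $ a $ b *\<^sub>R (indicator {0<..t} u *\<^sub>R (K u $ b))) (\<lambda>\<omega>. \<Sum>b\<in>UNIV. A $ a $ b * N \<omega> $ b)"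
    by (intro wiener_integral_sum wiener_integral_scale assms)
  moreover have "(\<Sum>b\<in>UNIV. A $ a $ b *\<^sub>R (indicator {0<..t} u *\<^sub>R (K u $ b))) = indicator {0<..t} u *\<^sub>R ((A ** K u) $ a)" for u
    by (simp add: vec_eq_iff matrix_matrix_mult_def sum_distrib_left mult_ac)
  ultimately show ?thesis by (simp add: matrix_vector_mult_def)
qed

section \<open>The linear process seen from time 0\<close>

context linear_sde
begin

text \<open>The matrix \<open>P\<close> of the overview, the covariance of
  \<open>E 0 t *v Z t\<close>. Pulled back to time 0, the noise on an interval has a plain
  difference as covariance, without propagation factors.\<close>

definition noise_cov :: "real \<Rightarrow> real^'d^'d" where
  "noise_cov t = integral {0..t} (\<lambda>u. (E 0 u ** \<Sigma> u) ** transpose (E 0 u ** \<Sigma> u))"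

definition drift :: "real \<Rightarrow> real^'d" where
  "drift t = integral {0..t} (\<lambda>u. E 0 u *v r u)"

lemma continuous_on_sub: "0 \<le> s \<Longrightarrow> continuous_on {0..} f \<Longrightarrow> continuous_on {s..t} f" for s t :: real
  by (rule continuous_on_subset) auto

lemma noise_cont: "continuous_on {0..} (\<lambda>u. (E 0 u ** \<Sigma> u) ** transpose (E 0 u ** \<Sigma> u))"
  by (intro continuous_intros E0_cont \<Sigma>_cont)

lemma integral_noise: "0 \<le> s \<Longrightarrow> s \<le> t \<Longrightarrow>
    integral {s..t} (\<lambda>u. (E 0 u ** \<Sigma> u) ** transpose (E 0 u ** \<Sigma> u)) = noise_cov t - noise_cov s"
  using Henstock_Kurzweil_Integration.integral_combine[of 0 s t, OF _ _ integrable_continuous_interval[OF continuous_on_sub[OF _ noise_cont]]]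
  by (simp add: noise_cov_def algebra_simps)

lemma integral_drift: "0 \<le> s \<Longrightarrow> s \<le> t \<Longrightarrow> integral {s..t} (\<lambda>u. E 0 u *v r u) = drift t - drift s"
proof -
  assume s: "0 \<le> s" "s \<le> t"
  have c: "continuous_on {0..} (\<lambda>u. E 0 u *v r u)" by (intro continuous_intros E0_cont r_cont)
  show ?thesis
    using Henstock_Kurzweil_Integration.integral_combine[of 0 s t, OF _ _ integrable_continuous_interval[OF continuous_on_sub[OF _ c]]] s
    by (simp add: drift_def algebra_simps)
qed

lemma transpose_noise_cov: "transpose (noise_cov t) = noise_cov t"
  unfolding noise_cov_def
  by (subst transpose_integral[OF continuous_on_sub[OF order_refl noise_cont]])
     (simp add: matrix_transpose_mul transpose_transpose)

text \<open>\<open>E t u = E t 0 ** E 0 u\<close> takes the dependence on the final time out of the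
  integral.\<close>

lemma kappa_eq:
  assumes "0 \<le> s" "s \<le> t"
  shows "kappa E \<Sigma> s t = E t 0 ** (noise_cov t - noise_cov s) ** transpose (E t 0)"
proof -
  have "kappa E \<Sigma> s t = integral {s..t} (\<lambda>u. E t 0 ** ((E 0 u ** \<Sigma> u) ** transpose (E 0 u ** \<Sigma> u)) ** transpose (E t 0))"
    unfolding kappa_def
  proof (rule Henstock_Kurzweil_Integration.integral_cong)
    fix u assume "u \<in> {s..t}"
    then have "E t u = E t 0 ** E 0 u" using assms by (intro E_mult[symmetric]) auto
    then show "E t u ** \<Sigma> u ** transpose (\<Sigma> u) ** transpose (E t u) =
        E t 0 ** ((E 0 u ** \<Sigma> u) ** transpose (E 0 u ** \<Sigma> u)) ** transpose (E t 0)"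
      by (simp add: matrix_transpose_mul matrix_mul_assoc)
  qed
  then show ?thesis
    by (simp only: integral_matrix_mult[OF continuous_on_sub[OF assms(1) noise_cont]] integral_noise[OF assms])
qed

lemma Gam_eq:
  assumes "0 \<le> s" "s \<le> t"
  shows "Gam E \<Sigma> s t = E s 0 ** (noise_cov t - noise_cov s) ** transpose (E t 0)"
  unfolding Gam_def kappa_eq[OF assms] using E_mult[of s t 0] assms by (simp add: matrix_mul_assoc)

lemma E_transpose_inverse:
  assumes "0 \<le> t"
  shows "transpose (E t 0) ** transpose (E 0 t) = mat 1" "transpose (E 0 t) ** transpose (E t 0) = mat 1"
  using E_inverse[OF assms] by (simp_all add: matrix_transpose_mul[symmetric] transpose_mat)

text \<open>Multiplication by \<open>E t 0\<close> undoes the pullback, so integrand and centring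
  become those of \<open>Z t\<close> itself.\<close>

lemma linear_process_kernel:
  assumes Z: "linear_process M F B Q r \<Sigma> x Z" and t: "0 \<le> t"
  shows "wiener_integral M B (\<lambda>u. indicator {0<..t} u *\<^sub>R ((E t 0 ** (E 0 u ** \<Sigma> u)) $ a))
    (\<lambda>\<omega>. Z t \<omega> $ a - (E t 0 *v (x + drift t)) $ a)"
proof -
  have "wiener_integral M B (\<lambda>u. indicator {0<..t} u *\<^sub>R ((E t 0 ** (E 0 u ** \<Sigma> u)) $ a))
    (\<lambda>\<omega>. (E t 0 *v (E 0 t *v Z t \<omega> - x - drift t)) $ a)"
    unfolding drift_def by (rule wiener_integral_matrix_mult[OF linear_process_wiener_integral[OF Z t]])
  moreover have "E t 0 *v (E 0 t *v Z t \<omega> - x - drift t) = Z t \<omega> - E t 0 *v (x + drift t)" for \<omega>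
    by (simp add: matrix_vector_mult_diff_distrib matrix_vector_right_distrib matrix_vector_mul_assoc E_inverse[OF t])
  ultimately show ?thesis by simp
qed

lemma linear_process_cov:
  assumes "0 \<le> s" "0 \<le> t"
  shows "(\<integral>u. (indicator {0<..s} u *\<^sub>R ((E s 0 ** (E 0 u ** \<Sigma> u)) $ a)) \<bullet> (indicator {0<..t} u *\<^sub>R ((E t 0 ** (E 0 u ** \<Sigma> u)) $ b)) \<partial>lborel)
    = (E s 0 ** noise_cov (min s t) ** transpose (E t 0)) $ a $ b"
proof -
  have c: "continuous_on {0..v} (\<lambda>u. E w 0 ** (E 0 u ** \<Sigma> u))" for v w
    by (intro continuous_intros continuous_on_sub E0_cont \<Sigma>_cont) auto
  have "(\<lambda>u. (E s 0 ** (E 0 u ** \<Sigma> u)) ** transpose (E t 0 ** (E 0 u ** \<Sigma> u)))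
      = (\<lambda>u. E s 0 ** ((E 0 u ** \<Sigma> u) ** transpose (E 0 u ** \<Sigma> u)) ** transpose (E t 0))"
    by (simp add: matrix_transpose_mul matrix_mul_assoc)
  then show ?thesis
    unfolding integral_inner_indicators[OF c c]
    by (simp only: integral_matrix_mult[OF continuous_on_sub[OF order_refl noise_cont]] noise_cov_def)
qed

end

section \<open>The bridge: remaining noise, covariance and mean\<close>

locale bridge = linear_sde M F B Q E r \<Sigma>
  for M :: "'w measure" and F and B :: "real \<Rightarrow> 'w \<Rightarrow> real^'p"
    and Q :: "real \<Rightarrow> real^'d^'d" and E and r and \<Sigma> +
  fixes T :: real
  assumes T_pos: "0 < T" and kappa_pos: "\<And>s u. 0 \<le> s \<Longrightarrow> s < u \<Longrightarrow> pos_definite (kappa E \<Sigma> s u)"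
begin

text \<open>The matrix \<open>J\<close> of the overview: the noise still to come between
  \<open>s\<close> and \<open>T\<close>, seen from time 0.\<close>

definition rest_cov :: "real \<Rightarrow> real^'d^'d" where
  "rest_cov s = noise_cov T - noise_cov s"

definition rest_inv :: "real \<Rightarrow> real^'d^'d" where
  "rest_inv s = matrix_inv (rest_cov s)"

text \<open>Positive definiteness enters here: \<open>rest_cov s\<close> is congruent to
  \<open>kappa E \<Sigma> s T\<close> through the invertible \<open>E 0 T\<close>.\<close>

lemma rest_inverse:
  assumes s: "0 \<le> s" "s < T"
  shows "rest_cov s ** rest_inv s = mat 1" "rest_inv s ** rest_cov s = mat 1"
proof -
  have "kappa E \<Sigma> s T = E T 0 ** rest_cov s ** transpose (E T 0)"
    using kappa_eq[of s T] s by (simp add: rest_cov_def)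
  then have "E 0 T ** kappa E \<Sigma> s T ** transpose (E 0 T) = (E 0 T ** E T 0) ** rest_cov s ** (transpose (E T 0) ** transpose (E 0 T))"
    by (simp add: matrix_mul_assoc)
  also have "\<dots> = rest_cov s" using T_pos by (simp add: E_inverse E_transpose_inverse)
  finally have eq: "rest_cov s = E 0 T ** kappa E \<Sigma> s T ** transpose (E 0 T)" ..
  have "invertible (E 0 T)" using E_inverse[of T] T_pos by (auto simp: invertible_def)
  moreover from this have "invertible (transpose (E 0 T))" by (simp add: transpose_invertible)
  moreover have "invertible (kappa E \<Sigma> s T)" by (rule pos_definite_invertible[OF kappa_pos[OF s]])
  ultimately have "invertible (rest_cov s)" unfolding eq by (intro invertible_mult)
  then show "rest_cov s ** rest_inv s = mat 1" "rest_inv s ** rest_cov s = mat 1"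
    by (simp_all add: rest_inv_def matrix_inv_mult)
qed

lemma transpose_rest_cov: "transpose (rest_cov s) = rest_cov s"
  by (simp add: rest_cov_def transpose_diff transpose_noise_cov)

lemma transpose_rest_inv:
  assumes "0 \<le> s" "s < T"
  shows "transpose (rest_inv s) = rest_inv s"
proof -
  have "rest_cov s ** transpose (rest_inv s) = mat 1"
    using arg_cong[OF rest_inverse(2)[OF assms], of transpose]
    by (simp add: matrix_transpose_mul transpose_rest_cov transpose_mat)
  from matrix_inv_eqI[OF this] show ?thesis by (simp add: rest_inv_def)
qed

lemma Gam_T_eq: "0 \<le> s \<Longrightarrow> s < T \<Longrightarrow> Gam E \<Sigma> s T = E s 0 ** rest_cov s ** transpose (E T 0)"
  by (simp add: Gam_eq rest_cov_def)

lemma matrix_inv_Gam_T: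
  assumes s: "0 \<le> s" "s < T"
  shows "matrix_inv (Gam E \<Sigma> s T) = transpose (E 0 T) ** rest_inv s ** E 0 s"
proof (rule matrix_inv_eqI)
  have "Gam E \<Sigma> s T ** (transpose (E 0 T) ** rest_inv s ** E 0 s) =
     E s 0 ** (rest_cov s ** (transpose (E T 0) ** transpose (E 0 T)) ** rest_inv s) ** E 0 s"
    by (simp add: Gam_T_eq s matrix_mul_assoc)
  also have "\<dots> = mat 1" using T_pos s by (simp add: E_transpose_inverse rest_inverse E_inverse)
  finally show "Gam E \<Sigma> s T ** (transpose (E 0 T) ** rest_inv s ** E 0 s) = mat 1" .
qed

lemma rest_cov_cont: "s < T \<Longrightarrow> continuous_on {0..s} rest_cov"
  unfolding rest_cov_def noise_cov_def
  by (intro continuous_intros indefinite_integral_continuous_1 integrable_continuous_interval continuous_on_sub noise_cont) auto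

text \<open>The interval ends before \<open>T\<close>, where \<open>rest_cov\<close> vanishes and
  has no inverse.\<close>

lemma rest_inv_cont: "s < T \<Longrightarrow> continuous_on {0..s} rest_inv"
  by (rule continuous_on_matrix_inverse[OF rest_cov_cont]) (auto simp: rest_inverse)

text \<open>The derivative of \<open>rest_inv\<close> is the integrand, because that of \<open>rest_cov\<close> is minus the middle factor.\<close>
lemma integral_rest_inv:
  assumes s: "0 \<le> s" "s < T"
  shows "integral {0..s} (\<lambda>u. rest_inv u ** ((E 0 u ** \<Sigma> u) ** transpose (E 0 u ** \<Sigma> u)) ** rest_inv u) = rest_inv s - rest_inv 0"
proof -
  let ?S = "\<lambda>u. (E 0 u ** \<Sigma> u) ** transpose (E 0 u ** \<Sigma> u)"
  have c: "continuous_on {0..s} (\<lambda>u. rest_inv u ** ?S u ** rest_inv u)"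
    by (intro continuous_intros rest_inv_cont s continuous_on_sub E0_cont \<Sigma>_cont) auto
  have d: "(rest_cov has_vector_derivative - ?S u) (at u within {0..s})" if u: "u \<in> {0..s}" for u
  proof -
    have "((\<lambda>u. noise_cov T - noise_cov u) has_vector_derivative 0 - ?S u) (at u within {0..s})"
      unfolding noise_cov_def
      by (intro has_vector_derivative_diff has_vector_derivative_const integral_has_vector_derivative continuous_on_sub noise_cont u) simp
    then show ?thesis by (simp add: rest_cov_def[abs_def])
  qed
  have "((\<lambda>u. (rest_inv u ** ?S u ** rest_inv u) $ i $ j) has_integral (rest_inv s $ i $ j - rest_inv 0 $ i $ j)) {0..s}" for i j
  proof (rule fundamental_theorem_of_calculus[OF s(1)])
    fix u assume u: "u \<in> {0..s}"
    have "((\<lambda>y. rest_inv y $ i $ j) has_real_derivative (- (rest_inv u ** (- ?S u) ** rest_inv u)) $ i $ j) (at u within {0..s})"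
      by (rule has_real_derivative_matrix_inverse[OF d[OF u] u]) (use s in \<open>auto simp: rest_inverse intro: rest_inv_cont\<close>)
    moreover have "- (rest_inv u ** (- ?S u) ** rest_inv u) = rest_inv u ** ?S u ** rest_inv u"
    proof -
      have "rest_inv u ** (0 - ?S u) ** rest_inv u = 0 - rest_inv u ** ?S u ** rest_inv u"
        unfolding matrix_diff_ldistrib matrix_diff_rdistrib by simp
      then show ?thesis by simp
    qed
    ultimately show "((\<lambda>u. rest_inv u $ i $ j) has_vector_derivative (rest_inv u ** ?S u ** rest_inv u) $ i $ j) (at u within {0..s})"
      by (simp add: has_real_derivative_iff_has_vector_derivative)
  qed
  then show ?thesis by (simp add: vec_eq_iff integral_entry[OF c] integral_unique)
qed

text \<open>The factor \<open>transpose (E T 0)\<close> of \<open>Gam\<close> at time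
  \<open>t\<close> cancels \<open>transpose (E 0 T)\<close> from the inverse at time
  \<open>u\<close>, so the terminal time acts only through the remaining noise.\<close>

lemma bridge_kernel:
  assumes U: "linear_process_bridge M F B E r \<Sigma> T a b U" and t: "0 \<le> t" "t < T"
  shows "wiener_integral M B (\<lambda>u. indicator {0<..t} u *\<^sub>R ((E t 0 ** rest_cov t ** (rest_inv u ** (E 0 u ** \<Sigma> u))) $ k))
    (\<lambda>\<omega>. U t \<omega> $ k - bridge_mean E r \<Sigma> T a b 0 t $ k)"
proof -
  have tin: "t \<in> {0..T}" "t \<in> {0..<T}" using t by auto
  obtain I where Um: "U t \<in> borel_measurable M"
    and I: "has_ito_integral M F B (\<lambda>u \<omega>. matrix_inv (Gam E \<Sigma> u T) ** \<Sigma> u) t (I t)"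
    and eq: "AE \<omega> in M. \<forall>t\<in>{0..<T}. U t \<omega> = bridge_mean E r \<Sigma> T a b 0 t + Gam E \<Sigma> t T *v I t \<omega>"
    using U tin unfolding linear_process_bridge_def ito_integral_process_def by blast
  have inv: "matrix_inv (Gam E \<Sigma> u T) ** \<Sigma> u = transpose (E 0 T) ** (rest_inv u ** (E 0 u ** \<Sigma> u))" if "u \<in> {0..t}" for u
    using that t by (simp add: matrix_inv_Gam_T matrix_mul_assoc)
  have "continuous_on {0..t} (\<lambda>u. transpose (E 0 T) ** (rest_inv u ** (E 0 u ** \<Sigma> u)))"
    by (intro continuous_intros rest_inv_cont t continuous_on_sub E0_cont \<Sigma>_cont) auto
  then have c: "continuous_on {0..t} (\<lambda>u. matrix_inv (Gam E \<Sigma> u T) ** \<Sigma> u)"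
    by (rule continuous_on_eq) (simp add: inv)
  have "wiener_integral M B (\<lambda>u. indicator {0<..t} u *\<^sub>R ((Gam E \<Sigma> t T ** (matrix_inv (Gam E \<Sigma> u T) ** \<Sigma> u)) $ k)) (\<lambda>\<omega>. (Gam E \<Sigma> t T *v I t \<omega>) $ k)"
    by (rule wiener_integral_matrix_mult[OF has_ito_integral_continuous[OF I c]])
  moreover have "indicator {0<..t} u *\<^sub>R ((Gam E \<Sigma> t T ** (matrix_inv (Gam E \<Sigma> u T) ** \<Sigma> u)) $ k)
     = indicator {0<..t} u *\<^sub>R ((E t 0 ** rest_cov t ** (rest_inv u ** (E 0 u ** \<Sigma> u))) $ k)" for u
  proof (cases "u \<in> {0<..t}")
    case True
    then have u: "u \<in> {0..t}" by simp
    have "Gam E \<Sigma> t T ** (matrix_inv (Gam E \<Sigma> u T) ** \<Sigma> u) =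
        E t 0 ** rest_cov t ** (transpose (E T 0) ** transpose (E 0 T)) ** (rest_inv u ** (E 0 u ** \<Sigma> u))"
      unfolding inv[OF u] Gam_T_eq[OF t] by (simp only: matrix_mul_assoc)
    then show ?thesis using T_pos by (simp add: E_transpose_inverse)
  qed simp
  ultimately have W: "wiener_integral M B (\<lambda>u. indicator {0<..t} u *\<^sub>R ((E t 0 ** rest_cov t ** (rest_inv u ** (E 0 u ** \<Sigma> u))) $ k))
     (\<lambda>\<omega>. (Gam E \<Sigma> t T *v I t \<omega>) $ k)" by simp
  show ?thesis
  proof (rule wiener_integral_cong_AE[OF W])
    show "(\<lambda>\<omega>. U t \<omega> $ k - bridge_mean E r \<Sigma> T a b 0 t $ k) \<in> borel_measurable M"
      using Um by measurable
    show "AE \<omega> in M. (Gam E \<Sigma> t T *v I t \<omega>) $ k = U t \<omega> $ k - bridge_mean E r \<Sigma> T a b 0 t $ k"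
      using eq by eventually_elim (use t in auto)
  qed
qed

text \<open>Write \<open>P\<close> for \<open>noise_cov\<close> and \<open>J\<close> for
  \<open>rest_cov\<close>. The inverse at the earlier time cancels the matching factor and leaves
  \<open>J (max s t)\<close>, while \<open>J s ** rest_inv 0 ** J t\<close> expands through
  \<open>P T = J 0\<close> to \<open>J t - P s + P s ** rest_inv 0 ** P t\<close>. In the difference
  \<open>P T\<close> cancels, and \<open>P s + P t - P (max s t)\<close> is
  \<open>P (min s t)\<close>.\<close>

lemma bridge_cov_algebra:
  assumes s: "0 \<le> s" "s < T" and t: "0 \<le> t" "t < T"
  shows "rest_cov s ** (rest_inv (min s t) - rest_inv 0) ** rest_cov t
    = noise_cov (min s t) - noise_cov s ** rest_inv 0 ** noise_cov t"
proof -
  have 0: "rest_cov 0 = noise_cov T" by (simp add: rest_cov_def noise_cov_def)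
  note inv0 = rest_inverse[OF order_refl T_pos]
  have Jl: "rest_cov v ** rest_inv 0 = mat 1 - noise_cov v ** rest_inv 0" for v
    using inv0(1) by (simp add: 0 rest_cov_def[of v] matrix_diff_rdistrib)
  have Jr: "rest_inv 0 ** rest_cov v = mat 1 - rest_inv 0 ** noise_cov v" for v
    using inv0(2) by (simp add: 0 rest_cov_def[of v] matrix_diff_ldistrib)
  have sym: "rest_cov s ** rest_inv 0 ** rest_cov t = rest_cov t - noise_cov s + noise_cov s ** rest_inv 0 ** noise_cov t"
    by (simp add: Jl matrix_diff_rdistrib matrix_mul_assoc[symmetric] Jr matrix_diff_ldistrib)
  have main: "rest_cov s ** (rest_inv (min s t)) ** rest_cov t = rest_cov (max s t)"
  proof (cases "s \<le> t")
    case True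
    then show ?thesis using rest_inverse(1)[OF s] by (simp add: min_def max_def)
  next
    case False
    then show ?thesis using rest_inverse(2)[OF t] by (simp add: min_def max_def matrix_mul_assoc[symmetric])
  qed
  have "rest_cov s ** (rest_inv (min s t) - rest_inv 0) ** rest_cov t
      = rest_cov (max s t) - (rest_cov t - noise_cov s + noise_cov s ** rest_inv 0 ** noise_cov t)"
    by (simp add: matrix_diff_ldistrib matrix_diff_rdistrib main sym)
  also have "\<dots> = noise_cov (min s t) - noise_cov s ** rest_inv 0 ** noise_cov t"
    by (simp add: rest_cov_def min_def max_def)
  finally show ?thesis .
qed

text \<open>The factors \<open>rest_cov s\<close> and \<open>rest_cov t\<close> do not depend on
  \<open>u\<close>, so what is integrated between them is the derivative of \<open>rest_inv\<close>.
  The outcome is the conditional covariance of the values of \<open>Z\<close> at \<open>s\<close>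
  and \<open>t\<close> given the terminal value.\<close>

lemma bridge_cov:
  assumes s: "0 \<le> s" "s < T" and t: "0 \<le> t" "t < T"
  shows "(\<integral>u. (indicator {0<..s} u *\<^sub>R ((E s 0 ** rest_cov s ** (rest_inv u ** (E 0 u ** \<Sigma> u))) $ k))
      \<bullet> (indicator {0<..t} u *\<^sub>R ((E t 0 ** rest_cov t ** (rest_inv u ** (E 0 u ** \<Sigma> u))) $ l)) \<partial>lborel)
    = (E s 0 ** (noise_cov (min s t) - noise_cov s ** rest_inv 0 ** noise_cov t) ** transpose (E t 0)) $ k $ l"
proof -
  let ?S = "\<lambda>u. (E 0 u ** \<Sigma> u) ** transpose (E 0 u ** \<Sigma> u)"
  have c: "continuous_on {0..v} (\<lambda>u. E v 0 ** rest_cov v ** (rest_inv u ** (E 0 u ** \<Sigma> u)))" if "v < T" for v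
    by (intro continuous_intros rest_inv_cont that continuous_on_sub E0_cont \<Sigma>_cont) auto
  have m: "0 \<le> min s t" "min s t < T" using s t by auto
  have cS: "continuous_on {0..min s t} (\<lambda>u. rest_inv u ** ?S u ** rest_inv u)"
    by (intro continuous_intros rest_inv_cont m continuous_on_sub E0_cont \<Sigma>_cont) auto
  have "integral {0..min s t} (\<lambda>u. (E s 0 ** rest_cov s ** (rest_inv u ** (E 0 u ** \<Sigma> u))) ** transpose (E t 0 ** rest_cov t ** (rest_inv u ** (E 0 u ** \<Sigma> u))))
     = integral {0..min s t} (\<lambda>u. (E s 0 ** rest_cov s) ** (rest_inv u ** ?S u ** rest_inv u) ** (rest_cov t ** transpose (E t 0)))"
  proof (rule Henstock_Kurzweil_Integration.integral_cong)
    fix u assume u: "u \<in> {0..min s t}"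
    then have "transpose (rest_inv u) = rest_inv u" using s t by (intro transpose_rest_inv) auto
    then show "(E s 0 ** rest_cov s ** (rest_inv u ** (E 0 u ** \<Sigma> u))) ** transpose (E t 0 ** rest_cov t ** (rest_inv u ** (E 0 u ** \<Sigma> u)))
       = (E s 0 ** rest_cov s) ** (rest_inv u ** ?S u ** rest_inv u) ** (rest_cov t ** transpose (E t 0))"
      by (simp add: matrix_transpose_mul transpose_rest_cov matrix_mul_assoc)
  qed
  also have "\<dots> = (E s 0 ** rest_cov s) ** (rest_inv (min s t) - rest_inv 0) ** (rest_cov t ** transpose (E t 0))"
    by (simp only: integral_matrix_mult[OF cS] integral_rest_inv[OF m])
  also have "\<dots> = E s 0 ** (rest_cov s ** (rest_inv (min s t) - rest_inv 0) ** rest_cov t) ** transpose (E t 0)"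
    by (simp add: matrix_mul_assoc)
  finally show ?thesis
    unfolding integral_inner_indicators[OF c[OF s(2)] c[OF t(2)]] bridge_cov_algebra[OF s t] by simp
qed

text \<open>The right side is the regression formula: \<open>E s 0 *v (a + drift s)\<close> is the
  mean of \<open>Z s\<close>, and the matrix in front of \<open>b - E T 0 *v (a + drift T)\<close>
  is the covariance of \<open>Z s\<close> with \<open>Z T\<close> times the inverse covariance of
  \<open>Z T\<close>.\<close>

lemma bridge_mean_eq:
  assumes s: "0 \<le> s" "s < T"
  shows "bridge_mean E r \<Sigma> T a b 0 s =
    E s 0 *v (a + drift s) + (E s 0 ** noise_cov s ** rest_inv 0 ** E 0 T) *v (b - E T 0 *v (a + drift T))"
proof -
  have 0: "rest_cov 0 = noise_cov T" "noise_cov 0 = 0" by (simp_all add: rest_cov_def noise_cov_def)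
  note inv0 = rest_inverse[OF order_refl T_pos]
  have T: "0 \<le> T" using T_pos by simp
  have E00: "E 0 0 = mat 1" by (rule E_same) simp
  have Jl: "rest_cov s ** rest_inv 0 = mat 1 - noise_cov s ** rest_inv 0"
    using inv0(1) by (simp add: 0 rest_cov_def[of s] matrix_diff_rdistrib)
  have G1: "Gam E \<Sigma> s T ** matrix_inv (Gam E \<Sigma> 0 T) = E s 0 ** (mat 1 - noise_cov s ** rest_inv 0)"
  proof -
    have "Gam E \<Sigma> s T ** matrix_inv (Gam E \<Sigma> 0 T) = E s 0 ** rest_cov s ** (transpose (E T 0) ** transpose (E 0 T)) ** rest_inv 0 ** E 0 0"
      unfolding Gam_T_eq[OF s] matrix_inv_Gam_T[OF order_refl T_pos] by (simp only: matrix_mul_assoc)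
    also have "\<dots> = E s 0 ** (rest_cov s ** rest_inv 0)"
      by (simp add: E_transpose_inverse[OF T] E00 matrix_mul_assoc)
    finally show ?thesis unfolding Jl .
  qed
  have t1: "transpose (Gam E \<Sigma> 0 s) = E s 0 ** noise_cov s"
    using s by (simp add: Gam_eq E00 0 matrix_transpose_mul transpose_noise_cov)
  have t2: "matrix_inv (transpose (Gam E \<Sigma> 0 T)) = rest_inv 0 ** E 0 T"
  proof (rule matrix_inv_eqI)
    have "transpose (Gam E \<Sigma> 0 T) ** (rest_inv 0 ** E 0 T) = E T 0 ** (rest_cov 0 ** rest_inv 0) ** E 0 T"
      using T_pos by (simp add: Gam_T_eq E00 matrix_transpose_mul transpose_rest_cov matrix_mul_assoc)
    then show "transpose (Gam E \<Sigma> 0 T) ** (rest_inv 0 ** E 0 T) = mat 1"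
      by (simp add: inv0 E_inverse[OF T])
  qed
  have mp: "m_plus E r a 0 s = a + drift s" by (simp add: m_plus_def drift_def)
  have mm: "m_minus E r b s T = b - E T 0 *v (drift T - drift s)"
  proof -
    have c: "continuous_on {0..} (\<lambda>u. E 0 u *v r u)" by (intro continuous_intros E0_cont r_cont)
    have "integral {s..T} (\<lambda>u. E T u *v r u) = integral {s..T} (\<lambda>u. E T 0 *v (E 0 u *v r u))"
    proof (rule Henstock_Kurzweil_Integration.integral_cong)
      fix u assume "u \<in> {s..T}"
      then have "E T u = E T 0 ** E 0 u" using s T by (intro E_mult[symmetric]) auto
      then show "E T u *v r u = E T 0 *v (E 0 u *v r u)" by (simp add: matrix_vector_mul_assoc)
    qed
    also have "\<dots> = E T 0 *v (drift T - drift s)"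
      by (simp only: integral_matrix_vector_mult[OF continuous_on_sub[OF s(1) c]] integral_drift[OF s(1) less_imp_le[OF s(2)]])
    finally show ?thesis by (simp add: m_minus_def)
  qed
  \<comment> \<open>The regression matrix seen from time 0: the bridge mean combines the start
    carried forward with weight \<open>mat 1 - D\<close> and the target pulled back with weight
    \<open>D\<close>. The two terms \<open>D *v drift s\<close> cancel, which leaves the deviation
    of \<open>b\<close> from the mean at \<open>T\<close>.\<close>
  define D where "D = noise_cov s ** rest_inv 0"
  have ET: "E 0 T *v (E T 0 *v v) = v" for v by (simp add: matrix_vector_mul_assoc E_inverse[OF T])
  have "bridge_mean E r \<Sigma> T a b 0 s = E s 0 *v ((mat 1 - D) *v (a + drift s) + D *v (E 0 T *v (b - E T 0 *v (drift T - drift s))))"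
    unfolding bridge_mean_def G1 t1 t2 mp mm D_def
    by (simp add: matrix_vector_mul_assoc matrix_vector_right_distrib matrix_mul_assoc)
  also have "(mat 1 - D) *v (a + drift s) + D *v (E 0 T *v (b - E T 0 *v (drift T - drift s))) =
     (a + drift s) + D *v (E 0 T *v (b - E T 0 *v (a + drift T)))"
    by (simp add: matrix_vector_mult_diff_distrib matrix_vector_right_distrib matrix_vector_mult_diff_rdistrib ET)
  finally show ?thesis by (simp add: D_def matrix_vector_mul_assoc matrix_vector_right_distrib matrix_mul_assoc)
qed

end

section \<open>Comparison of the two Gauss laws\<close>

theorem proposition2p1:
  fixes M :: "'w measure" and F :: "real \<Rightarrow> 'w measure"
    and B :: "real \<Rightarrow> 'w \<Rightarrow> real^'p"
    and Q :: "real \<Rightarrow> real^'d^'d" and r :: "real \<Rightarrow> real^'d" and \<Sigma> :: "real \<Rightarrow> real^'p^'d"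
    and E :: "real \<Rightarrow> real \<Rightarrow> real^'d^'d"
    and Z U :: "real \<Rightarrow> 'w \<Rightarrow> real^'d"
    and a b :: "real^'d" and T :: real
    and t :: "'n::{finite,linorder} \<Rightarrow> real"
  assumes "usual_filtration M F" and "wiener_process M F B"
    and "continuous_on {0..} Q" and "continuous_on {0..} r" and "continuous_on {0..} \<Sigma>"
    and "evolution_matrices Q E"
    and "T > 0"
    and "linear_process M F B Q r \<Sigma> a Z"
    and "\<And>s u. 0 \<le> s \<Longrightarrow> s < u \<Longrightarrow> pos_definite (kappa E \<Sigma> s u)"
    and "linear_process_bridge M F B E r \<Sigma> T a b U"
    and "strict_mono t" and "\<And>i. 0 < t i" and "\<And>i. t i < T"
  shows "(\<exists>K. gauss_cond_distr M (fdd_vec t Z) (Z T) K) \<and>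
         (\<forall>K. gauss_cond_distr M (fdd_vec t Z) (Z T) K \<longrightarrow>
                K b = distr M borel (fdd_vec t U))"
proof -
  interpret bridge M F B Q E r \<Sigma> T
    by (intro bridge.intro linear_sde.intro wiener.intro wiener_axioms.intro evolution.intro
        linear_sde_axioms.intro bridge_axioms.intro assms)
       (use assms(1) in \<open>simp add: usual_filtration_def\<close>)
  have t0: "0 \<le> t i" and tT: "t i < T" for i using assms(12)[of i] assms(13)[of i] by auto
  have T: "0 \<le> T" using assms(7) by simp
  let ?X = "fdd_vec t Z" and ?W = "Z T"
  let ?mX = "\<chi> p. (E (t (fst p)) 0 *v (a + drift (t (fst p)))) $ snd p"
  let ?mW = "E T 0 *v (a + drift T)"
  let ?mU = "\<chi> p. bridge_mean E r \<Sigma> T a b 0 (t (fst p)) $ snd p"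
  let ?K = "\<lambda>s u. E s 0 ** (E 0 u ** \<Sigma> u)"
  have X: "wiener_integral M B (\<lambda>u. indicator {0<..t (fst p)} u *\<^sub>R (?K (t (fst p)) u $ snd p)) (\<lambda>\<omega>. ?X \<omega> $ p - ?mX $ p)" for p
    using linear_process_kernel[OF assms(8) t0] by (simp add: fdd_vec_def)
  have W: "wiener_integral M B (\<lambda>u. indicator {0<..T} u *\<^sub>R (?K T u $ k)) (\<lambda>\<omega>. ?W \<omega> $ k - ?mW $ k)" for k
    by (rule linear_process_kernel[OF assms(8) T])
  have U: "wiener_integral M B (\<lambda>u. indicator {0<..t (fst p)} u *\<^sub>R ((E (t (fst p)) 0 ** rest_cov (t (fst p)) ** (rest_inv u ** (E 0 u ** \<Sigma> u))) $ snd p))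
     (\<lambda>\<omega>. fdd_vec t U \<omega> $ p - ?mU $ p)" for p
    using bridge_kernel[OF assms(10) t0 tT] by (simp add: fdd_vec_def)
  \<comment> \<open>All observation times precede \<open>T\<close>, so the noise shared by
    \<open>Z (t i)\<close> and \<open>Z T\<close> is that up to \<open>t i\<close>.\<close>
  have minT: "min (t i) T = t i" for i using tT[of i] by simp
  have cXX: "cov_mat M ?X ?X = (\<chi> p q. (E (t (fst p)) 0 ** noise_cov (min (t (fst p)) (t (fst q))) ** transpose (E (t (fst q)) 0)) $ snd p $ snd q)"
    unfolding wiener_integral_cov_mat[OF X X] linear_process_cov[OF t0 t0] ..
  have cXW: "cov_mat M ?X ?W = (\<chi> p k. (E (t (fst p)) 0 ** noise_cov (t (fst p)) ** transpose (E T 0)) $ snd p $ k)"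
    unfolding wiener_integral_cov_mat[OF X W] linear_process_cov[OF t0 T] minT ..
  have cWW: "cov_mat M ?W ?W = E T 0 ** noise_cov T ** transpose (E T 0)"
    unfolding wiener_integral_cov_mat[OF W W] linear_process_cov[OF T T] by (simp add: vec_eq_iff)
  have n0: "rest_cov 0 = noise_cov T" by (simp add: rest_cov_def noise_cov_def)
  have WWinv: "E T 0 ** noise_cov T ** transpose (E T 0) ** (transpose (E 0 T) ** rest_inv 0 ** E 0 T) = mat 1"
  proof -
    have "E T 0 ** noise_cov T ** transpose (E T 0) ** (transpose (E 0 T) ** rest_inv 0 ** E 0 T)
       = E T 0 ** (rest_cov 0 ** (transpose (E T 0) ** transpose (E 0 T)) ** rest_inv 0) ** E 0 T"
      by (simp add: matrix_mul_assoc n0)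
    then show ?thesis
      by (simp add: E_transpose_inverse[OF T] rest_inverse[OF order_refl T_pos] E_inverse[OF T])
  qed
  then have invWW: "invertible (cov_mat M ?W ?W)"
    unfolding cWW using invertible_right_inverse by blast
  have mi: "matrix_inv (cov_mat M ?W ?W) = transpose (E 0 T) ** rest_inv 0 ** E 0 T"
    unfolding cWW by (rule matrix_inv_eqI[OF WWinv])
  \<comment> \<open>The transposed evolution factors at \<open>T\<close> cancel, which leaves the
    matrix of \<open>bridge_mean_eq\<close>, block by block.\<close>
  have reg: "cov_mat M ?X ?W ** matrix_inv (cov_mat M ?W ?W)
      = (\<chi> p k. (E (t (fst p)) 0 ** noise_cov (t (fst p)) ** rest_inv 0 ** E 0 T) $ snd p $ k)"
  proof -
    have "cov_mat M ?X ?W ** matrix_inv (cov_mat M ?W ?W) = (\<chi> p k. ((E (t (fst p)) 0 ** noise_cov (t (fst p)) ** transpose (E T 0))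
        ** (transpose (E 0 T) ** rest_inv 0 ** E 0 T)) $ snd p $ k)"
      unfolding mi cXW by (simp add: vec_eq_iff matrix_matrix_mult_def)
    moreover have "(E s 0 ** noise_cov s ** transpose (E T 0)) ** (transpose (E 0 T) ** rest_inv 0 ** E 0 T)
       = E s 0 ** noise_cov s ** (transpose (E T 0) ** transpose (E 0 T)) ** rest_inv 0 ** E 0 T" for s
      by (simp add: matrix_mul_assoc)
    ultimately show ?thesis by (simp add: E_transpose_inverse[OF T])
  qed
  have mean: "mean_vec M ?X + (cov_mat M ?X ?W ** matrix_inv (cov_mat M ?W ?W)) *v (b - mean_vec M ?W) = ?mU"
    unfolding wiener_integral_mean_vec[OF X] wiener_integral_mean_vec[OF W] reg
    by (simp add: vec_eq_iff bridge_mean_eq[OF t0 tT] matrix_vector_mult_def)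
  have cov: "cov_mat M ?X ?X - cov_mat M ?X ?W ** matrix_inv (cov_mat M ?W ?W) ** transpose (cov_mat M ?X ?W)
    = (\<chi> p q. (E (t (fst p)) 0 ** (noise_cov (min (t (fst p)) (t (fst q))) - noise_cov (t (fst p)) ** rest_inv 0 ** noise_cov (t (fst q)))
        ** transpose (E (t (fst q)) 0)) $ snd p $ snd q)"
  proof -
    have "cov_mat M ?X ?W ** matrix_inv (cov_mat M ?W ?W) ** transpose (cov_mat M ?X ?W) =
      (\<chi> p q. ((E (t (fst p)) 0 ** noise_cov (t (fst p)) ** rest_inv 0 ** E 0 T)
        ** transpose (E (t (fst q)) 0 ** noise_cov (t (fst q)) ** transpose (E T 0))) $ snd p $ snd q)"
      unfolding reg unfolding cXW by (simp add: vec_eq_iff matrix_matrix_mult_def transpose_def)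
    moreover have "(E s 0 ** noise_cov s ** rest_inv 0 ** E 0 T) ** transpose (E v 0 ** noise_cov v ** transpose (E T 0))
      = E s 0 ** (noise_cov s ** rest_inv 0 ** (E 0 T ** E T 0) ** noise_cov v) ** transpose (E v 0)" for s v
      by (simp add: matrix_transpose_mul transpose_transpose transpose_noise_cov matrix_mul_assoc)
    ultimately show ?thesis
      unfolding cXX by (simp add: vec_eq_iff E_inverse[OF T] matrix_diff_ldistrib matrix_diff_rdistrib)
  qed
  \<comment> \<open>The Gram matrix of the bridge integrands, computed by \<open>bridge_cov\<close>,
    is entry by entry the right side of \<open>cov\<close>.\<close>
  have gU: "is_gauss (distr M borel (fdd_vec t U)) ?mU
     (cov_mat M ?X ?X - cov_mat M ?X ?W ** matrix_inv (cov_mat M ?W ?W) ** transpose (cov_mat M ?X ?W))"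
    using wiener_integral_gauss[OF U] unfolding bridge_cov[OF t0 tT t0 tT] cov .
  show ?thesis
  proof (intro conjI allI impI)
    \<comment> \<open>This rules out that the second claim holds only for want of a kernel.\<close>
    show "\<exists>K. gauss_cond_distr M ?X ?W K"
      by (rule gauss_cond_distr_exists[OF wiener_integral_jointly_gauss[OF X W] invWW])
    fix K assume "gauss_cond_distr M ?X ?W K"
    \<comment> \<open>\<open>gauss_cond_distr\<close> fixes the law at every single value, so
      \<open>b\<close> may be inserted although the event \<open>Z T = b\<close> is null.\<close>
    then have "is_gauss (K b) ?mU (cov_mat M ?X ?X - cov_mat M ?X ?W ** matrix_inv (cov_mat M ?W ?W) ** transpose (cov_mat M ?X ?W))"
      unfolding gauss_cond_distr_def mean[symmetric] by blast
    then show "K b = distr M borel (fdd_vec t U)" using gU by (rule is_gauss_unique)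
  qed
qed

end
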